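(* Let $\mathbb{F}$ be a field, let $X$ be a $2n\times 2n$ generic skew-symmetric matrix of variables, and let $f(X)$ be a nonzero polynomial in the ideal generated by the Pfaffians of the $2r\times 2r$ principal submatrices of $X$. Let $h(X,\varepsilon)\in\mathbb{F}[[\varepsilon]][X]$ be any polynomial with $h(X,\varepsilon)=f(X)+O(\varepsilon)$. Let $g(\vec y)\in\mathbb{F}[\vec y]$ be a polynomial in the border of layered algebraic branching programs with at most $r$ vertices. Then there is a depth-three $h$-oracle circuit $\Phi$ defined over $\mathbb{F}(\varepsilon)$ such that: (1) $\Phi$ has $4n^2$ addition gates at the bottom layer, a single $h$-oracle gate in the middle layer, and a single addition gate at the top layer; (2) if $\mathrm{char}(\mathbb{F})=0$, then $\Phi$ computes $g(\vec y)+O(\varepsilon)$; (3) if $\mathrm{char}(\mathbb{F})=p>0$, then $\Phi$ computes $g(\vec y)^{p^k}+O(\varepsilon)$ for some $k\in\mathbb{N}$.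
   Context: A generic $2n\times 2n$ skew-symmetric matrix $X$ has $(i,j)$ entry $x_{i,j}$ with $x_{j,i}=-x_{i,j}$ (and zero diagonal), the $x_{i,j}$ for $i<j$ being independent variables. For a $2k\times 2k$ skew-symmetric matrix $A$, its Pfaffian is $\mathrm{Pf}(A)=\frac{1}{2^k k!}\sum_{\pi\in S_{2k}}\mathrm{sgn}(\pi)\prod_{i=1}^k a_{\pi(2i-1),\pi(2i)}$ (so $\mathrm{Pf}(A)^2=\det A$). A principal submatrix is one with the same row and column index set. $\varepsilon$ is an indeterminate; "$f+O(\varepsilon)$" denotes any polynomial $f+\varepsilon g$ with $g\in\mathbb{F}[[\varepsilon]][\text{variables}]$. An $h$-oracle circuit is an algebraic circuit that may additionally use gates which on inputs $a_1,\dots,a_N$ output $h(a_1,\dots,a_N)$. A layered algebraic branching program (ABP) is a DAG with layers $V_0=\{s\},V_1,\dots,V_k=\{t\}$, edges only between consecutive layers labeled by affine linear polynomials, computing the sum over $s$–$t$ paths of products of labels. $g$ is in the border of layered ABPs with at most $r$ vertices if some $\tilde g\in\mathbb{F}[\varepsilon][\vec y]$ with $\tilde g=g+O(\varepsilon)$ is computed by a layered ABP with at most $r$ vertices.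
   Formalization: The h-oracle gate evaluates h(A, ε^q) for some q ≥ 1 chosen with the circuit, instead of h(A, ε). With q = 1 forced the claim fails, e.g. over the reals for f = Pf(X)^2, g a sum of many sixth powers, and h with a suitable error term of order ε. *)

theory Defs
  imports
    "HOL-Library.Poly_Mapping"
    "HOL-Combinatorics.Permutations"
    "HOL-Computational_Algebra.Computational_Algebra"
begin

section \<open>Multivariate polynomials\<close>

type_synonym ('x, 'c) mpoly = "('x \<Rightarrow>\<^sub>0 nat) \<Rightarrow>\<^sub>0 'c"

definition mvar :: "'x \<Rightarrow> ('x, 'c::zero_neq_one) mpoly" where
  "mvar x = Poly_Mapping.single (Poly_Mapping.single x 1) 1"

definition mconst :: "'c::zero \<Rightarrow> ('x, 'c) mpoly" where
  "mconst c = Poly_Mapping.single 0 c"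

definition mvars :: "('x, 'c::zero) mpoly \<Rightarrow> 'x set" where
  "mvars p = (\<Union>m\<in>Poly_Mapping.keys p. Poly_Mapping.keys m)"

definition mcoeffs :: "('x, 'c::zero) mpoly \<Rightarrow> 'c set" where
  "mcoeffs p = Poly_Mapping.lookup p ` UNIV"

definition map_coeffs :: "('b::zero \<Rightarrow> 'c::zero) \<Rightarrow> ('x, 'b) mpoly \<Rightarrow> ('x, 'c) mpoly" where
  "map_coeffs \<phi> p = Poly_Mapping.map \<phi> p"

definition affine_linear :: "('x, 'c::zero) mpoly \<Rightarrow> bool" where
  "affine_linear p \<longleftrightarrow>
     (\<forall>m\<in>Poly_Mapping.keys p. (\<Sum>x\<in>Poly_Mapping.keys m. Poly_Mapping.lookup m x) \<le> 1)"

definition subst :: "('x \<Rightarrow> ('v, 'c::comm_ring_1) mpoly) \<Rightarrow> ('x, 'c) mpoly \<Rightarrow> ('v, 'c) mpoly" where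
  "subst a p = (\<Sum>m\<in>Poly_Mapping.keys p. mconst (Poly_Mapping.lookup p m) *
                  (\<Prod>x\<in>Poly_Mapping.keys m. a x ^ Poly_Mapping.lookup m x))"

text \<open>The ideal generated by \<open>G\<close> in the subring \<open>R\<close> of the ambient ring.\<close>

definition ideal_generated :: "'r::comm_ring_1 set \<Rightarrow> 'r set \<Rightarrow> 'r set" where
  "ideal_generated R G = {\<Sum>g\<in>T. c g * g | T c. finite T \<and> T \<subseteq> G \<and> c ` T \<subseteq> R}"


section \<open>The generic skew-symmetric matrix and its Pfaffians\<close>

text \<open>Rows and columns are indexed by \<open>{..<2 * n}\<close>. The independent variables are the
  \<open>x (i, j)\<close> with \<open>i < j\<close>.\<close>

definition skew_vars :: "nat \<Rightarrow> (nat \<times> nat) set" where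
  "skew_vars n = {(i, j). i < j \<and> j < 2 * n}"

definition skew_ring :: "nat \<Rightarrow> (nat \<times> nat, 'c::zero) mpoly set" where
  "skew_ring n = {p. mvars p \<subseteq> skew_vars n}"

definition generic_skew :: "nat \<Rightarrow> nat \<Rightarrow> (nat \<times> nat, 'c::comm_ring_1) mpoly" where
  "generic_skew i j =
     (if i < j then mvar (i, j) else if j < i then - mvar (j, i) else 0)"

text \<open>The factor \<open>1 / (2 ^ k * k!)\<close> has no meaning over a field of small positive
  characteristic. As usual, the formula is read as an identity of polynomials over the
  integers: for skew-symmetric \<open>A\<close> every coefficient of the signed sum is a multiple of
  \<open>2 ^ k * k!\<close>, so the division below is exact. The resulting integer polynomial is then
  reduced into the coefficient field.\<close>

definition pfaffian_int ::
    "nat \<Rightarrow> (nat \<Rightarrow> nat \<Rightarrow> (nat \<times> nat, int) mpoly) \<Rightarrow> (nat \<times> nat, int) mpoly" where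
  "pfaffian_int k A = map_coeffs (\<lambda>c. c div (2 ^ k * fact k))
     (\<Sum>\<pi> | \<pi> permutes {..<2 * k}. of_int (sign \<pi>) * (\<Prod>i<k. A (\<pi> (2 * i)) (\<pi> (2 * i + 1))))"

definition principal_pfaffian :: "nat set \<Rightarrow> (nat \<times> nat, 'c::comm_ring_1) mpoly" where
  "principal_pfaffian S = (let s = sorted_list_of_set S in
     map_coeffs of_int
       (pfaffian_int (card S div 2) (\<lambda>i j. generic_skew (s ! i) (s ! j))))"

definition pfaffian_ideal :: "nat \<Rightarrow> nat \<Rightarrow> (nat \<times> nat, 'c::comm_ring_1) mpoly set" where
  "pfaffian_ideal n r = ideal_generated (skew_ring n)
     {principal_pfaffian S | S. S \<subseteq> {..<2 * n} \<and> card S = 2 * r}"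


section \<open>The indeterminate \<open>\<epsilon>\<close>\<close>

text \<open>All computations take place over the Laurent series field in \<open>\<epsilon>\<close> = \<^const>\<open>fls_X\<close>,
  which contains the power series, the polynomials and the rational functions in \<open>\<epsilon>\<close>.\<close>

definition eps_poly :: "'a::field poly \<Rightarrow> 'a fls" where
  "eps_poly p = fps_to_fls (fps_of_poly p)"

definition eps_polynomials :: "'a::field fls set" where
  "eps_polynomials = {eps_poly p | p. True}"

definition eps_rational_functions :: "'a::field fls set" where
  "eps_rational_functions = {eps_poly p / eps_poly q | p q. q \<noteq> 0}"

text \<open>\<open>P = g + O(\<epsilon>)\<close>, with an error term in \<open>\<epsilon> * F[[\<epsilon>]][variables]\<close>.\<close>

definition approximates :: "('x, 'a::field fls) mpoly \<Rightarrow> ('x, 'a) mpoly \<Rightarrow> bool" where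
  "approximates P g \<longleftrightarrow> (\<exists>E :: ('x, 'a fps) mpoly.
     P = map_coeffs fls_const g + mconst fls_X * map_coeffs fps_to_fls E)"


section \<open>Layered algebraic branching programs\<close>

record (overloaded) ('v, 'c) abp =
  depth :: nat
  layer :: "nat \<Rightarrow> nat set"
  edges :: "(nat \<times> nat) set"
  label :: "nat \<times> nat \<Rightarrow> ('v, 'c) mpoly"

definition abp_vertices :: "('v, 'c) abp \<Rightarrow> nat set" where
  "abp_vertices P = (\<Union>i\<le>depth P. layer P i)"

definition is_abp_over :: "'c::comm_ring_1 set \<Rightarrow> ('v, 'c) abp \<Rightarrow> bool" where
  "is_abp_over K P \<longleftrightarrow>
     (\<exists>s. layer P 0 = {s}) \<and> (\<exists>t. layer P (depth P) = {t}) \<and>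
     (\<forall>i\<le>depth P. finite (layer P i)) \<and>
     (\<forall>i\<le>depth P. \<forall>j\<le>depth P. i \<noteq> j \<longrightarrow> layer P i \<inter> layer P j = {}) \<and>
     edges P \<subseteq> (\<Union>i<depth P. layer P i \<times> layer P (Suc i)) \<and>
     (\<forall>e\<in>edges P. affine_linear (label P e) \<and> mcoeffs (label P e) \<subseteq> K)"

definition abp_paths :: "('v, 'c) abp \<Rightarrow> nat list set" where
  "abp_paths P = {vs. length vs = Suc (depth P) \<and> (\<forall>i\<le>depth P. vs ! i \<in> layer P i) \<and>
                      (\<forall>i<depth P. (vs ! i, vs ! Suc i) \<in> edges P)}"

definition abp_poly :: "('v, 'c::comm_ring_1) abp \<Rightarrow> ('v, 'c) mpoly" where
  "abp_poly P = (\<Sum>vs\<in>abp_paths P. \<Prod>i<depth P. label P (vs ! i, vs ! Suc i))"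

text \<open>The approximating polynomial has coefficients in \<open>F[\<epsilon>]\<close>; the program computing it may
  use constants from \<open>F(\<epsilon>)\<close>.\<close>

definition border_abp :: "nat \<Rightarrow> ('v, 'a::field) mpoly \<Rightarrow> bool" where
  "border_abp r g \<longleftrightarrow> (\<exists>P :: ('v, 'a fls) abp.
     is_abp_over eps_rational_functions P \<and> card (abp_vertices P) \<le> r \<and>
     mcoeffs (abp_poly P) \<subseteq> eps_polynomials \<and> approximates (abp_poly P) g)"


section \<open>Oracle circuits\<close>

text \<open>A circuit is a list of gates in topological order whose last gate is the output; wires
  refer to gates by position. Addition gates carry a scalar on each input wire.

  An oracle gate \<open>GOracle q W\<close> reads the \<open>2n \<times> 2n\<close> matrix whose \<open>(i, j)\<close> entry is the value
  of gate \<open>W i j\<close>, and evaluates \<open>h(X, \<epsilon>)\<close> at that matrix. As usual for border computations,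
  \<open>h\<close> is an approximation of \<open>f\<close> whose parameter may be rescaled: the \<open>\<epsilon>\<close>-argument of \<open>h\<close> is
  fed with \<open>\<epsilon> ^ q\<close> for some \<open>q \<ge> 1\<close>. The rescaling is
  needed: if \<open>f\<close> is the square of a Pfaffian and char F = 0, then \<open>g\<close> has to be read off from
  a lower-order term, as in \<open>(1 + \<epsilon> * g)\<^sup>2 = 1 + 2 * \<epsilon> * g + O(\<epsilon>\<^sup>2)\<close>, and an arbitrary error of
  order \<open>\<epsilon>\<close> in \<open>h\<close> can mask this term.\<close>

datatype ('v, 'c) gate =
    GVar 'v
  | GConst 'c
  | GAdd "('c \<times> nat) list"
  | GMul "nat list"
  | GOracle nat "nat \<Rightarrow> nat \<Rightarrow> nat"

type_synonym ('v, 'c) circuit = "('v, 'c) gate list"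

fun gate_wires :: "nat \<Rightarrow> ('v, 'c) gate \<Rightarrow> nat set" where
  "gate_wires n (GVar v) = {}"
| "gate_wires n (GConst c) = {}"
| "gate_wires n (GAdd ws) = snd ` set ws"
| "gate_wires n (GMul js) = set js"
| "gate_wires n (GOracle q W) = {W i j | i j. i < 2 * n \<and> j < 2 * n}"

fun gate_scalars :: "('v, 'c) gate \<Rightarrow> 'c set" where
  "gate_scalars (GConst c) = {c}"
| "gate_scalars (GAdd ws) = fst ` set ws"
| "gate_scalars _ = {}"

definition oracle_circuit_over :: "'c set \<Rightarrow> nat \<Rightarrow> ('v, 'c) circuit \<Rightarrow> bool" where
  "oracle_circuit_over K n \<Phi> \<longleftrightarrow> \<Phi> \<noteq> [] \<and>
     (\<forall>i<length \<Phi>. gate_wires n (\<Phi> ! i) \<subseteq> {..<i} \<and> gate_scalars (\<Phi> ! i) \<subseteq> K \<and>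
        (\<forall>q W. \<Phi> ! i = GOracle q W \<longrightarrow> q \<ge> 1))"

definition oracle_value ::
    "(nat \<times> nat, 'a::field fps) mpoly \<Rightarrow> nat \<Rightarrow> (nat \<Rightarrow> nat \<Rightarrow> ('v, 'a fls) mpoly)
      \<Rightarrow> ('v, 'a fls) mpoly" where
  "oracle_value h q A =
     subst (\<lambda>(i, j). A i j) (map_coeffs (\<lambda>c. fps_to_fls (fps_compose c (fps_X ^ q))) h)"

fun gate_value ::
    "(nat \<times> nat, 'a::field fps) mpoly \<Rightarrow> (nat \<Rightarrow> ('v, 'a fls) mpoly) \<Rightarrow> ('v, 'a fls) gate
      \<Rightarrow> ('v, 'a fls) mpoly" where
  "gate_value h val (GVar v) = mvar v"
| "gate_value h val (GConst c) = mconst c"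
| "gate_value h val (GAdd ws) = (\<Sum>(c, j)\<leftarrow>ws. mconst c * val j)"
| "gate_value h val (GMul js) = (\<Prod>j\<leftarrow>js. val j)"
| "gate_value h val (GOracle q W) = oracle_value h q (\<lambda>i j. val (W i j))"

definition skew_symmetric :: "nat \<Rightarrow> (nat \<Rightarrow> nat \<Rightarrow> 'r::comm_ring_1) \<Rightarrow> bool" where
  "skew_symmetric N A \<longleftrightarrow> (\<forall>i<N. A i i = 0 \<and> (\<forall>j<N. A j i = - A i j))"

text \<open>On a circuit the equations for \<open>val\<close> have exactly one solution on \<open>{..<length \<Phi>}\<close>,
  since wires point backwards. As \<open>h\<close> is a polynomial in the entries of a skew-symmetric
  matrix, every matrix queried has to be skew-symmetric.\<close>

definition computes ::
    "nat \<Rightarrow> (nat \<times> nat, 'a::field fps) mpoly \<Rightarrow> ('v, 'a fls) circuit \<Rightarrow> ('v, 'a fls) mpoly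
      \<Rightarrow> bool" where
  "computes n h \<Phi> p \<longleftrightarrow> (\<exists>val.
     (\<forall>i<length \<Phi>. val i = gate_value h val (\<Phi> ! i) \<and>
        (\<forall>q W. \<Phi> ! i = GOracle q W \<longrightarrow> skew_symmetric (2 * n) (\<lambda>i j. val (W i j)))) \<and>
     p = val (length \<Phi> - 1))"

text \<open>Apart from variables and constants, the circuit consists of \<open>4 * n\<^sup>2\<close> addition gates
  \<open>B\<close> applied to variables and constants, one oracle gate \<open>oi\<close> whose \<open>4 * n\<^sup>2\<close> inputs are
  the gates in \<open>B\<close>, and one addition gate \<open>t\<close>, the output, applied to \<open>oi\<close> and constants.\<close>

definition depth_three_oracle_circuit :: "nat \<Rightarrow> ('v, 'c) circuit \<Rightarrow> bool" where
  "depth_three_oracle_circuit n \<Phi> \<longleftrightarrow> (\<exists>B oi t q W ws.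
     t = length \<Phi> - 1 \<and> oi < length \<Phi> \<and> B \<subseteq> {..<length \<Phi>} \<and>
     card B = 4 * n\<^sup>2 \<and>
     (\<forall>b\<in>B. \<exists>us. \<Phi> ! b = GAdd us \<and>
        (\<forall>j\<in>snd ` set us. (\<exists>v. \<Phi> ! j = GVar v) \<or> (\<exists>c. \<Phi> ! j = GConst c))) \<and>
     \<Phi> ! oi = GOracle q W \<and>
     bij_betw (\<lambda>(i, j). W i j) ({..<2 * n} \<times> {..<2 * n}) B \<and>
     t \<notin> B \<and> \<Phi> ! t = GAdd ws \<and> oi \<in> snd ` set ws \<and>
     (\<forall>j\<in>snd ` set ws. j = oi \<or> (\<exists>c. \<Phi> ! j = GConst c)) \<and>
     (\<forall>j<length \<Phi>. j \<notin> B \<union> {oi, t} \<longrightarrow> (\<exists>v. \<Phi> ! j = GVar v) \<or> (\<exists>c. \<Phi> ! j = GConst c)))"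

end

theory Submission
  imports Defs "HOL-Library.FuncSet" "HOL-Library.Nat_Bijection"
begin

text \<open>The generic skew-symmetric matrix is congruent to one with diagonal blocks
  \<open>t\<^sub>1 J, \<dots>, t\<^sub>n J\<close>, so \<open>f\<close> becomes a nonzero polynomial in the \<open>t\<^sub>k\<close> and in the entries of
  the congruence matrix \<open>(P, Q)\<close>. As \<open>f\<close> vanishes on matrices of rank below \<open>2r\<close>, each of its
  monomials involves at least \<open>r\<close> of the \<open>t\<^sub>k\<close>. Substituting generic powers of \<open>\<epsilon>\<close> for all
  variables singles out one monomial; it contains some \<open>t\<^sub>k\<close> with \<open>k \<ge> r\<close> to a positive power \<open>\<alpha>\<close>.

  Let \<open>A\<close> be the strictly upper triangular adjacency matrix of the branching program, with sink in
  position \<open>k\<close> and source in position \<open>s\<close>, and let \<open>B = I - A + \<epsilon> E\<^bsub>k,s\<^esub>\<close>. Then \<open>B = L D R\<close>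
  with polynomial unitriangular \<open>L\<close>, \<open>R\<close> and \<open>D = diag(1, \<dots>, 1 + \<epsilon> g, \<dots>, 1)\<close>. Placing \<open>B\<close>
  between diagonal matrices of rapidly increasing powers of \<open>\<epsilon>\<close> makes \<open>L\<close> and \<open>R\<close> act on \<open>P\<close>
  and \<open>Q\<close> as the identity up to high order, so \<open>f\<close> takes the value
  \<open>c \<epsilon>\<^sup>d ((1 + \<epsilon> g)\<^sup>\<alpha> + O(\<epsilon>\<^sup>M))\<close> on a matrix with affine linear entries. Writing \<open>\<alpha> = p\<^sup>j \<beta>\<close>
  with \<open>p\<close> not dividing \<open>\<beta>\<close> (and \<open>p\<^sup>j = 1\<close> in characteristic zero), the first nonconstant term of
  \<open>(1 + \<epsilon> g)\<^sup>\<alpha>\<close> is \<open>\<beta> (\<epsilon> g)\<^sup>e\<close> with \<open>e = p\<^sup>j\<close>, from which the top gate recovers \<open>g\<^sup>e\<close>.\<close>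


section \<open>Evaluation of multivariate polynomials\<close>

text \<open>Unital ring homomorphisms as a predicate on functions: evaluations, coefficient maps and
  the embedding of power series are all of this kind, and \<open>hom_simps\<close> pushes any of
  them through sums, products and powers.\<close>

locale rhom =
  fixes \<phi> :: "'a::comm_ring_1 \<Rightarrow> 'b::comm_ring_1"
  assumes hom_add: "\<phi> (x + y) = \<phi> x + \<phi> y"
    and hom_mult: "\<phi> (x * y) = \<phi> x * \<phi> y"
    and hom_one: "\<phi> 1 = 1"
begin

lemma hom_zero: "\<phi> 0 = 0"
  using hom_add[of 0 0] by simp

lemma hom_uminus: "\<phi> (- x) = - \<phi> x"
  using hom_add[of x "- x"] by (simp add: hom_zero eq_neg_iff_add_eq_0 add.commute)

lemma hom_minus: "\<phi> (x - y) = \<phi> x - \<phi> y"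
  using hom_add[of x "- y"] by (simp add: hom_uminus)

lemma hom_sum: "\<phi> (\<Sum>x\<in>A. f x) = (\<Sum>x\<in>A. \<phi> (f x))"
  by (induction A rule: infinite_finite_induct) (auto simp: hom_zero hom_add)

lemma hom_prod: "\<phi> (\<Prod>x\<in>A. f x) = (\<Prod>x\<in>A. \<phi> (f x))"
  by (induction A rule: infinite_finite_induct) (auto simp: hom_one hom_mult)

lemma hom_power: "\<phi> (x ^ n) = \<phi> x ^ n"
  by (induction n) (auto simp: hom_one hom_mult)

lemma hom_of_nat: "\<phi> (of_nat n) = of_nat n"
  by (induction n) (auto simp: hom_zero hom_one hom_add)

lemma hom_of_int: "\<phi> (of_int n) = of_int n"
  by (cases n rule: int_cases2) (auto simp: hom_of_nat hom_uminus)

lemmas hom_simps = hom_add hom_mult hom_one hom_zero hom_uminus hom_minus hom_sum hom_prod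
  hom_power hom_of_nat hom_of_int

end

lemma rhom_comp:
  assumes "rhom \<phi>" "rhom \<psi>"
  shows "rhom (\<lambda>x. \<phi> (\<psi> x))"
proof -
  interpret \<phi>: rhom \<phi> by fact
  interpret \<psi>: rhom \<psi> by fact
  show ?thesis by unfold_locales (simp_all add: \<phi>.hom_simps \<psi>.hom_simps)
qed

lemma rhom_of_int: "rhom (of_int :: int \<Rightarrow> 'a::comm_ring_1)"
  by unfold_locales simp_all

section \<open>Evaluation homomorphisms\<close>

definition monom_ev :: "('x \<Rightarrow> 'r::comm_ring_1) \<Rightarrow> ('x \<Rightarrow>\<^sub>0 nat) \<Rightarrow> 'r" where
  "monom_ev a m = (\<Prod>x\<in>Poly_Mapping.keys m. a x ^ Poly_Mapping.lookup m x)"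

text \<open>Coefficients and variables are mapped independently, so one notion serves for
  substitution (\<open>\<phi> = mconst\<close>), specialisation to Laurent series
  (\<open>\<phi> = fls_const\<close>) and reduction of integer polynomials
  (\<open>\<phi> = of_int\<close>).\<close>

definition ev :: "('c::zero \<Rightarrow> 'r::comm_ring_1) \<Rightarrow> ('x \<Rightarrow> 'r) \<Rightarrow> ('x, 'c) mpoly \<Rightarrow> 'r" where
  "ev \<phi> a p = (\<Sum>m\<in>Poly_Mapping.keys p. \<phi> (Poly_Mapping.lookup p m) * monom_ev a m)"

lemma monom_ev_superset:
  assumes "finite K" "Poly_Mapping.keys m \<subseteq> K"
  shows "monom_ev a m = (\<Prod>x\<in>K. a x ^ Poly_Mapping.lookup m x)"
  unfolding monom_ev_def using assms
  by (intro prod.mono_neutral_left) (auto simp: in_keys_iff)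

lemma monom_ev_zero [simp]: "monom_ev a 0 = 1"
  by (simp add: monom_ev_def)

lemma monom_ev_add: "monom_ev a (m + m') = monom_ev a m * monom_ev a m'"
proof -
  let ?K = "Poly_Mapping.keys m \<union> Poly_Mapping.keys m'"
  have sub: "Poly_Mapping.keys (m + m') \<subseteq> ?K" by (rule Poly_Mapping.keys_add)
  show ?thesis
    using sub by (simp add: monom_ev_superset[of ?K] lookup_add power_add prod.distrib)
qed

lemma monom_ev_single [simp]: "monom_ev a (Poly_Mapping.single x k) = a x ^ k"
  by (cases "k = 0") (simp_all add: monom_ev_def)

lemma ev_superset:
  assumes "\<phi> 0 = 0" "finite K" "Poly_Mapping.keys p \<subseteq> K"
  shows "ev \<phi> a p = (\<Sum>m\<in>K. \<phi> (Poly_Mapping.lookup p m) * monom_ev a m)"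
  unfolding ev_def using assms by (intro sum.mono_neutral_left) (auto simp: in_keys_iff)

lemma ev_single:
  assumes "\<phi> 0 = 0"
  shows "ev \<phi> a (Poly_Mapping.single m c) = \<phi> c * monom_ev a m"
  using assms by (cases "c = 0") (simp_all add: ev_def)

lemma sum_single_lookup:
  "(\<Sum>m\<in>Poly_Mapping.keys p. Poly_Mapping.single m (Poly_Mapping.lookup p m)) = p"
  by (rule poly_mapping_eqI)
    (auto simp: lookup_sum lookup_single when_def in_keys_iff)

text \<open>A polynomial is the sum of its monomials. With zero coefficients allowed in the base
  case and arbitrary sums in the step, no side condition on supports arises, and bilinear identities
  reduce to monomials.\<close>

lemma poly_mapping_single_induct [case_names single add]:
  fixes p :: "'a \<Rightarrow>\<^sub>0 'b::comm_monoid_add"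
  assumes "\<And>m c. P (Poly_Mapping.single m c)" "\<And>p q. P p \<Longrightarrow> P q \<Longrightarrow> P (p + q)"
  shows "P p"
proof -
  have zero: "P 0" using assms(1)[of undefined 0] by simp
  have "P (\<Sum>m\<in>A. Poly_Mapping.single m (Poly_Mapping.lookup p m))" for A
    by (induction A rule: infinite_finite_induct) (auto simp: zero assms)
  thus ?thesis by (metis sum_single_lookup)
qed

text \<open>Multiplicativity reduces to monomials by additivity, first in the right factor and then
  in the left one.\<close>

lemma rhom_ev:
  assumes "rhom \<phi>"
  shows "rhom (ev \<phi> a)"
proof -
  interpret rhom \<phi> by fact
  note s = ev_single[of \<phi>, OF hom_zero]
  have add: "ev \<phi> a (p + q) = ev \<phi> a p + ev \<phi> a q" for p q
  proof -
    let ?K = "Poly_Mapping.keys p \<union> Poly_Mapping.keys q"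
    have sub: "Poly_Mapping.keys (p + q) \<subseteq> ?K" by (rule Poly_Mapping.keys_add)
    show ?thesis
      using sub by (simp add: ev_superset[of \<phi> ?K] hom_zero lookup_add hom_add
          distrib_right sum.distrib)
  qed
  have single_mult: "ev \<phi> a (Poly_Mapping.single m c * q) = ev \<phi> a (Poly_Mapping.single m c) * ev \<phi> a q"
    for m c q
    by (induction q rule: poly_mapping_single_induct)
      (auto simp: add mult_single s monom_ev_add hom_mult algebra_simps)
  have mult: "ev \<phi> a (p * q) = ev \<phi> a p * ev \<phi> a q" for p q
    by (induction p rule: poly_mapping_single_induct) (simp_all add: single_mult add distrib_right)
  have "ev \<phi> a 1 = 1"
    by (metis s hom_one monom_ev_zero mult_1 single_one)
  with add mult show ?thesis by unfold_locales
qed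

lemma ev_cong:
  assumes "\<And>x. x \<in> mvars p \<Longrightarrow> a x = b x"
  shows "ev \<phi> a p = ev \<phi> b p"
proof -
  have "monom_ev a m = monom_ev b m" if "m \<in> Poly_Mapping.keys p" for m
  proof -
    have "a x = b x" if "x \<in> Poly_Mapping.keys m" for x
      using assms[of x] that \<open>m \<in> _\<close> by (auto simp: mvars_def)
    thus ?thesis by (simp add: monom_ev_def)
  qed
  thus ?thesis by (simp add: ev_def)
qed

section \<open>Constants, variables and change of coefficients\<close>

lemma rhom_mconst: "rhom (mconst :: 'c::comm_ring_1 \<Rightarrow> ('x, 'c) mpoly)"
  by unfold_locales (simp_all add: mconst_def single_add mult_single)

lemma mconst_0 [simp]: "mconst 0 = 0"
  by (simp add: mconst_def)

lemma mconst_1 [simp]: "mconst 1 = 1"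
  by (simp add: mconst_def)

lemma ev_mconst:
  assumes "rhom \<phi>"
  shows "ev \<phi> a (mconst c) = \<phi> c"
  using assms by (simp add: mconst_def ev_single rhom.hom_zero)

lemma ev_mvar:
  assumes "rhom \<phi>"
  shows "ev \<phi> a (mvar x) = a x"
  using assms by (simp add: mvar_def ev_single rhom.hom_zero rhom.hom_one)

lemma hom_ev:
  assumes "rhom \<Phi>"
  shows "\<Phi> (ev \<phi> a p) = ev (\<lambda>c. \<Phi> (\<phi> c)) (\<lambda>x. \<Phi> (a x)) p"
proof -
  interpret rhom \<Phi> by fact
  show ?thesis by (simp add: ev_def monom_ev_def hom_simps)
qed

lemma subst_eq_ev: "subst a p = ev mconst a p"
  by (simp add: subst_def ev_def monom_ev_def)

lemma lookup_map_coeffs: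
  assumes "\<phi> 0 = 0"
  shows "Poly_Mapping.lookup (map_coeffs \<phi> p) m = \<phi> (Poly_Mapping.lookup p m)"
  using assms by (simp add: map_coeffs_def Poly_Mapping.map.rep_eq when_def)

lemma ev_map_coeffs:
  assumes "rhom \<phi>" "rhom \<psi>"
  shows "ev \<psi> a (map_coeffs \<phi> p) = ev (\<lambda>c. \<psi> (\<phi> c)) a p"
proof -
  have "Poly_Mapping.keys (map_coeffs \<phi> p) \<subseteq> Poly_Mapping.keys p"
    using assms(1) by (auto simp: in_keys_iff lookup_map_coeffs rhom.hom_zero)
  thus ?thesis
    using assms by (subst ev_superset[of \<psi> "Poly_Mapping.keys p"])
      (auto simp: rhom.hom_zero lookup_map_coeffs ev_def)
qed

lemma map_coeffs_single:
  assumes "\<phi> 0 = 0"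
  shows "map_coeffs \<phi> (Poly_Mapping.single m c) = Poly_Mapping.single m (\<phi> c)"
  using assms by (intro poly_mapping_eqI) (simp add: lookup_map_coeffs lookup_single when_def)

lemma rhom_map_coeffs:
  assumes "rhom \<phi>"
  shows "rhom (map_coeffs \<phi> :: ('x, _) mpoly \<Rightarrow> _)"
proof -
  interpret rhom \<phi> by fact
  note s = map_coeffs_single[of \<phi>, OF hom_zero]
  have add: "map_coeffs \<phi> (p + q) = map_coeffs \<phi> p + map_coeffs \<phi> q" for p q :: "('x, _) mpoly"
    by (rule poly_mapping_eqI) (simp add: lookup_map_coeffs hom_zero lookup_add hom_add)
  have single_mult: "map_coeffs \<phi> (Poly_Mapping.single m c * q) =
      map_coeffs \<phi> (Poly_Mapping.single m c) * map_coeffs \<phi> q" for m c and q :: "('x, _) mpoly"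
    by (induction q rule: poly_mapping_single_induct) (auto simp: add mult_single s hom_mult algebra_simps)
  have mult: "map_coeffs \<phi> (p * q) = map_coeffs \<phi> p * map_coeffs \<phi> q" for p q :: "('x, _) mpoly"
    by (induction p rule: poly_mapping_single_induct) (simp_all add: single_mult add distrib_right)
  have "map_coeffs \<phi> (1 :: ('x, _) mpoly) = 1"
    by (metis s hom_one single_one)
  with add mult show ?thesis by unfold_locales
qed

lemma map_coeffs_mconst:
  assumes "\<phi> 0 = 0"
  shows "map_coeffs \<phi> (mconst c) = mconst (\<phi> c)"
  using assms by (simp add: mconst_def map_coeffs_single)

lemma map_coeffs_map_coeffs:
  assumes "\<phi> 0 = 0" "\<psi> 0 = 0"
  shows "map_coeffs \<psi> (map_coeffs \<phi> p) = map_coeffs (\<lambda>c. \<psi> (\<phi> c)) p"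
  using assms by (intro poly_mapping_eqI) (simp add: lookup_map_coeffs)

lemma lookup_mconst_mult:
  "Poly_Mapping.lookup (mconst c * p) m = c * Poly_Mapping.lookup p m"
  by (induction p rule: poly_mapping_single_induct)
    (auto simp: mconst_def mult_single lookup_single when_def lookup_add distrib_left)

section \<open>Pfaffians\<close>

text \<open>\<open>\<Omega>\<close> is a disjoint union of orbits \<open>x \<circ> H\<close>. The
  action is free because each \<open>x\<close> is bijective, and \<open>F\<close> is constant on
  orbits, so every orbit contributes \<open>card H\<close> times one value. The induction removes
  one orbit at a time.\<close>

lemma sum_over_free_action:
  fixes F :: "('a \<Rightarrow> 'a) \<Rightarrow> 'r::comm_ring_1"
  assumes "finite \<Omega>" "finite H"
    and closed: "\<And>x h. x \<in> \<Omega> \<Longrightarrow> h \<in> H \<Longrightarrow> x \<circ> h \<in> \<Omega>"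
    and inj: "\<And>x. x \<in> \<Omega> \<Longrightarrow> bij x"
    and comp: "\<And>g h. g \<in> H \<Longrightarrow> h \<in> H \<Longrightarrow> g \<circ> h \<in> H"
    and id: "id \<in> H"
    and inv: "\<And>h. h \<in> H \<Longrightarrow> bij h \<and> Hilbert_Choice.inv h \<in> H"
    and F: "\<And>x h. x \<in> \<Omega> \<Longrightarrow> h \<in> H \<Longrightarrow> F (x \<circ> h) = F x"
  shows "\<exists>s. (\<Sum>x\<in>\<Omega>. F x) = of_nat (card H) * s"
  using assms(1) closed inj F
proof (induction \<Omega> rule: finite_psubset_induct)
  case (psubset \<Omega>)
  show ?case
  proof (cases "\<Omega> = {}")
    case True
    thus ?thesis by (intro exI[of _ 0]) simp
  next
    case False
    then obtain x where x: "x \<in> \<Omega>" by blast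
    define O' where "O' = (\<lambda>h. x \<circ> h) ` H"
    have sub: "O' \<subseteq> \<Omega>"
      unfolding O'_def by (rule image_subsetI) (rule psubset.prems(1)[OF x])
    have "x \<in> O'" unfolding O'_def using id by (intro image_eqI[of _ _ id]) simp_all
    hence ps: "\<Omega> - O' \<subset> \<Omega>" using x by blast
    \<comment> \<open>Left cancellation by the bijection \<open>x\<close>: the orbit has exactly
      \<open>card H\<close> elements.\<close>
    have injx: "inj_on (\<lambda>h. x \<circ> h) H"
    proof (rule inj_onI)
      fix g h assume "x \<circ> g = x \<circ> h"
      thus "g = h" using psubset.prems(2)[OF x]
        by (metis bij_is_inj comp_assoc id_comp inj_iff)
    qed
    \<comment> \<open>The complement of an orbit is again stable:
      \<open>y \<circ> h = x \<circ> g\<close> would give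
      \<open>y = x \<circ> (g \<circ> inv h)\<close>, which lies in the removed orbit.\<close>
    have closed': "y \<circ> h \<in> \<Omega> - O'" if "y \<in> \<Omega> - O'" "h \<in> H" for y h
    proof -
      have "y \<circ> h \<notin> O'"
      proof
        assume "y \<circ> h \<in> O'"
        then obtain g where g: "g \<in> H" "y \<circ> h = x \<circ> g" by (auto simp: O'_def)
        have "y = (y \<circ> h) \<circ> Hilbert_Choice.inv h"
          using inv[OF that(2)] by (simp add: comp_assoc bij_is_surj surj_iff[THEN iffD1])
        also have "\<dots> = x \<circ> (g \<circ> Hilbert_Choice.inv h)" by (simp add: g(2) comp_assoc)
        finally show False using that g inv[OF that(2)] comp by (auto simp: O'_def)
      qed
      thus ?thesis using psubset.prems(1)[of y h] that by blast
    qed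
    have "\<exists>s. (\<Sum>x\<in>\<Omega> - O'. F x) = of_nat (card H) * s"
      by (rule psubset.IH[OF ps closed']) (use psubset.prems in auto)
    then obtain s where s: "(\<Sum>x\<in>\<Omega> - O'. F x) = of_nat (card H) * s" by blast
    have "(\<Sum>y\<in>O'. F y) = (\<Sum>h\<in>H. F x)"
      unfolding O'_def sum.reindex[OF injx]
      by (intro sum.cong refl) (simp only: psubset.prems(3)[OF x] comp_apply)
    also have "\<dots> = of_nat (card H) * F x" by simp
    finally have "(\<Sum>y\<in>\<Omega>. F y) = of_nat (card H) * (F x + s)"
      using sum.subset_diff[OF sub psubset.hyps(1), of F] s by (simp add: algebra_simps)
    thus ?thesis by blast
  qed
qed

section \<open>The hyperoctahedral group\<close>

definition pair_perm :: "(nat \<Rightarrow> nat) \<Rightarrow> nat \<Rightarrow> nat" where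
  "pair_perm \<sigma> p = 2 * \<sigma> (p div 2) + p mod 2"

definition flip_perm :: "nat set \<Rightarrow> nat \<Rightarrow> nat" where
  "flip_perm B p = (if p div 2 \<in> B then 2 * (p div 2) + (1 - p mod 2) else p)"

text \<open>The stabiliser of the partition of the positions into the blocks
  \<open>{2 * i, 2 * i + 1}\<close>. Its order is the denominator in the definition of the Pfaffian.
  It is generated by block permutations (\<open>pair_perm\<close>) and flips inside blocks
  (\<open>flip_perm\<close>).\<close>

definition hyperoctahedral :: "nat \<Rightarrow> (nat \<Rightarrow> nat) set" where
  "hyperoctahedral k = {h. h permutes {..<2 * k} \<and>
     (\<forall>p q. h p div 2 = h q div 2 \<longleftrightarrow> p div 2 = q div 2)}"

lemma pair_perm_comp: "pair_perm (\<sigma> \<circ> \<tau>) = pair_perm \<sigma> \<circ> pair_perm \<tau>"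
  by (auto simp: pair_perm_def)

lemma pair_perm_id [simp]: "pair_perm id = id"
  by (auto simp: pair_perm_def)

lemma pair_perm_transpose:
  assumes "a \<noteq> b"
  shows "pair_perm (transpose a b) =
    transpose (2 * a) (2 * b) \<circ> transpose (2 * a + 1) (2 * b + 1)"
proof
  fix p :: nat
  have ne: "2 * a \<noteq> 2 * b + 1" "2 * b \<noteq> 2 * a + 1" "2 * a \<noteq> 2 * a + 1" "2 * b \<noteq> 2 * b + 1"
    by presburger+
  have v: "pair_perm \<sigma> (2 * i) = 2 * \<sigma> i" "pair_perm \<sigma> (2 * i + 1) = 2 * \<sigma> i + 1" for \<sigma> i
    by (simp_all add: pair_perm_def)
  have "p = 2 * (p div 2) \<or> p = 2 * (p div 2) + 1" by presburger
  then consider "p = 2 * a" | "p = 2 * b" | "p = 2 * a + 1" | "p = 2 * b + 1" |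
    "p div 2 \<noteq> a" "p div 2 \<noteq> b" by metis
  thus "pair_perm (transpose a b) p =
    (transpose (2 * a) (2 * b) \<circ> transpose (2 * a + 1) (2 * b + 1)) p"
  proof cases
    case 5
    hence "p \<noteq> 2 * a" "p \<noteq> 2 * b" "p \<noteq> 2 * a + 1" "p \<noteq> 2 * b + 1" by presburger+
    with 5 show ?thesis by (simp add: pair_perm_def transpose_def)
  qed (use assms ne ne[symmetric] in \<open>simp_all only: v comp_apply transpose_def, simp_all\<close>)
qed

text \<open>Exchanging two blocks is a product of two transpositions, hence even, and such exchanges
  generate all block permutations.\<close>

lemma pair_perm_permutes_even:
  assumes "\<sigma> permutes {..<k}"
  shows "pair_perm \<sigma> permutes {..<2 * k} \<and> sign (pair_perm \<sigma>) = 1"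
  using assms finite_lessThan
proof (induction rule: permutes_induct)
  case id
  show ?case unfolding pair_perm_id by (intro conjI permutes_id sign_id)
next
  case (swap a b p)
  have 1: "transpose (2 * a) (2 * b) permutes {..<2 * k}"
       "transpose (2 * a + 1) (2 * b + 1) permutes {..<2 * k}"
    using swap by (auto intro!: permutes_swap_id)
  hence 2: "permutation (transpose (2 * a) (2 * b))"
       "permutation (transpose (2 * a + 1) (2 * b + 1))" "permutation (pair_perm p)"
    using swap permutation_permutes finite_lessThan by blast+
  have "2 * a \<noteq> 2 * b" "2 * a + 1 \<noteq> 2 * b + 1" using swap by auto
  hence "sign (transpose (2 * a) (2 * b)) * sign (transpose (2 * a + 1) (2 * b + 1)) = 1"
    by (simp only: sign_swap_id) simp
  moreover have p: "pair_perm p permutes {..<2 * k}" "sign (pair_perm p) = 1" using swap by auto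
  ultimately show ?case unfolding pair_perm_comp pair_perm_transpose[OF swap(3)]
    using permutes_compose[OF p(1) permutes_compose[OF 1(2,1)]]
    by (simp only: sign_compose[OF permutation_compose[OF 2(1,2)] 2(3)] sign_compose[OF 2(1,2)]) simp
qed

lemma flip_perm_empty [simp]: "flip_perm {} = id"
  by (auto simp: flip_perm_def)

lemma flip_perm_div [simp]: "flip_perm B p div 2 = p div 2"
  by (cases "even p") (auto simp: flip_perm_def elim!: oddE)

lemma flip_perm_insert:
  fixes B :: "nat set"
  assumes "i \<notin> B"
  shows "flip_perm (insert i B) = transpose (2 * i) (2 * i + 1) \<circ> flip_perm B"
proof
  fix p :: nat
  show "flip_perm (insert i B) p = (transpose (2 * i) (2 * i + 1) \<circ> flip_perm B) p"
  proof (cases "p div 2 = i")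
    case True
    hence "p = 2 * i \<or> p = 2 * i + 1" by presburger
    thus ?thesis using assms by (auto simp: flip_perm_def)
  next
    case False
    hence "flip_perm B p div 2 \<noteq> i" by simp
    hence "flip_perm B p \<noteq> 2 * i" "flip_perm B p \<noteq> 2 * i + 1" by presburger+
    thus ?thesis using False by (simp add: flip_perm_def transpose_def)
  qed
qed

text \<open>Each flipped block contributes one transposition and therefore one sign.\<close>

lemma flip_perm_permutes_sign:
  assumes "finite B" "B \<subseteq> {..<k}"
  shows "flip_perm B permutes {..<2 * k} \<and> sign (flip_perm B) = (- 1) ^ card B"
  using assms
proof (induction B rule: finite_induct)
  case empty
  show ?case unfolding flip_perm_empty card.empty power_0 by (intro conjI permutes_id sign_id)
next
  case (insert i B)
  have 1: "transpose (2 * i) (2 * i + 1) permutes {..<2 * k}"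
    using insert by (auto intro!: permutes_swap_id)
  hence 2: "permutation (transpose (2 * i) (2 * i + 1))" "permutation (flip_perm B)"
    using insert permutation_permutes finite_lessThan by blast+
  show ?case unfolding flip_perm_insert[OF insert(2)]
    using insert by (intro conjI permutes_compose[OF _ 1])
      (simp_all only: sign_compose[OF 2] sign_swap_id, simp_all)
qed

text \<open>The image of an even position \<open>2 * i\<close> determines both components: its block
  is \<open>\<sigma> i\<close>, and its parity tells whether \<open>i\<close> belongs to
  \<open>B\<close>.\<close>

lemma bij_betw_hyperoctahedral:
  "bij_betw (\<lambda>(\<sigma>, B). pair_perm \<sigma> \<circ> flip_perm B)
     ({\<sigma>. \<sigma> permutes {..<k}} \<times> Pow {..<k}) (hyperoctahedral k)"
  unfolding bij_betw_def
proof
  have val: "(pair_perm \<sigma> \<circ> flip_perm B) (2 * i) = 2 * \<sigma> i + (if i \<in> B then 1 else 0)"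
    for \<sigma> :: "nat \<Rightarrow> nat" and B and i :: nat
    by (auto simp: pair_perm_def flip_perm_def)
  show "inj_on (\<lambda>(\<sigma>, B). pair_perm \<sigma> \<circ> flip_perm B)
     ({\<sigma>. \<sigma> permutes {..<k}} \<times> Pow {..<k})"
  proof (rule inj_onI, clarify)
    fix \<sigma> \<tau> :: "nat \<Rightarrow> nat" and B C :: "nat set"
    assume eq: "pair_perm \<sigma> \<circ> flip_perm B = pair_perm \<tau> \<circ> flip_perm C"
    have e: "2 * \<sigma> i + (if i \<in> B then 1 else 0) = 2 * \<tau> i + (if i \<in> C then 1 else 0)" for i
      using val eq by metis
    have "\<sigma> i = \<tau> i \<and> (i \<in> B \<longleftrightarrow> i \<in> C)" for i
      using e[of i] by (auto split: if_splits; presburger)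
    thus "\<sigma> = \<tau> \<and> B = C" by auto
  qed
  show "(\<lambda>(\<sigma>, B). pair_perm \<sigma> \<circ> flip_perm B) ` ({\<sigma>. \<sigma> permutes {..<k}} \<times> Pow {..<k})
    = hyperoctahedral k"
  proof (intro equalityI subsetI; clarify?)
    fix \<sigma> B assume \<sigma>: "\<sigma> permutes {..<k}" and B: "B \<subseteq> {..<k}"
    have "(pair_perm \<sigma> \<circ> flip_perm B) p div 2 = \<sigma> (p div 2)" for p
      by (simp add: pair_perm_def)
    moreover have "inj \<sigma>" using \<sigma> permutes_inj by blast
    ultimately show "pair_perm \<sigma> \<circ> flip_perm B \<in> hyperoctahedral k"
      using pair_perm_permutes_even[OF \<sigma>] flip_perm_permutes_sign[of B k] B finite_subset[OF B]
      by (auto simp: hyperoctahedral_def inj_eq intro: permutes_compose)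
  next
    fix h assume "h \<in> hyperoctahedral k"
    hence h: "h permutes {..<2 * k}" "\<And>p q. h p div 2 = h q div 2 \<longleftrightarrow> p div 2 = q div 2"
      by (auto simp: hyperoctahedral_def)
    \<comment> \<open>Both components are read off from the images of the even positions; the odd
      position of a block is then forced, since \<open>h\<close> is injective and preserves
      blocks.\<close>
    define \<sigma> where "\<sigma> i = h (2 * i) div 2" for i :: nat
    define B :: "nat set" where "B = {i. odd (h (2 * i))}"
    have out: "h (2 * i) = 2 * i" if "i \<ge> k" for i
      using permutes_not_in[OF h(1), of "2 * i"] that by simp
    have "inj_on \<sigma> {..<k}" by (rule inj_onI) (auto simp: \<sigma>_def h(2))
    moreover have "\<sigma> i < k" if "i < k" for i
      using permutes_in_image[OF h(1), of "2 * i"] that by (simp add: \<sigma>_def)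
    hence "\<sigma> ` {..<k} \<subseteq> {..<k}" by auto
    ultimately have "bij_betw \<sigma> {..<k} {..<k}"
      by (simp add: bij_betw_def endo_inj_surj)
    hence "\<sigma> permutes {..<k}" by (rule bij_imp_permutes) (simp add: \<sigma>_def out)
    moreover have "B \<subseteq> {..<k}"
    proof
      fix i assume "i \<in> B"
      thus "i \<in> {..<k}" using out[of i] by (cases "i < k") (auto simp: B_def)
    qed
    moreover have "h = pair_perm \<sigma> \<circ> flip_perm B"
    proof
      fix p :: nat
      define i where "i = p div 2"
      have eq: "h (2 * i) div 2 = h (2 * i + 1) div 2" by (simp add: h(2))
      have ne: "h (2 * i) \<noteq> h (2 * i + 1)"
        using permutes_inj[OF h(1)] by (simp add: inj_eq)
      have "p = 2 * i \<or> p = 2 * i + 1" unfolding i_def by presburger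
      thus "h p = (pair_perm \<sigma> \<circ> flip_perm B) p"
      proof
        assume "p = 2 * i"
        thus ?thesis using val[of \<sigma> B i] by (auto simp: \<sigma>_def B_def)
      next
        assume p: "p = 2 * i + 1"
        have "(pair_perm \<sigma> \<circ> flip_perm B) p = 2 * \<sigma> i + (if i \<in> B then 0 else 1)"
          by (auto simp: p pair_perm_def flip_perm_def)
        moreover have "y = 2 * (x div 2) + (if odd x then 0 else 1)"
          if "x div 2 = y div 2" "x \<noteq> y" for x y :: nat
          using that by (cases "odd x") (simp_all, presburger+)
        ultimately show ?thesis using eq ne by (simp add: p \<sigma>_def B_def)
      qed
    qed
    ultimately show "h \<in> (\<lambda>(\<sigma>, B). pair_perm \<sigma> \<circ> flip_perm B) `
        ({\<sigma>. \<sigma> permutes {..<k}} \<times> Pow {..<k})" by force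
  qed
qed

lemma card_hyperoctahedral: "card (hyperoctahedral k) = 2 ^ k * fact k"
  using bij_betw_same_card[OF bij_betw_hyperoctahedral, of k]
  by (simp add: card_cartesian_product card_Pow card_permutations[of "{..<k}" k] mult.commute)

section \<open>Exactness of the division in the Pfaffian\<close>

definition signed_sum :: "nat \<Rightarrow> (nat \<Rightarrow> nat \<Rightarrow> 'r::comm_ring_1) \<Rightarrow> 'r" where
  "signed_sum k A = (\<Sum>\<pi> | \<pi> permutes {..<2 * k}.
     of_int (sign \<pi>) * (\<Prod>i<k. A (\<pi> (2 * i)) (\<pi> (2 * i + 1))))"

text \<open>Summands are invariant under right multiplication by the hyperoctahedral group: a block
  permutation is even and only reorders the factors, while a flip changes the sign of the
  permutation and, by skew symmetry, that of one factor. The group acts freely, so its order divides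
  the sum.\<close>

lemma signed_sum_divisible:
  assumes skew: "\<And>i j. A j i = - A i j"
  shows "\<exists>s. signed_sum k A = of_nat (2 ^ k * fact k) * s"
proof -
  let ?H = "hyperoctahedral k" and ?\<Omega> = "{\<pi>. \<pi> permutes {..<2 * k}}"
  let ?F = "\<lambda>\<pi>. of_int (sign \<pi>) * (\<Prod>i<k. A (\<pi> (2 * i)) (\<pi> (2 * i + 1)))"
  have inv: "?F (x \<circ> h) = ?F x" if x: "x \<in> ?\<Omega>" and "h \<in> ?H" for x h
  proof -
    obtain \<sigma> B where \<sigma>: "\<sigma> permutes {..<k}" and B: "B \<subseteq> {..<k}" and h: "h = pair_perm \<sigma> \<circ> flip_perm B"
      using \<open>h \<in> ?H\<close> unfolding bij_betw_imp_surj_on[OF bij_betw_hyperoctahedral, symmetric] by auto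
    have fB: "finite B" using B finite_subset by blast
    note p = pair_perm_permutes_even[OF \<sigma>] and f = flip_perm_permutes_sign[OF fB B]
    have "permutation x" "permutation (pair_perm \<sigma>)" "permutation (flip_perm B)"
      using x p f permutation_permutes finite_lessThan by blast+
    hence sgn: "sign (x \<circ> h) = sign x * (- 1) ^ card B"
      using p f by (simp add: h sign_compose permutation_compose)
    have "(\<Prod>i<k. A ((x \<circ> h) (2 * i)) ((x \<circ> h) (2 * i + 1))) =
        (\<Prod>i<k. (if i \<in> B then - 1 else 1) * A (x (2 * \<sigma> i)) (x (2 * \<sigma> i + 1)))"
      by (intro prod.cong refl)
        (auto simp: h pair_perm_def flip_perm_def skew[of "x (Suc (2 * \<sigma> _))"])
    also have "\<dots> = (\<Prod>i<k. if i \<in> B then - 1 else 1) * (\<Prod>i<k. A (x (2 * \<sigma> i)) (x (2 * \<sigma> i + 1)))"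
      by (rule prod.distrib)
    also have "(\<Prod>i<k. if i \<in> B then - 1 else 1) = ((- 1) ^ card B :: 'a)"
      using B by (simp add: prod.If_cases Int_absorb1)
    also have "(\<Prod>i<k. A (x (2 * \<sigma> i)) (x (2 * \<sigma> i + 1))) = (\<Prod>i<k. A (x (2 * i)) (x (2 * i + 1)))"
      using prod.permute[OF \<sigma>, of "\<lambda>i. A (x (2 * i)) (x (2 * i + 1))"] by (simp add: o_def)
    finally have "(\<Prod>i<k. A ((x \<circ> h) (2 * i)) ((x \<circ> h) (2 * i + 1))) =
        (- 1) ^ card B * (\<Prod>i<k. A (x (2 * i)) (x (2 * i + 1)))" .
    moreover have "(- 1) ^ card B * ((- 1) ^ card B * X) = X" for X :: 'a
      by (simp flip: mult.assoc power_mult_distrib)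
    ultimately show ?thesis by (simp only: sgn) (simp add: mult.assoc)
  qed
  have finH: "finite ?H"
    by (rule finite_subset[OF _ finite_permutations[of "{..<2 * k}"]]) (auto simp: hyperoctahedral_def)
  have "\<exists>s. sum ?F ?\<Omega> = of_nat (card ?H) * s"
  proof (rule sum_over_free_action)
    fix h assume h: "h \<in> ?H"
    hence "bij h" by (auto simp: hyperoctahedral_def intro: permutes_bij)
    hence "h (Hilbert_Choice.inv h p) = p" for p by (simp add: bij_is_surj surj_f_inv_f)
    thus "bij h \<and> Hilbert_Choice.inv h \<in> ?H"
      using h \<open>bij h\<close> by (auto simp: hyperoctahedral_def permutes_inv) metis+
  qed (use inv finH in \<open>auto simp: finite_permutations hyperoctahedral_def permutes_id permutes_bij
      intro: permutes_compose\<close>)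
  thus ?thesis by (simp add: signed_sum_def card_hyperoctahedral)
qed

text \<open>Multiplication by an integer acts coefficientwise, so divisibility of the sum makes
  every coefficientwise \<open>div\<close> exact. Identities for the Pfaffian can thus be proved for
  the undivided sum.\<close>

lemma pfaffian_int_signed_sum:
  assumes skew: "\<And>i j. A j i = - A i j"
  shows "of_nat (2 ^ k * fact k) * pfaffian_int k A = signed_sum k A"
proof -
  obtain s where s: "signed_sum k A = of_nat (2 ^ k * fact k) * s"
    using signed_sum_divisible[of A, OF skew] by blast
  have "of_nat (2 ^ k * fact k) = (mconst (of_nat (2 ^ k * fact k)) :: (nat \<times> nat, int) mpoly)"
    by (rule rhom.hom_of_nat[OF rhom_mconst, symmetric])
  hence l: "Poly_Mapping.lookup (of_nat (2 ^ k * fact k) * s) m =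
      of_nat (2 ^ k * fact k) * Poly_Mapping.lookup s m" for m
    by (simp only: lookup_mconst_mult)
  have "pfaffian_int k A = map_coeffs (\<lambda>c. c div (2 ^ k * fact k)) (of_nat (2 ^ k * fact k) * s)"
    unfolding pfaffian_int_def s[symmetric] signed_sum_def by simp
  also have "\<dots> = s"
    by (rule poly_mapping_eqI) (simp only: lookup_map_coeffs l div_0, simp)
  finally show ?thesis by (simp add: s)
qed

text \<open>Positions \<open>a\<close> and \<open>b\<close> carry the same rank-two form. The three
  ways of pairing their four arguments give terms that cancel by the three-term Pluecker relation,
  so three times the sum is zero, and integer coefficients allow division by three.\<close>

lemma sum_antisymmetrized_plucker:
  fixes f :: "nat \<Rightarrow> nat \<Rightarrow> nat \<Rightarrow> ('x, int) mpoly"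
  assumes ab: "a < k" "b < k" "a \<noteq> b"
    and fab: "\<And>p q. f a p q = u p * v q - u q * v p" "\<And>p q. f b p q = u p * v q - u q * v p"
  shows "(\<Sum>\<pi> | \<pi> permutes {..<2 * k}. of_int (sign \<pi>) *
    (\<Prod>i<k. f i (\<pi> (2 * i)) (\<pi> (2 * i + 1)) :: ('x, int) mpoly)) = 0" (is "sum ?T ?P = 0")
proof -
  define rest where "rest \<pi> = (\<Prod>i\<in>{..<k} - {a, b}. f i (\<pi> (2 * i)) (\<pi> (2 * i + 1)))" for \<pi> :: "nat \<Rightarrow> nat"
  let ?d = "\<lambda>p q. u p * v q - u q * v p"
  have T: "?T \<pi> = of_int (sign \<pi>) * ?d (\<pi> (2 * a)) (\<pi> (2 * a + 1)) * ?d (\<pi> (2 * b)) (\<pi> (2 * b + 1)) * rest \<pi>" for \<pi>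
  proof -
    have "(\<Prod>i<k. f i (\<pi> (2 * i)) (\<pi> (2 * i + 1))) =
      f a (\<pi> (2 * a)) (\<pi> (2 * a + 1)) * (\<Prod>i\<in>{..<k} - {a}. f i (\<pi> (2 * i)) (\<pi> (2 * i + 1)))"
      using ab by (intro prod.remove) auto
    also have "(\<Prod>i\<in>{..<k} - {a}. f i (\<pi> (2 * i)) (\<pi> (2 * i + 1))) =
      f b (\<pi> (2 * b)) (\<pi> (2 * b + 1)) * (\<Prod>i\<in>{..<k} - {a} - {b}. f i (\<pi> (2 * i)) (\<pi> (2 * i + 1)))"
      using ab by (intro prod.remove) auto
    also have "{..<k} - {a} - {b} = {..<k} - {a, b}" by auto
    finally show ?thesis by (simp add: rest_def fab mult.assoc)
  qed
  have neq: "2 * a + 1 \<noteq> 2 * b" "2 * a + 1 \<noteq> 2 * b + 1" "2 * a \<noteq> 2 * b" "2 * a \<noteq> 2 * b + 1"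
    using ab by presburger+
  \<comment> \<open>Composing with \<open>\<tau>1\<close> or \<open>\<tau>2\<close> yields the other
    two pairings of the four arguments; both are odd and fix the remaining positions.\<close>
  define \<tau>1 where "\<tau>1 = transpose (2 * a + 1) (2 * b)"
  define \<tau>2 where "\<tau>2 = transpose (2 * a + 1) (2 * b + 1)"
  have \<tau>: "\<tau>1 permutes {..<2 * k}" "\<tau>2 permutes {..<2 * k}"
    using ab by (auto simp: \<tau>1_def \<tau>2_def intro!: permutes_swap_id)
  have \<tau>_fix: "\<tau> (2 * i) = 2 * i \<and> \<tau> (2 * i + 1) = 2 * i + 1"
    if "\<tau> = \<tau>1 \<or> \<tau> = \<tau>2" "i \<noteq> a" "i \<noteq> b" for i \<tau>
  proof -
    have "2 * i \<noteq> 2 * a + 1" "2 * i + 1 \<noteq> 2 * a + 1" "2 * i \<noteq> 2 * b" "2 * i + 1 \<noteq> 2 * b"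
      "2 * i \<noteq> 2 * b + 1" "2 * i + 1 \<noteq> 2 * b + 1" using that(2,3) by presburger+
    thus ?thesis using that(1) unfolding \<tau>1_def \<tau>2_def by (auto simp: transpose_def)
  qed
  have rest: "rest (\<pi> \<circ> \<tau>) = rest \<pi>" if "\<tau> = \<tau>1 \<or> \<tau> = \<tau>2" for \<pi> \<tau>
    unfolding rest_def using \<tau>_fix[OF that] by (intro prod.cong refl) auto
  have sgn: "sign (\<pi> \<circ> \<tau>) = - sign \<pi>" if "\<pi> \<in> ?P" "\<tau> = \<tau>1 \<or> \<tau> = \<tau>2" for \<pi> \<tau>
  proof -
    have "permutation \<pi>" "permutation \<tau>1" "permutation \<tau>2"
      using that \<tau> permutation_permutes finite_lessThan by blast+
    moreover have "sign \<tau>1 = -1" "sign \<tau>2 = -1"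
      using neq by (simp_all add: \<tau>1_def \<tau>2_def sign_swap_id)
    ultimately show ?thesis using that by (auto simp: sign_compose)
  qed
  have plucker: "s * (x1 * y2 - x2 * y1) * (x3 * y4 - x4 * y3) * t
      + - s * (x1 * y3 - x3 * y1) * (x2 * y4 - x4 * y2) * t
      + - s * (x1 * y4 - x4 * y1) * (x3 * y2 - x2 * y3) * t = 0"
    for s t x1 x2 x3 x4 y1 y2 y3 y4 :: "('x, int) mpoly"
    by (simp add: algebra_simps)
  have 1: "?T \<pi> + ?T (\<pi> \<circ> \<tau>1) + ?T (\<pi> \<circ> \<tau>2) = 0" if "\<pi> \<in> ?P" for \<pi>
  proof -
    have v1: "(\<pi> \<circ> \<tau>1) (2 * a) = \<pi> (2 * a)" "(\<pi> \<circ> \<tau>1) (2 * a + 1) = \<pi> (2 * b)"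
      "(\<pi> \<circ> \<tau>1) (2 * b) = \<pi> (2 * a + 1)" "(\<pi> \<circ> \<tau>1) (2 * b + 1) = \<pi> (2 * b + 1)"
      "(\<pi> \<circ> \<tau>2) (2 * a) = \<pi> (2 * a)" "(\<pi> \<circ> \<tau>2) (2 * a + 1) = \<pi> (2 * b + 1)"
      "(\<pi> \<circ> \<tau>2) (2 * b) = \<pi> (2 * b)" "(\<pi> \<circ> \<tau>2) (2 * b + 1) = \<pi> (2 * a + 1)"
      using neq ab by (auto simp: \<tau>1_def \<tau>2_def transpose_def)
    show ?thesis
      unfolding T[of \<pi>] T[of "\<pi> \<circ> \<tau>1"] T[of "\<pi> \<circ> \<tau>2"]
      unfolding v1 rest[OF disjI1[OF refl]] rest[OF disjI2[OF refl]]
        sgn[OF that disjI1[OF refl]] sgn[OF that disjI2[OF refl]] of_int_minus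
      by (rule plucker)
  qed
  \<comment> \<open>Right multiplication by a fixed permutation only reindexes the sum, so each of
    the three sums equals the original one.\<close>
  have "sum ?T ?P + sum ?T ?P + sum ?T ?P = (\<Sum>\<pi>\<in>?P. ?T \<pi> + ?T (\<pi> \<circ> \<tau>1) + ?T (\<pi> \<circ> \<tau>2))"
    using sum_permutations_compose_right[OF \<tau>(1), of ?T] sum_permutations_compose_right[OF \<tau>(2), of ?T]
    by (simp add: sum.distrib)
  also have "\<dots> = 0" using 1 by (intro sum.neutral) blast
  finally have "sum ?T ?P + sum ?T ?P + sum ?T ?P = 0" .
  hence three: "Poly_Mapping.lookup (sum ?T ?P) m + Poly_Mapping.lookup (sum ?T ?P) m
      + Poly_Mapping.lookup (sum ?T ?P) m = 0" for m
    unfolding lookup_add[symmetric] by (simp only: lookup_zero)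
  have "Poly_Mapping.lookup (sum ?T ?P) m = 0" for m
    using three[of m] by linarith
  thus ?thesis by (intro poly_mapping_eqI) simp
qed

text \<open>Expanding the product chooses a form \<open>\<kappa> i\<close> for each of the
  \<open>k\<close> factors. With fewer than \<open>k\<close> forms available two factors share one
  by the pigeonhole principle, and the Pluecker argument kills the term.\<close>

lemma signed_sum_low_rank:
  fixes u v :: "'z \<Rightarrow> nat \<Rightarrow> ('x, int) mpoly"
  assumes "finite Z" "card Z < k"
  shows "signed_sum k (\<lambda>p q. \<Sum>c\<in>Z. u c p * v c q - u c q * v c p) = 0"
proof -
  let ?d = "\<lambda>c p q. u c p * v c q - u c q * v c p"
  let ?P = "{\<pi>. \<pi> permutes {..<2 * k}}" and ?K = "PiE {..<k} (\<lambda>_. Z)"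
  have zero: "(\<Sum>\<pi>\<in>?P. of_int (sign \<pi>) * (\<Prod>i<k. ?d (\<kappa> i) (\<pi> (2 * i)) (\<pi> (2 * i + 1)))) = 0"
    if "\<kappa> \<in> ?K" for \<kappa>
  proof -
    have "\<not> inj_on \<kappa> {..<k}"
    proof
      assume "inj_on \<kappa> {..<k}"
      hence "card {..<k} \<le> card Z" by (rule card_inj_on_le) (use that assms in auto)
      thus False using assms by simp
    qed
    then obtain a b where "a < k" "b < k" "a \<noteq> b" "\<kappa> a = \<kappa> b" by (auto simp: inj_on_def)
    thus ?thesis
      by (intro sum_antisymmetrized_plucker[of a k b "\<lambda>i. ?d (\<kappa> i)" "u (\<kappa> a)" "v (\<kappa> a)"]) auto
  qed
  have "signed_sum k (\<lambda>p q. \<Sum>c\<in>Z. ?d c p q) =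
      (\<Sum>\<pi>\<in>?P. \<Sum>\<kappa>\<in>?K. of_int (sign \<pi>) * (\<Prod>i<k. ?d (\<kappa> i) (\<pi> (2 * i)) (\<pi> (2 * i + 1))))"
    unfolding signed_sum_def using assms by (simp add: prod_sum_PiE sum_distrib_left)
  also have "\<dots> = (\<Sum>\<kappa>\<in>?K. \<Sum>\<pi>\<in>?P. of_int (sign \<pi>) * (\<Prod>i<k. ?d (\<kappa> i) (\<pi> (2 * i)) (\<pi> (2 * i + 1))))"
    by (rule sum.swap)
  also have "\<dots> = 0" using zero by (intro sum.neutral) blast
  finally show ?thesis .
qed

lemma generic_skew_antisym: "generic_skew j i = - generic_skew i j"
  by (simp add: generic_skew_def)

lemma ev_generic_skew:
  assumes "rhom \<phi>" "\<And>i j. B j i = - B i j" "\<And>i. B i i = 0"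
  shows "ev \<phi> (\<lambda>(i, j). B i j) (generic_skew i j) = B i j"
proof -
  interpret rhom "ev \<phi> (\<lambda>(i, j). B i j)" by (rule rhom_ev) fact
  have v: "ev \<phi> (\<lambda>(i, j). B i j) (mvar (i, j)) = B i j" for i j
    by (simp add: ev_mvar assms(1))
  show ?thesis unfolding generic_skew_def
    by (auto simp: hom_simps v assms(3) assms(2)[of i j])
qed

text \<open>As the Pfaffian is defined by an exact division, this is deduced from the torsion-free case of
  generic \<open>u\<close>, \<open>v\<close> over the integers.\<close>

lemma principal_pfaffian_low_rank:
  fixes \<phi> :: "'c::comm_ring_1 \<Rightarrow> 'r::comm_ring_1" and u v :: "'z \<Rightarrow> nat \<Rightarrow> 'r"
  assumes \<phi>: "rhom \<phi>" and S: "card S = 2 * r" and Z: "finite Z" "card Z < r"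
  shows "ev \<phi> (\<lambda>(i, j). \<Sum>c\<in>Z. u c i * v c j - u c j * v c i) (principal_pfaffian S) = 0"
proof -
  define A :: "nat \<Rightarrow> nat \<Rightarrow> (nat \<times> nat, int) mpoly" where
    "A i j = generic_skew (sorted_list_of_set S ! i) (sorted_list_of_set S ! j)" for i j
  define P where "P = pfaffian_int r A"
  have pf: "principal_pfaffian S = map_coeffs of_int P"
    by (simp add: principal_pfaffian_def P_def A_def[abs_def] S Let_def)
  \<comment> \<open>One independent variable per entry of the vectors; \<open>w\<close> specialises
    them to the given \<open>u\<close> and \<open>v\<close>.\<close>
  define U V :: "'z \<Rightarrow> nat \<Rightarrow> (bool \<times> 'z \<times> nat, int) mpoly"
    where "U c i = mvar (True, c, i)" and "V c i = mvar (False, c, i)" for c i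
  define B where "B i j = (\<Sum>c\<in>Z. U c i * V c j - U c j * V c i)" for i j
  define w where "w = (\<lambda>(b, c, i). if b then u c i else v c i)"
  interpret e: rhom "ev mconst (\<lambda>(i, j). B i j)" by (intro rhom_ev rhom_mconst)
  interpret w: rhom "ev of_int w" by (intro rhom_ev rhom_of_int)
  have B_skew: "B j i = - B i j" "B i i = 0" for i j
    by (simp_all add: B_def flip: sum_negf)
  have "of_nat (2 ^ r * fact r) * ev mconst (\<lambda>(i, j). B i j) P =
      ev mconst (\<lambda>(i, j). B i j) (of_nat (2 ^ r * fact r) * P)"
    by (simp only: e.hom_mult e.hom_of_nat)
  also have "of_nat (2 ^ r * fact r) * P = signed_sum r A"
    unfolding P_def by (rule pfaffian_int_signed_sum) (unfold A_def, rule generic_skew_antisym)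
  \<comment> \<open>The undivided sum, unlike coefficientwise division, visibly commutes with
    evaluation.\<close>
  also have "ev mconst (\<lambda>(i, j). B i j) \<dots> =
      signed_sum r (\<lambda>p q. B (sorted_list_of_set S ! p) (sorted_list_of_set S ! q))"
    unfolding signed_sum_def A_def
    by (simp add: e.hom_simps ev_generic_skew[OF rhom_mconst B_skew(1) B_skew(2)])
  also have "\<dots> = 0"
    unfolding B_def by (rule signed_sum_low_rank[OF Z, of "\<lambda>c p. U c (sorted_list_of_set S ! p)"
          "\<lambda>c p. V c (sorted_list_of_set S ! p)"])
  finally have tors: "of_nat (2 ^ r * fact r) * ev mconst (\<lambda>(i, j). B i j) P = 0" .
  have "(of_nat N :: (bool \<times> 'z \<times> nat, int) mpoly) = mconst (of_nat N)" for N
    by (rule rhom.hom_of_nat[OF rhom_mconst, symmetric])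
  hence "of_nat (2 ^ r * fact r) * Poly_Mapping.lookup (ev mconst (\<lambda>(i, j). B i j) P) m = 0" for m
    using arg_cong[OF tors, of "\<lambda>p. Poly_Mapping.lookup p m"] by (simp only: lookup_mconst_mult lookup_zero)
  hence zero: "ev mconst (\<lambda>(i, j). B i j) P = 0"
    by (intro poly_mapping_eqI) simp
  have wB: "ev of_int w (B i j) = (\<Sum>c\<in>Z. u c i * v c j - u c j * v c i)" for i j
  proof -
    have "ev of_int w (mvar (True, c, i)) = u c i" "ev of_int w (mvar (False, c, i)) = v c i" for c i
      by (simp_all add: ev_mvar rhom_of_int) (simp_all add: w_def)
    thus ?thesis by (simp add: B_def U_def V_def w.hom_simps)
  qed
  \<comment> \<open>The polynomial has integer coefficients, so its value over the target ring is
    the image under \<open>w\<close> of its generic value.\<close>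
  have "ev \<phi> a (map_coeffs of_int P) = ev of_int a P" for a
    using \<phi> by (simp add: ev_map_coeffs rhom_of_int rhom.hom_of_int)
  moreover have "ev of_int (\<lambda>(i, j). \<Sum>c\<in>Z. u c i * v c j - u c j * v c i) P =
      ev of_int w (ev mconst (\<lambda>(i, j). B i j) P)"
    unfolding hom_ev[OF w.rhom_axioms] by (simp add: ev_mconst rhom_of_int wB case_prod_unfold)
  ultimately show ?thesis using zero by (simp add: pf w.hom_zero)
qed

text \<open>The generators vanish on sums of fewer than \<open>r\<close> rank-two forms, and the
  common zeros of generators are zeros of the ideal.\<close>

lemma pfaffian_ideal_low_rank:
  fixes \<phi> :: "'c::comm_ring_1 \<Rightarrow> 'r::comm_ring_1" and u v :: "'z \<Rightarrow> nat \<Rightarrow> 'r"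
  assumes "f \<in> pfaffian_ideal n r" "rhom \<phi>" "finite Z" "card Z < r"
  shows "ev \<phi> (\<lambda>(i, j). \<Sum>c\<in>Z. u c i * v c j - u c j * v c i) f = 0"
proof -
  let ?a = "\<lambda>(i, j). \<Sum>c\<in>Z. u c i * v c j - u c j * v c i"
  interpret rhom "ev \<phi> ?a" by (rule rhom_ev) fact
  obtain T c where f: "f = (\<Sum>g\<in>T. c g * g)"
    and T: "T \<subseteq> {principal_pfaffian S | S. S \<subseteq> {..<2 * n} \<and> card S = 2 * r}"
    using assms(1) unfolding pfaffian_ideal_def ideal_generated_def by blast
  have "ev \<phi> ?a g = 0" if "g \<in> T" for g
    using that T principal_pfaffian_low_rank[OF assms(2) _ assms(3,4)] by blast
  thus ?thesis unfolding f by (simp add: hom_sum hom_mult)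
qed

section \<open>Kronecker substitution\<close>

text \<open>The degree of a monomial when the variable \<open>x\<close> is given degree
  \<open>w x\<close>.\<close>

definition weight :: "('x \<Rightarrow> nat) \<Rightarrow> ('x \<Rightarrow>\<^sub>0 nat) \<Rightarrow> nat" where
  "weight w m = (\<Sum>x\<in>Poly_Mapping.keys m. Poly_Mapping.lookup m x * w x)"

lemma weight_mult: "weight (\<lambda>x. k * w x) m = k * weight w m"
  by (simp add: weight_def sum_distrib_left mult.left_commute)

lemma monom_ev_power: "monom_ev (\<lambda>x. b ^ w x) m = b ^ weight w m"
  by (simp add: monom_ev_def weight_def power_sum mult.commute flip: power_mult)

lemma monom_ev_mult: "monom_ev (\<lambda>x. a x * b x) m = monom_ev a m * monom_ev b m"
  by (simp add: monom_ev_def power_mult_distrib prod.distrib)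

lemma digits_unique:
  fixes a b :: "nat \<Rightarrow> nat"
  assumes "(\<Sum>j<d. a j * N ^ j) = (\<Sum>j<d. b j * N ^ j)" "\<And>j. a j < N" "\<And>j. b j < N" "j < d"
  shows "a j = b j"
  using assms
proof (induction d arbitrary: a b j)
  case (Suc d)
  have N: "N > 0" using Suc.prems(2)[of 0] by simp
  have split: "(\<Sum>j<Suc d. c j * N ^ j) = c 0 + N * (\<Sum>j<d. c (Suc j) * N ^ j)" for c :: "nat \<Rightarrow> nat"
    by (simp only: sum.lessThan_Suc_shift) (simp add: sum_distrib_left mult_ac)
  have eq: "a 0 + N * (\<Sum>j<d. a (Suc j) * N ^ j) = b 0 + N * (\<Sum>j<d. b (Suc j) * N ^ j)"
    using Suc.prems(1) unfolding split .
  from arg_cong[OF eq, of "\<lambda>x. x mod N"] have 0: "a 0 = b 0"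
    using Suc.prems(2,3)[of 0] by simp
  with eq N have "(\<Sum>j<d. a (Suc j) * N ^ j) = (\<Sum>j<d. b (Suc j) * N ^ j)" by simp
  hence "a (Suc j) = b (Suc j)" if "j < d" for j
    using Suc.IH[of "\<lambda>j. a (Suc j)" "\<lambda>j. b (Suc j)"] Suc.prems(2,3) that by blast
  with 0 Suc.prems(4) show ?case by (cases j) auto
qed simp

text \<open>For these weights the exponents of a monomial are the base \<open>N\<close> digits of
  its weight, the exponent of \<open>x\<close> standing at place \<open>code x\<close>.\<close>

lemma weight_powers_inject:
  fixes m m' :: "'x \<Rightarrow>\<^sub>0 nat"
  assumes "inj code" and m: "\<And>x. Poly_Mapping.lookup m x < N" and m': "\<And>x. Poly_Mapping.lookup m' x < N"
    and eq: "weight (\<lambda>x. N ^ code x) m = weight (\<lambda>x. N ^ code x) m'"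
  shows "m = m'"
proof -
  define K where "K = Poly_Mapping.keys m \<union> Poly_Mapping.keys m'"
  have fin: "finite K" by (simp add: K_def)
  define d where "d = Suc (Max (insert 0 (code ` K)))"
  have d: "code ` K \<subseteq> {..<d}" using fin by (auto simp: d_def less_Suc_eq_le intro: Max_ge)
  \<comment> \<open>Places that are not codes of relevant variables get the digit zero.\<close>
  define digit where "digit m j = (if j \<in> code ` K then Poly_Mapping.lookup m (Hilbert_Choice.inv code j) else 0)"
    for m :: "'x \<Rightarrow>\<^sub>0 nat" and j
  have digit_code: "digit m (code x) = Poly_Mapping.lookup m x" if "x \<in> K" for m x
    using that \<open>inj code\<close> by (simp add: digit_def)
  have w: "weight (\<lambda>x. N ^ code x) m = (\<Sum>j<d. digit m j * N ^ j)" if "Poly_Mapping.keys m \<subseteq> K" for m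
  proof -
    have "weight (\<lambda>x. N ^ code x) m = (\<Sum>x\<in>K. Poly_Mapping.lookup m x * N ^ code x)"
      unfolding weight_def using that fin by (intro sum.mono_neutral_left) (auto simp: in_keys_iff)
    also have "\<dots> = (\<Sum>j\<in>code ` K. digit m j * N ^ j)"
      using \<open>inj code\<close> by (simp add: sum.reindex inj_on_subset digit_code)
    also have "\<dots> = (\<Sum>j<d. digit m j * N ^ j)"
      using d by (intro sum.mono_neutral_left) (auto simp: digit_def)
    finally show ?thesis .
  qed
  have N: "0 < N" using m[of undefined] by simp
  have "digit m j = digit m' j" if "j < d" for j
  proof (rule digits_unique[OF _ _ _ that])
    show "(\<Sum>j<d. digit m j * N ^ j) = (\<Sum>j<d. digit m' j * N ^ j)"
      using eq w[of m] w[of m'] by (simp add: K_def)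
  qed (use m m' N in \<open>auto simp: digit_def\<close>)
  hence "Poly_Mapping.lookup m x = Poly_Mapping.lookup m' x" if "x \<in> K" for x
    using d that digit_code[OF that, of m] digit_code[OF that, of m'] by auto
  moreover have "Poly_Mapping.lookup m x = Poly_Mapping.lookup m' x" if "x \<notin> K" for x
    using that by (simp add: K_def in_keys_iff)
  ultimately show ?thesis by (intro poly_mapping_eqI) blast
qed

text \<open>The bound is made at least 4 for the gap between weights required in
  \<open>leading_term\<close>.\<close>

lemma exponents_bounded:
  fixes p :: "('x, 'c::zero) mpoly"
  obtains N where "N \<ge> 4" "\<And>m x. m \<in> Poly_Mapping.keys p \<Longrightarrow> Poly_Mapping.lookup m x < N"
proof -
  define E where "E = (\<Union>m\<in>Poly_Mapping.keys p. Poly_Mapping.range m)"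
  have fin: "finite (insert 0 E)" by (simp add: E_def)
  define N where "N = Max (insert 0 E) + 4"
  have "Poly_Mapping.lookup m x < N" if "m \<in> Poly_Mapping.keys p" for m x
  proof (cases "Poly_Mapping.lookup m x = 0")
    case False
    hence "Poly_Mapping.lookup m x \<in> insert 0 E"
      using that by (auto simp: E_def intro!: bexI[of _ m] in_keys_lookup_in_range) (simp add: in_keys_iff)
    hence "Poly_Mapping.lookup m x \<le> Max (insert 0 E)" using fin by (rule Max_ge[rotated])
    thus ?thesis by (simp add: N_def)
  qed (simp add: N_def)
  moreover have "N \<ge> 4" by (simp add: N_def)
  ultimately show ?thesis using that by blast
qed

lemma rhom_fls_const: "rhom (fls_const :: 'a::comm_ring_1 \<Rightarrow> 'a fls)"
  by unfold_locales (simp_all add: fls_plus_const fls_const_mult_const)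

lemma sum_distinct_powers_nonzero:
  fixes c :: "'m \<Rightarrow> 'a::comm_ring_1"
  assumes "finite M" "inj_on W M" "m \<in> M" "c m \<noteq> 0"
  shows "(\<Sum>m\<in>M. fls_const (c m) * fls_X ^ W m) \<noteq> 0"
proof
  assume "(\<Sum>m\<in>M. fls_const (c m) * fls_X ^ W m) = 0"
  hence "0 = fls_nth (\<Sum>m'\<in>M. fls_const (c m') * fls_X ^ W m') (int (W m))" by simp
  also have "\<dots> = (\<Sum>m'\<in>M. if m' = m then c m else 0)"
    unfolding fls_nth_sum using assms(2,3) by (intro sum.cong refl) (auto simp: inj_on_def)
  also have "\<dots> = c m" using assms(1,3) by simp
  finally show False using assms(4) by simp
qed

text \<open>Distinct monomials become distinct powers of \<open>fls_X\<close>, so nothing can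
  cancel.\<close>

lemma ev_powers_nonzero:
  fixes p :: "('x, 'a::comm_ring_1) mpoly"
  assumes "p \<noteq> 0" "inj_on (weight w) (Poly_Mapping.keys p)"
  shows "ev fls_const (\<lambda>x. fls_X ^ w x) p \<noteq> 0"
proof -
  obtain m where m: "m \<in> Poly_Mapping.keys p" using assms(1) by (metis keys_eq_empty ex_in_conv)
  have "ev fls_const (\<lambda>x. fls_X ^ w x) p =
      (\<Sum>m\<in>Poly_Mapping.keys p. fls_const (Poly_Mapping.lookup p m) * fls_X ^ weight w m)"
    by (simp add: ev_def monom_ev_power)
  also have "\<dots> \<noteq> 0"
    by (rule sum_distinct_powers_nonzero[OF _ assms(2) m]) (use m in \<open>auto simp: in_keys_iff\<close>)
  finally show ?thesis .
qed

section \<open>Normal form of skew-symmetric matrices over a field\<close>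

text \<open>Symplectic Gaussian elimination: subtracting the rank-two form built from column
  \<open>b\<close> and row \<open>a\<close> of a nonzero entry clears both rows and both columns.
  Two indices leave the support for each form used. The zero diagonal is a separate hypothesis
  because of characteristic two.\<close>

lemma skew_matrix_decomposition:
  fixes X :: "nat \<Rightarrow> nat \<Rightarrow> 'k::field"
  assumes "finite I" "card I \<le> 2 * n" "\<And>i j. X j i = - X i j" "\<And>i. X i i = 0"
    "\<And>i j. i \<notin> I \<Longrightarrow> X i j = 0"
  shows "\<exists>P Q. \<forall>i j. X i j = (\<Sum>k<n. P k i * Q k j - P k j * Q k i)"
  using assms
proof (induction n arbitrary: I X)
  case 0
  thus ?case by auto
next
  case (Suc n)
  show ?case
  proof (cases "\<exists>a b. X a b \<noteq> 0")
    case False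
    thus ?thesis by (intro exI[of _ "\<lambda>_ _. 0"]) auto
  next
    case True
    then obtain a b where ab: "X a b \<noteq> 0" by blast
    have "a \<in> I" using ab Suc.prems(5) by blast
    moreover have "b \<in> I" using ab Suc.prems(3)[of b a] Suc.prems(5)[of b a] by force
    moreover have "a \<noteq> b" using ab Suc.prems(4) by blast
    ultimately have card: "card (I - {a, b}) \<le> 2 * n" using Suc.prems(1,2) by (simp add: card_Diff_subset)
    \<comment> \<open>Normalised so that \<open>p a = 1\<close> and \<open>p b = 0\<close>, while
      \<open>q a = 0\<close> and \<open>q b = X a b\<close>; hence the form agrees with
      \<open>X\<close> in rows \<open>a\<close> and \<open>b\<close>.\<close>
    define p where "p i = X i b / X a b" for i
    define q where "q j = X a j" for j
    define Y where "Y i j = X i j - (p i * q j - p j * q i)" for i j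
    have 1: "Y j i = - Y i j" "Y i i = 0" for i j
      using Suc.prems(3)[of j i] Suc.prems(4)[of i] by (simp_all add: Y_def)
    have "Y i j = 0" if i: "i \<notin> I - {a, b}" for i j
    proof -
      consider "i = a" | "i = b" | "i \<notin> I" using i by blast
      thus ?thesis
      proof cases
        case 1
        thus ?thesis using ab Suc.prems(4)[of a] by (simp add: Y_def p_def q_def)
      next
        case 2
        thus ?thesis using ab Suc.prems(4)[of b] Suc.prems(3)[of b j] by (simp add: Y_def p_def q_def)
      next
        case 3
        thus ?thesis using Suc.prems(5)[of i] Suc.prems(3)[of i a] by (simp add: Y_def p_def q_def)
      qed
    qed
    then obtain P Q where PQ: "\<And>i j. Y i j = (\<Sum>k<n. P k i * Q k j - P k j * Q k i)"
      using Suc.IH[of "I - {a, b}" Y] card 1 Suc.prems(1) by blast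
    define P' where "P' k = (if k < n then P k else p)" for k
    define Q' where "Q' k = (if k < n then Q k else q)" for k
    have "X i j = (\<Sum>k<Suc n. P' k i * Q' k j - P' k j * Q' k i)" for i j
    proof -
      have "X i j = Y i j + (p i * q j - p j * q i)" by (simp add: Y_def)
      thus ?thesis by (simp add: PQ P'_def Q'_def)
    qed
    thus ?thesis by blast
  qed
qed

section \<open>The \<open>\<epsilon>\<close>-adic filtration\<close>

definition emb :: "('x, 'a::field fps) mpoly \<Rightarrow> ('x, 'a fls) mpoly" where
  "emb = map_coeffs fps_to_fls"

abbreviation eps :: "('x, 'a::field fls) mpoly" where
  "eps \<equiv> mconst fls_X"

text \<open>The Gauss valuation with respect to \<epsilon> is at least \<open>d\<close>. In
  particular \<open>vge 0\<close> means that no coefficient has a pole. A predicate avoids assigning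
  a valuation to zero.\<close>

definition vge :: "nat \<Rightarrow> ('x, 'a::field fls) mpoly \<Rightarrow> bool" where
  "vge d p \<longleftrightarrow> (\<exists>E. p = eps ^ d * emb E)"

lemma rhom_fps_to_fls: "rhom (fps_to_fls :: 'a::field fps \<Rightarrow> 'a fls)"
  by unfold_locales (simp_all add: fls_times_fps_to_fls)

lemma rhom_fps_const: "rhom (fps_const :: 'a::comm_ring_1 \<Rightarrow> 'a fps)"
  by unfold_locales simp_all

global_interpretation emb: rhom "emb :: ('x, 'a::field fps) mpoly \<Rightarrow> _"
  unfolding emb_def by (rule rhom_map_coeffs[OF rhom_fps_to_fls])

global_interpretation mc: rhom "mconst :: 'c::comm_ring_1 \<Rightarrow> ('x, 'c) mpoly"
  by (rule rhom_mconst)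

lemma emb_mconst: "emb (mconst c) = mconst (fps_to_fls c)"
  by (simp add: emb_def map_coeffs_mconst)

lemma emb_map_const: "emb (map_coeffs fps_const g) = map_coeffs fls_const g"
  by (simp add: emb_def map_coeffs_map_coeffs)

section \<open>Closure properties of the filtration\<close>

lemma vge_add:
  assumes "vge d p" "vge d q"
  shows "vge d (p + q)"
proof -
  obtain E E' where "p = eps ^ d * emb E" "q = eps ^ d * emb E'" using assms by (auto simp: vge_def)
  hence "p + q = eps ^ d * emb (E + E')" by (simp only: emb.hom_add distrib_left)
  thus ?thesis unfolding vge_def by blast
qed

lemma vge_uminus:
  assumes "vge d p"
  shows "vge d (- p)"
proof -
  obtain E where "p = eps ^ d * emb E" using assms by (auto simp: vge_def)
  hence "- p = eps ^ d * emb (- E)" by (simp only: emb.hom_uminus mult_minus_right)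
  thus ?thesis unfolding vge_def by blast
qed

lemma vge_diff: "vge d p \<Longrightarrow> vge d q \<Longrightarrow> vge d (p - q)"
  using vge_add[of d p "- q"] vge_uminus[of d q] by simp

lemma vge_0 [simp]: "vge d 0"
  unfolding vge_def by (rule exI[of _ 0]) (simp add: emb.hom_zero)

lemma vge_mult: "vge d p \<Longrightarrow> vge d' q \<Longrightarrow> vge (d + d') (p * q)"
proof -
  assume "vge d p" "vge d' q"
  then obtain E E' where "p = eps ^ d * emb E" "q = eps ^ d' * emb E'" by (auto simp: vge_def)
  hence "p * q = eps ^ (d + d') * emb (E * E')"
    by (simp only: emb.hom_mult power_add mult_ac)
  thus ?thesis unfolding vge_def by blast
qed

lemma vge_sum: "(\<And>x. x \<in> A \<Longrightarrow> vge d (f x)) \<Longrightarrow> vge d (\<Sum>x\<in>A. f x)"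
  by (induction A rule: infinite_finite_induct) (auto intro: vge_add)

lemma vge_emb [simp]: "vge 0 (emb E)"
  unfolding vge_def by auto

lemma vge_1 [simp]: "vge 0 1"
  using vge_emb[of 1] by (simp add: emb.hom_one)

lemma eps_eq_emb: "eps = emb (mconst fps_X)"
  by (simp add: emb_mconst)

lemma vge_eps: "vge 0 eps"
  by (subst eps_eq_emb) (rule vge_emb)

lemma vge_eps_power [simp]: "vge d (eps ^ d)"
  unfolding vge_def by (intro exI[of _ 1]) (simp add: emb.hom_one)

lemma vge_mono: "vge d p \<Longrightarrow> d' \<le> d \<Longrightarrow> vge d' p"
proof -
  assume "vge d p" "d' \<le> d"
  then obtain E where p: "p = eps ^ d * emb E" by (auto simp: vge_def)
  have "p = eps ^ d' * emb (mconst fps_X ^ (d - d') * E)"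
    unfolding p emb.hom_mult emb.hom_power eps_eq_emb[symmetric] mult.assoc[symmetric] power_add[symmetric]
    using \<open>d' \<le> d\<close> by simp
  thus ?thesis unfolding vge_def by blast
qed

lemma vge_mult_left: "vge 0 p \<Longrightarrow> vge d q \<Longrightarrow> vge d (p * q)"
  using vge_mult[of 0 p d q] by simp

lemma vge_prod: "(\<And>x. x \<in> A \<Longrightarrow> vge 0 (f x)) \<Longrightarrow> vge 0 (\<Prod>x\<in>A. f x)"
  by (induction A rule: infinite_finite_induct) (auto intro: vge_mult_left)

lemma vge_power: "vge d p \<Longrightarrow> vge (k * d) (p ^ k)"
  by (induction k) (auto intro: vge_mult)

lemma vge_power_0: "vge 0 p \<Longrightarrow> vge 0 (p ^ k)"
  using vge_power[of 0 p k] by simp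

lemma vge_const [simp]: "vge 0 (mconst (fls_const c))"
  using vge_emb[of "mconst (fps_const c)"] by (simp add: emb_mconst)

lemma vge_monom_ev: "(\<And>x. vge 0 (a x)) \<Longrightarrow> vge 0 (monom_ev a m)"
  unfolding monom_ev_def by (intro vge_prod vge_power_0)

text \<open>The element \<open>eps\<close> is a unit over Laurent series, so its powers can be
  cancelled at the cost of the corresponding order.\<close>

lemma vge_eps_power_mult_cancel:
  assumes "vge (d + k) (eps ^ k * p)"
  shows "vge d p"
proof -
  obtain E where E: "eps ^ k * p = eps ^ (d + k) * emb E" using assms by (auto simp: vge_def)
  have inv: "mconst (inverse (fls_X ^ k)) * eps ^ k = 1"
    unfolding mc.hom_power[symmetric] mc.hom_mult[symmetric] by simp
  have "p = mconst (inverse (fls_X ^ k)) * eps ^ k * p" unfolding inv by simp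
  also have "\<dots> = mconst (inverse (fls_X ^ k)) * (eps ^ k * p)" by (rule mult.assoc)
  also have "\<dots> = mconst (inverse (fls_X ^ k)) * eps ^ k * (eps ^ d * emb E)"
    unfolding E power_add mult.assoc by (simp only: mult.left_commute)
  finally show ?thesis unfolding inv vge_def by auto
qed

section \<open>Approximation as congruence modulo \<epsilon>\<close>

lemma approximates_iff: "approximates P g \<longleftrightarrow> vge 1 (P - map_coeffs fls_const g)"
  unfolding approximates_def vge_def emb_def power_one_right diff_eq_eq by (simp only: add.commute)

lemma vge_map_const [simp]: "vge 0 (map_coeffs fls_const g)"
  by (simp flip: emb_map_const)

lemma approximates_vge_0: "approximates P g \<Longrightarrow> vge 0 P"
  using vge_add[OF vge_mono[of 1 "P - map_coeffs fls_const g" 0] vge_map_const[of g]]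
  by (simp add: approximates_iff)

lemma approximates_mult:
  assumes "approximates P g" "approximates Q h"
  shows "approximates (P * Q) (g * h)"
proof -
  interpret m: rhom "map_coeffs fls_const :: ('a, 'b) mpoly \<Rightarrow> _"
    by (rule rhom_map_coeffs[OF rhom_fls_const])
  have "P * Q - map_coeffs fls_const (g * h) =
      P * (Q - map_coeffs fls_const h) + map_coeffs fls_const h * (P - map_coeffs fls_const g)"
    unfolding m.hom_mult by (simp add: right_diff_distrib mult.commute)
  moreover have "vge 1 \<dots>"
    using assms approximates_vge_0[OF assms(1)] unfolding approximates_iff
    by (intro vge_add[OF vge_mult_left vge_mult_left[OF vge_map_const]])
  ultimately show ?thesis unfolding approximates_iff by (simp only:)
qed

lemma approximates_power:
  assumes "approximates P g"
  shows "approximates (P ^ k) (g ^ k)"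
proof (induction k)
  case 0
  show ?case unfolding approximates_iff power_0
      rhom.hom_one[OF rhom_map_coeffs[OF rhom_fls_const]] diff_self by (rule vge_0)
next
  case (Suc k)
  show ?case unfolding power_Suc by (rule approximates_mult[OF assms Suc])
qed

text \<open>Each Laurent coefficient has a pole of finite order and there are finitely many of
  them.\<close>

lemma poles_bounded: "\<exists>C. vge 0 (eps ^ C * p)"
proof (induction p rule: poly_mapping_single_induct)
  case (single m c)
  define n where "n = nat (- fls_subdegree c)"
  have "int n \<ge> - fls_subdegree c" by (simp add: n_def)
  then obtain c' where c': "c = fls_shift (int n) (fps_to_fls c')"
    using fls_as_fps' by blast
  have "fls_X ^ n * c = fps_to_fls c'"
    unfolding c' fls_X_power_times_conv_shift by simp
  hence "eps ^ n * Poly_Mapping.single m c = emb (Poly_Mapping.single m c')"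
    unfolding mc.hom_power[symmetric]
    by (simp only: emb_def map_coeffs_single fps_zero_to_fls mconst_def mult_single add_0)
  hence "vge 0 (eps ^ n * Poly_Mapping.single m c)" by (simp only: vge_emb)
  thus ?case by blast
next
  case (add p q)
  then obtain C D where CD: "vge 0 (eps ^ C * p)" "vge 0 (eps ^ D * q)" by blast
  have "vge 0 (eps ^ D * (eps ^ C * p) + eps ^ C * (eps ^ D * q))"
    using CD by (intro vge_add[OF vge_mult_left[OF vge_power_0[OF vge_eps]]
          vge_mult_left[OF vge_power_0[OF vge_eps]]])
  moreover have "y * (x * p) + x * (y * q) = (x * y) * (p + q)" for x y :: "('a, 'b fls) mpoly"
    by (simp only: distrib_left mult_ac)
  ultimately have "vge 0 (eps ^ C * eps ^ D * (p + q))" by (rule back_subst)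
  hence "vge 0 (eps ^ (C + D) * (p + q))" unfolding power_add .
  thus ?case by blast
qed

section \<open>The leading term of a polynomial in the Pfaffian ideal\<close>

text \<open>Coordinates on sums of \<open>n\<close> rank-two forms: \<open>PV i k\<close> and
  \<open>QV i k\<close> are the entries at \<open>i\<close> of the two vectors of the
  \<open>k\<close>-th form, and \<open>TV k\<close> scales that form.\<close>

datatype pv = PV nat nat | QV nat nat | TV nat

text \<open>The weights of the \<open>TV k\<close> exceed those of the relevant \<open>PV i k\<close> and \<open>QV i k\<close> when \<open>B\<close> is
  large, and distinct variables have distinct codes.\<close>

fun code :: "nat \<Rightarrow> pv \<Rightarrow> nat" where
  "code B (PV i k) = 3 * prod_encode (i, k)"
| "code B (QV i k) = 3 * prod_encode (i, k) + 1"
| "code B (TV k) = 3 * (B + k) + 2"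

lemma inj_code: "inj (code B)"
proof (rule injI)
  fix x y assume eq: "code B x = code B y"
  hence "code B x mod 3 = code B y mod 3" "code B x div 3 = code B y div 3" by simp_all
  thus "x = y" by (cases x; cases y) (auto simp: mod_Suc div_Suc dest: injD[OF inj_prod_encode])
qed

text \<open>The sum of the wedge products of \<open>u k\<close> and \<open>v k\<close>, that is, the
  congruence image of the standard block diagonal skew-symmetric matrix.\<close>

definition skewform :: "nat \<Rightarrow> (nat \<Rightarrow> nat \<Rightarrow> 'r::comm_ring_1) \<Rightarrow> (nat \<Rightarrow> nat \<Rightarrow> 'r) \<Rightarrow> nat \<Rightarrow> nat \<Rightarrow> 'r"
  where "skewform n u v i j = (\<Sum>k<n. u k i * v k j - u k j * v k i)"

definition generic_form :: "nat \<Rightarrow> (nat \<times> nat, 'c::comm_ring_1) mpoly \<Rightarrow> (pv, 'c) mpoly" where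
  "generic_form n f = ev mconst (\<lambda>(i, j). skewform n (\<lambda>k i. mvar (TV k) * mvar (PV i k))
     (\<lambda>k i. mvar (QV i k)) i j) f"

lemma ev_generic_form:
  assumes "rhom \<phi>"
  shows "ev \<phi> a (generic_form n f) =
    ev \<phi> (\<lambda>(i, j). skewform n (\<lambda>k i. a (TV k) * a (PV i k)) (\<lambda>k i. a (QV i k)) i j) f"
proof -
  interpret e: rhom "ev \<phi> a" by (rule rhom_ev) fact
  show ?thesis unfolding generic_form_def hom_ev[OF e.rhom_axioms]
    by (simp add: ev_mconst assms ev_mvar skewform_def e.hom_simps case_prod_unfold)
qed

text \<open>It suffices to find one nonzero value. A Kronecker substitution makes \<open>f\<close>
  nonzero at a skew-symmetric matrix over the Laurent series field, and such a matrix of size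
  \<open>2 * n\<close> is a sum of \<open>n\<close> rank-two forms, here with all scaling factors
  equal to 1.\<close>

lemma generic_form_nonzero:
  fixes f :: "(nat \<times> nat, 'a::field) mpoly"
  assumes "f \<noteq> 0" "mvars f \<subseteq> skew_vars n"
  shows "generic_form n f \<noteq> 0"
proof -
  obtain N where N: "\<And>m x. m \<in> Poly_Mapping.keys f \<Longrightarrow> Poly_Mapping.lookup m x < N"
    using exponents_bounded by blast
  define w where "w x = N ^ prod_encode x" for x
  have "inj_on (weight w) (Poly_Mapping.keys f)"
    unfolding w_def by (intro inj_onI weight_powers_inject[OF inj_prod_encode]) (auto simp: N)
  hence nz: "ev fls_const (\<lambda>x. fls_X ^ w x) f \<noteq> 0"
    by (rule ev_powers_nonzero[OF assms(1)])
  \<comment> \<open>The matrix is completed skew-symmetrically and extended by zero;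
    \<open>f\<close> only reads entries with \<open>i < j < 2 * n\<close>, where powers of
    \<open>fls_X\<close> stand.\<close>
  define X :: "nat \<Rightarrow> nat \<Rightarrow> 'a fls" where "X i j = (if i < j \<and> j < 2 * n then fls_X ^ w (i, j)
    else if j < i \<and> i < 2 * n then - (fls_X ^ w (j, i)) else 0)" for i j
  have "\<exists>P Q. \<forall>i j. X i j = (\<Sum>k<n. P k i * Q k j - P k j * Q k i)"
    by (rule skew_matrix_decomposition[of "{..<2 * n}"]) (auto simp: X_def)
  then obtain P Q where PQ: "\<And>i j. X i j = (\<Sum>k<n. P k i * Q k j - P k j * Q k i)" by blast
  define a where "a = (\<lambda>PV i k \<Rightarrow> P k i | QV i k \<Rightarrow> Q k i | TV k \<Rightarrow> 1)"
  have "ev fls_const a (generic_form n f) = ev fls_const (\<lambda>(i, j). X i j) f"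
    by (simp add: ev_generic_form[OF rhom_fls_const] a_def PQ skewform_def)
  also have "\<dots> = ev fls_const (\<lambda>x. fls_X ^ w x) f"
    using assms(2) by (intro ev_cong) (auto simp: X_def skew_vars_def)
  finally show ?thesis using nz by (auto simp: ev_def)
qed

text \<open>If \<open>m\<close> involved fewer than \<open>r\<close> scaling variables, setting all
  the others to zero would leave fewer than \<open>r\<close> forms, where \<open>f\<close> vanishes.
  But \<open>m\<close> survives this specialisation, and distinct weights prevent its
  cancellation.\<close>

lemma generic_form_support:
  fixes f :: "(nat \<times> nat, 'a::field) mpoly"
  assumes "f \<in> pfaffian_ideal n r" "m \<in> Poly_Mapping.keys (generic_form n f)"
  shows "r \<le> card {k. k < n \<and> Poly_Mapping.lookup m (TV k) \<noteq> 0}"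
proof (rule ccontr)
  define Z where "Z = {k. k < n \<and> Poly_Mapping.lookup m (TV k) \<noteq> 0}"
  assume "\<not> ?thesis"
  hence Z: "finite Z" "card Z < r" by (auto simp: Z_def)
  let ?G = "generic_form n f"
  obtain N where N: "\<And>m x. m \<in> Poly_Mapping.keys ?G \<Longrightarrow> Poly_Mapping.lookup m x < N"
    using exponents_bounded by blast
  define w where "w x = N ^ code 0 x" for x
  have inj: "inj_on (weight w) (Poly_Mapping.keys ?G)"
    unfolding w_def by (intro inj_onI weight_powers_inject[OF inj_code]) (auto simp: N)
  define killed where "killed = TV ` ({..<n} - Z)"
  define a :: "pv \<Rightarrow> 'a fls" where "a x = (if x \<in> killed then 0 else fls_X ^ w x)" for x
  define M where "M = {m \<in> Poly_Mapping.keys ?G. Poly_Mapping.keys m \<inter> killed = {}}"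
  have mono: "monom_ev a m' = (if Poly_Mapping.keys m' \<inter> killed = {} then fls_X ^ weight w m' else 0)" for m'
  proof (cases "Poly_Mapping.keys m' \<inter> killed = {}")
    case True
    hence "monom_ev a m' = monom_ev (\<lambda>x. fls_X ^ w x) m'"
      unfolding monom_ev_def by (intro prod.cong refl) (auto simp: a_def)
    thus ?thesis using True by (simp add: monom_ev_power)
  next
    case False
    then obtain x where "x \<in> Poly_Mapping.keys m'" "x \<in> killed" by blast
    hence "a x ^ Poly_Mapping.lookup m' x = 0" by (simp add: a_def in_keys_iff)
    hence "monom_ev a m' = 0"
      using \<open>x \<in> Poly_Mapping.keys m'\<close> unfolding monom_ev_def by (intro prod_zero) auto
    thus ?thesis using False by simp
  qed
  have "(\<Sum>m\<in>M. fls_const (Poly_Mapping.lookup ?G m) * fls_X ^ weight w m) = ev fls_const a ?G"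
    unfolding ev_def M_def mono by (intro sum.mono_neutral_cong_left) auto
  also have "\<dots> = ev fls_const (\<lambda>(i, j). \<Sum>k\<in>Z. (a (TV k) * a (PV i k)) * a (QV j k)
      - (a (TV k) * a (PV j k)) * a (QV i k)) f"
  proof -
    have "skewform n (\<lambda>k i. a (TV k) * a (PV i k)) (\<lambda>k i. a (QV i k)) i j =
        (\<Sum>k\<in>Z. (a (TV k) * a (PV i k)) * a (QV j k) - (a (TV k) * a (PV j k)) * a (QV i k))" for i j
      unfolding skewform_def by (intro sum.mono_neutral_right) (auto simp: Z_def a_def killed_def)
    thus ?thesis by (simp add: ev_generic_form[OF rhom_fls_const])
  qed
  also have "\<dots> = 0"
    by (rule pfaffian_ideal_low_rank[OF assms(1) rhom_fls_const Z,
          of "\<lambda>k i. a (TV k) * a (PV i k)" "\<lambda>k i. a (QV i k)"])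
  finally have "(\<Sum>m\<in>M. fls_const (Poly_Mapping.lookup ?G m) * fls_X ^ weight w m) = 0" .
  moreover have "m \<in> M"
    using assms(2) by (auto simp: M_def killed_def Z_def in_keys_iff)
  moreover have "inj_on (weight w) M" by (rule inj_on_subset[OF inj]) (auto simp: M_def)
  ultimately show False
    using sum_distinct_powers_nonzero[of M "weight w" m "Poly_Mapping.lookup ?G"] assms(2)
    by (simp add: M_def in_keys_iff)
qed

section \<open>Congruences modulo powers of \<epsilon> and leading terms\<close>

lemma vge_mult_cong:
  assumes "vge M (p - p')" "vge M (q - q')" "vge 0 p" "vge 0 q'"
  shows "vge M (p * q - p' * q')"
proof -
  have "p * q - p' * q' = p * (q - q') + q' * (p - p')" by (simp add: algebra_simps)
  thus ?thesis using assms by (auto intro!: vge_add vge_mult_left)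
qed

lemma vge_power_cong:
  assumes "vge M (p - p')" "vge 0 p" "vge 0 p'"
  shows "vge M (p ^ k - p' ^ k)"
  by (induction k) (use assms in \<open>auto intro!: vge_mult_cong vge_power_0\<close>)

lemma vge_monom_ev_cong:
  assumes "\<And>x. vge M (b x - b' x)" "\<And>x. vge 0 (b x)" "\<And>x. vge 0 (b' x)"
  shows "vge M (monom_ev b m - monom_ev b' m)"
proof -
  have "vge M ((\<Prod>x\<in>A. b x ^ Poly_Mapping.lookup m x) - (\<Prod>x\<in>A. b' x ^ Poly_Mapping.lookup m x))" for A
    by (induction A rule: infinite_finite_induct)
      (use assms in \<open>auto intro!: vge_mult_cong vge_power_0 vge_prod vge_power_cong\<close>)
  thus ?thesis by (simp add: monom_ev_def)
qed

abbreviation cst :: "'a::field \<Rightarrow> ('x, 'a fls) mpoly" where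
  "cst c \<equiv> mconst (fls_const c)"

lemma rhom_cst: "rhom (cst :: 'a::field \<Rightarrow> ('x, 'a fls) mpoly)"
  by (rule rhom_comp[OF rhom_mconst rhom_fls_const])

text \<open>Each monomial contributes its power of \<open>eps\<close> times a factor without poles,
  so all but the one of minimal weight are absorbed in the error.\<close>

lemma ev_leading_term:
  fixes G :: "('x, 'a::field) mpoly" and b :: "'x \<Rightarrow> ('v, 'a fls) mpoly"
  assumes m: "m \<in> Poly_Mapping.keys G"
    and min: "\<And>m'. m' \<in> Poly_Mapping.keys G \<Longrightarrow> m' \<noteq> m \<Longrightarrow> weight w m + k \<le> weight w m'"
    and b: "\<And>x. vge 0 (b x)"
  shows "vge (weight w m + k) (ev cst (\<lambda>x. eps ^ w x * b x) G -
    cst (Poly_Mapping.lookup G m) * eps ^ weight w m * monom_ev b m)"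
proof -
  let ?t = "\<lambda>m. cst (Poly_Mapping.lookup G m) * eps ^ weight w m * monom_ev b m"
  have "ev cst (\<lambda>x. eps ^ w x * b x) G = (\<Sum>m\<in>Poly_Mapping.keys G. ?t m)"
    by (simp add: ev_def monom_ev_mult monom_ev_power mult.assoc)
  also have "\<dots> = ?t m + (\<Sum>m\<in>Poly_Mapping.keys G - {m}. ?t m)"
    using m by (intro sum.remove) auto
  finally have "ev cst (\<lambda>x. eps ^ w x * b x) G - ?t m = (\<Sum>m\<in>Poly_Mapping.keys G - {m}. ?t m)"
    by simp
  moreover have "vge (weight w m + k) (?t m')" if "m' \<in> Poly_Mapping.keys G - {m}" for m'
  proof -
    have "vge (weight w m') (eps ^ weight w m' * (monom_ev b m' * cst (Poly_Mapping.lookup G m')))"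
      using vge_mult[OF vge_eps_power vge_mult_left[OF vge_monom_ev[of b, OF b] vge_const]] by simp
    thus ?thesis using min[of m'] that vge_mono by (simp add: mult_ac)
  qed
  ultimately show ?thesis by (simp only:) (rule vge_sum)
qed

text \<open>All data about \<open>f\<close> needed later. The numbers \<open>u\<close>,
  \<open>v\<close>, \<open>w\<close> are the exponents attached to the variables, \<open>K\<close>
  stretches them to reach any precision, and \<open>p\<close>, \<open>q\<close> are perturbations
  close to 1. The index \<open>t\<close> satisfies \<open>r \<le> Suc t\<close>, which leaves room
  for the vertices of the program in positions \<open>0\<close> to \<open>t\<close>.\<close>

lemma leading_term:
  fixes f :: "(nat \<times> nat, 'a::field) mpoly"
  assumes f: "f \<noteq> 0" "mvars f \<subseteq> skew_vars n" "f \<in> pfaffian_ideal n r" and "r > 0"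
  obtains c :: 'a and \<alpha> t D :: nat and u v :: "nat \<Rightarrow> nat \<Rightarrow> nat" and w :: "nat \<Rightarrow> nat" where
    "c \<noteq> 0" "\<alpha> > 0" "t < n" "r \<le> Suc t"
    "\<And>i j k. i < 2 * n \<Longrightarrow> j < k \<Longrightarrow> k < n \<Longrightarrow> w j + u i j + 1 \<le> w k \<and> w j + v i j + 1 \<le> w k"
    "\<And>K M (T :: nat \<Rightarrow> ('v, 'a fls) mpoly) p q g.
      M \<le> K \<Longrightarrow> vge 0 g \<Longrightarrow> (\<And>i k. i < 2 * n \<Longrightarrow> k < n \<Longrightarrow> vge M (p i k - 1) \<and> vge M (q i k - 1)) \<Longrightarrow>
      (\<And>k. k < n \<Longrightarrow> T k = eps ^ (2 * K * w k) * (if k = t then 1 + eps * g else 1)) \<Longrightarrow>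
      vge (K * D + M) (ev cst (\<lambda>(i, j). skewform n (\<lambda>k i. T k * (eps ^ (K * u i k) * p i k))
        (\<lambda>k i. eps ^ (K * v i k) * q i k) i j) f - cst c * eps ^ (K * D) * (1 + eps * g) ^ \<alpha>)"
proof -
  let ?G = "generic_form n f"
  have G: "?G \<noteq> 0" by (rule generic_form_nonzero) fact+
  obtain N where N4: "N \<ge> 4" and N: "\<And>m x. m \<in> Poly_Mapping.keys ?G \<Longrightarrow> Poly_Mapping.lookup m x < N"
    using exponents_bounded by blast
  have "finite (prod_encode ` ({..<2 * n} \<times> {..<n}))" by simp
  \<comment> \<open>Larger than all codes of index pairs in range, so that \<open>TV j\<close> has a
    higher code than \<open>PV i j\<close> and \<open>QV i j\<close>.\<close>
  then obtain B where "\<forall>x\<in>prod_encode ` ({..<2 * n} \<times> {..<n}). x < B"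
    unfolding finite_nat_set_iff_bounded by blast
  hence B: "prod_encode (i, k) < B" if "i < 2 * n" "k < n" for i k
    using that by blast
  define e where "e x = N ^ code B x" for x
  have inj: "inj_on (weight e) (Poly_Mapping.keys ?G)"
    unfolding e_def by (intro inj_onI weight_powers_inject[OF inj_code]) (auto simp: N)
  obtain m where m: "m \<in> Poly_Mapping.keys ?G"
    and min: "\<And>m'. m' \<in> Poly_Mapping.keys ?G \<Longrightarrow> weight e m \<le> weight e m'"
    using ex_has_least_nat[of "\<lambda>m. m \<in> Poly_Mapping.keys ?G" _ "weight e"] G
    by (metis keys_eq_empty ex_in_conv)
  have min': "weight e m + 1 \<le> weight e m'" if "m' \<in> Poly_Mapping.keys ?G" "m' \<noteq> m" for m'
    using min[OF that(1)] inj_onD[OF inj, of m m'] that m by force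
  define Z where "Z = {k. k < n \<and> Poly_Mapping.lookup m (TV k) \<noteq> 0}"
  have Z: "finite Z" "r \<le> card Z"
    using generic_form_support[OF f(3) m] by (auto simp: Z_def)
  \<comment> \<open>The largest index of a scaling variable in \<open>m\<close>. As \<open>Z\<close>
    lies in \<open>{..t}\<close> and has at least \<open>r\<close> elements, \<open>t\<close> is at
    least \<open>r - 1\<close>.\<close>
  define t where "t = Max Z"
  have "Z \<noteq> {}" using Z \<open>r > 0\<close> by auto
  hence "t \<in> Z" using Z(1) by (simp add: t_def)
  moreover have "Z \<subseteq> {..t}" using Z(1) by (auto simp: t_def)
  hence "card Z \<le> Suc t" using card_mono[of "{..t}" Z] by simp
  ultimately have t: "t < n" "Poly_Mapping.lookup m (TV t) > 0" "r \<le> Suc t"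
    using Z(2) by (auto simp: Z_def)
  \<comment> \<open>All weights are doubled because the factor \<open>eps ^ (2 * K * w k)\<close>
    will be split evenly between the two sides of the program matrix.\<close>
  define u v where "u i k = 2 * e (PV i k)" and "v i k = 2 * e (QV i k)" for i k
  define w where "w k = e (TV k)" for k
  define D where "D = weight (\<lambda>x. 2 * e x) m"
  define c where "c = Poly_Mapping.lookup ?G m"
  define \<alpha> where "\<alpha> = Poly_Mapping.lookup m (TV t)"
  show thesis
  proof (rule that[of c \<alpha> t w u v D])
    show "c \<noteq> 0" using m by (simp add: c_def in_keys_iff)
    show "\<alpha> > 0" "t < n" "r \<le> Suc t" using t by (simp_all add: \<alpha>_def)
  next
    fix i j k :: nat assume ijk: "i < 2 * n" "j < k" "k < n"
    have le: "code B (PV i j) \<le> code B (TV j)" "code B (QV i j) \<le> code B (TV j)"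
      using B[of i j] ijk by auto
    have mono: "N ^ x \<le> N ^ y" if "x \<le> y" for x y :: nat
      using that N4 by (intro power_increasing) auto
    \<comment> \<open>A larger index gains at least a factor \<open>N\<close>, which is at least 4;
      this covers \<open>w j\<close>, at most twice \<open>w j\<close> for \<open>u i j\<close> or
      \<open>v i j\<close>, and the final 1.\<close>
    have "N * N ^ code B (TV j) = N ^ Suc (code B (TV j))" by simp
    also have "\<dots> \<le> w k" unfolding w_def e_def using ijk by (intro mono) auto
    finally have "4 * N ^ code B (TV j) \<le> w k"
      using N4 mult_le_mono1[OF N4, of "N ^ code B (TV j)"] by linarith
    moreover have "1 \<le> N ^ code B (TV j)" using N4 by simp
    moreover have "u i j \<le> 2 * N ^ code B (TV j)" "v i j \<le> 2 * N ^ code B (TV j)"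
      using mono[OF le(1)] mono[OF le(2)] unfolding u_def v_def e_def by linarith+
    moreover have "w j = N ^ code B (TV j)" unfolding w_def e_def ..
    ultimately show "w j + u i j + 1 \<le> w k \<and> w j + v i j + 1 \<le> w k" by linarith
  next
    fix K M :: nat and T :: "nat \<Rightarrow> ('v, 'a fls) mpoly" and g :: "('v, 'a fls) mpoly"
      and p q :: "nat \<Rightarrow> nat \<Rightarrow> ('v, 'a fls) mpoly"
    assume "M \<le> K" and g: "vge 0 g"
      and pq: "\<And>i k. i < 2 * n \<Longrightarrow> k < n \<Longrightarrow> vge M (p i k - 1) \<and> vge M (q i k - 1)"
      and T: "\<And>k. k < n \<Longrightarrow> T k = eps ^ (2 * K * w k) * (if k = t then 1 + eps * g else 1)"
    \<comment> \<open>The actual factors left after extracting the powers of \<open>eps\<close>,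
      with default 1 out of range. Their idealisation \<open>b'\<close> keeps only the factor at
      \<open>TV t\<close>.\<close>
    define b where "b = (\<lambda>PV i k \<Rightarrow> if i < 2 * n \<and> k < n then p i k else 1
      | QV i k \<Rightarrow> if i < 2 * n \<and> k < n then q i k else 1
      | TV k \<Rightarrow> if k = t then 1 + eps * g else 1)"
    define b' where "b' x = (if x = TV t then 1 + eps * g else 1)" for x
    have v1: "vge 0 (1 + eps * g)" using g by (intro vge_add vge_mult_left vge_eps) auto
    have b': "vge 0 (b' x)" for x using v1 by (simp add: b'_def)
    have bb': "vge M (b x - b' x)" for x
      using pq by (cases x) (auto simp: b_def b'_def)
    have b: "vge 0 (b x)" for x
      using vge_add[OF vge_mono[OF bb'[of x] le0] b'[of x]] by simp
    have "monom_ev b' m = (\<Prod>x\<in>Poly_Mapping.keys m. if x = TV t then (1 + eps * g) ^ \<alpha> else 1)"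
      unfolding monom_ev_def by (intro prod.cong refl) (simp add: b'_def \<alpha>_def)
    also have "\<dots> = (1 + eps * g) ^ \<alpha>" using t(2) by (simp add: in_keys_iff)
    finally have b'm: "monom_ev b' m = (1 + eps * g) ^ \<alpha>" .
    let ?W = "\<lambda>x. K * (2 * e x)"
    have wt: "weight ?W m' = K * 2 * weight e m'" for m' by (simp add: weight_mult)
    have KD: "weight ?W m = K * D" by (simp add: weight_mult D_def)
    let ?ev = "ev cst (\<lambda>x. eps ^ ?W x * b x) ?G"
    have "vge (weight ?W m + K) (?ev - cst c * eps ^ weight ?W m * monom_ev b m)"
      unfolding c_def
    proof (rule ev_leading_term[OF m _ b])
      fix m' assume "m' \<in> Poly_Mapping.keys ?G" "m' \<noteq> m"
      from mult_le_mono2[OF min'[OF this], of "K * 2"] show "weight ?W m + K \<le> weight ?W m'"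
        unfolding wt by (simp add: algebra_simps)
    qed
    hence 1: "vge (K * D + M) (?ev - cst c * eps ^ (K * D) * monom_ev b m)"
      unfolding KD by (rule vge_mono) (simp add: \<open>M \<le> K\<close>)
    have "vge (K * D + M) (eps ^ (K * D) * (cst c * (monom_ev b m - monom_ev b' m)))"
      by (intro vge_mult vge_eps_power vge_mult_left vge_const vge_monom_ev_cong bb' b b')
    from vge_add[OF 1 this] have "vge (K * D + M) (?ev - cst c * eps ^ (K * D) * (1 + eps * g) ^ \<alpha>)"
      unfolding b'm by (simp add: algebra_simps)
    also have "?ev = ev cst (\<lambda>(i, j). skewform n (\<lambda>k i. T k * (eps ^ (K * u i k) * p i k))
        (\<lambda>k i. eps ^ (K * v i k) * q i k) i j) f"
      unfolding ev_generic_form[OF rhom_cst]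
    proof (rule ev_cong)
      fix x assume "x \<in> mvars f"
      then obtain i j where x: "x = (i, j)" "i < 2 * n" "j < 2 * n"
        using f(2) by (fastforce simp: skew_vars_def)
      have *: "2 * K * w k = K * (2 * e (TV k))" for k by (simp add: w_def)
      show "(\<lambda>(i, j). skewform n (\<lambda>k i. eps ^ ?W (TV k) * b (TV k) * (eps ^ ?W (PV i k) * b (PV i k)))
          (\<lambda>k i. eps ^ ?W (QV i k) * b (QV i k)) i j) x = (\<lambda>(i, j). skewform n
          (\<lambda>k i. T k * (eps ^ (K * u i k) * p i k)) (\<lambda>k i. eps ^ (K * v i k) * q i k) i j) x"
        unfolding x(1) prod.case skewform_def using x(2,3)
        by (intro sum.cong refl) (simp add: T b_def u_def v_def *)
    qed
    finally show "vge (K * D + M) (ev cst (\<lambda>(i, j). skewform n (\<lambda>k i. T k * (eps ^ (K * u i k) * p i k))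
        (\<lambda>k i. eps ^ (K * v i k) * q i k) i j) f - cst c * eps ^ (K * D) * (1 + eps * g) ^ \<alpha>)" .
  qed
qed

section \<open>Algebraic branching programs as triangular matrices\<close>

definition paths_to :: "('v, 'c) abp \<Rightarrow> nat \<Rightarrow> nat \<Rightarrow> nat list set" where
  "paths_to P j v = {vs. length vs = Suc j \<and> (\<forall>i\<le>j. vs ! i \<in> layer P i) \<and>
     (\<forall>i<j. (vs ! i, vs ! Suc i) \<in> edges P) \<and> vs ! j = v}"

text \<open>The dynamic programming recursion over layers. The value 1 at depth 0 is intended for
  the source, the only vertex of that layer.\<close>

fun path_sum :: "('v, 'c::comm_ring_1) abp \<Rightarrow> nat \<Rightarrow> nat \<Rightarrow> ('v, 'c) mpoly" where
  "path_sum P 0 v = 1"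
| "path_sum P (Suc j) v = (\<Sum>u\<in>layer P j. if (u, v) \<in> edges P then path_sum P j u * label P (u, v) else 0)"

lemma finite_paths_to:
  assumes "\<And>i. i \<le> j \<Longrightarrow> finite (layer P i)"
  shows "finite (paths_to P j v)"
proof (rule finite_subset)
  show "paths_to P j v \<subseteq> {vs. set vs \<subseteq> (\<Union>i\<le>j. layer P i) \<and> length vs = Suc j}"
  proof (intro subsetI CollectI conjI)
    fix vs x assume vs: "vs \<in> paths_to P j v" and "x \<in> set vs"
    then obtain i where "i < length vs" "x = vs ! i" by (auto simp: in_set_conv_nth)
    hence "i \<le> j" "x \<in> layer P i" using vs by (auto simp: paths_to_def)
    thus "x \<in> (\<Union>i\<le>j. layer P i)" by blast
  qed (simp add: paths_to_def)
  show "finite {vs. set vs \<subseteq> (\<Union>i\<le>j. layer P i) \<and> length vs = Suc j}"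
    using assms by (intro finite_lists_length_eq) auto
qed

text \<open>Splitting off the last edge is a bijection between paths of length \<open>Suc j\<close>
  to \<open>v\<close> and pairs of a predecessor of \<open>v\<close> and a path to it.\<close>

lemma sum_paths_to:
  assumes "\<And>i. i \<le> j \<Longrightarrow> finite (layer P i)" "v \<in> layer P j"
  shows "(\<Sum>vs\<in>paths_to P j v. \<Prod>i<j. label P (vs ! i, vs ! Suc i)) = path_sum P j v"
  using assms
proof (induction j arbitrary: v)
  case 0
  have "vs \<in> paths_to P 0 v \<longleftrightarrow> vs = [v]" for vs
  proof
    assume "vs \<in> paths_to P 0 v"
    hence "length vs = 1" "vs ! 0 = v" by (simp_all add: paths_to_def)
    thus "vs = [v]" by (cases vs) simp_all
  qed (use 0 in \<open>simp add: paths_to_def\<close>)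
  hence "paths_to P 0 v = {[v]}" by blast
  thus ?case by simp
next
  case (Suc j)
  let ?U = "{u \<in> layer P j. (u, v) \<in> edges P}"
  let ?g = "\<lambda>j vs. \<Prod>i<j. label P (vs ! i, vs ! Suc i)"
  have fin: "finite (layer P j)" using Suc.prems(1)[of j] by simp
  have "(\<Sum>vs\<in>paths_to P (Suc j) v. ?g (Suc j) vs) =
      (\<Sum>(u, vs)\<in>(SIGMA u:?U. paths_to P j u). ?g j vs * label P (u, v))"
  proof (rule sum.reindex_bij_witness[where i = "\<lambda>(u, vs). vs @ [v]" and j = "\<lambda>vs. (vs ! j, butlast vs)"])
    fix vs assume vs: "vs \<in> paths_to P (Suc j) v"
    hence len: "length vs = Suc (Suc j)" and last: "vs ! Suc j = v" by (auto simp: paths_to_def)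
    have "vs \<noteq> []" using len by auto
    hence "last vs = v" using len last by (simp add: last_conv_nth)
    thus "(case (vs ! j, butlast vs) of (u, vs) \<Rightarrow> vs @ [v]) = vs"
      using append_butlast_last_id[OF \<open>vs \<noteq> []\<close>] by simp
    have nth: "butlast vs ! i = vs ! i" if "i \<le> j" for i
      using that len by (simp add: nth_butlast)
    have lay: "vs ! i \<in> layer P i" if "i \<le> Suc j" for i using vs that by (simp add: paths_to_def)
    have ed: "(vs ! i, vs ! Suc i) \<in> edges P" if "i < Suc j" for i using vs that by (simp add: paths_to_def)
    have "butlast vs \<in> paths_to P j (vs ! j)"
      unfolding paths_to_def using len by (simp add: nth lay ed)
    thus "(vs ! j, butlast vs) \<in> (SIGMA u:?U. paths_to P j u)"
      using lay[of j] ed[of j] by (simp add: last)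
    show "(case (vs ! j, butlast vs) of (u, vs) \<Rightarrow> ?g j vs * label P (u, v)) = ?g (Suc j) vs"
      using last by (simp add: nth)
  next
    fix x assume "x \<in> (SIGMA u:?U. paths_to P j u)"
    then obtain u vs where x: "x = (u, vs)" and u: "u \<in> layer P j" "(u, v) \<in> edges P"
      and vs: "vs \<in> paths_to P j u" by auto
    have len: "length vs = Suc j" "vs ! j = u" using vs by (auto simp: paths_to_def)
    show "((case x of (u, vs) \<Rightarrow> vs @ [v]) ! j, butlast (case x of (u, vs) \<Rightarrow> vs @ [v])) = x"
      using len by (simp add: x nth_append)
    have "(vs @ [v]) ! i \<in> layer P i" if "i \<le> Suc j" for i
      using that vs Suc.prems(2) by (cases "i = Suc j") (simp_all add: paths_to_def nth_append)
    moreover have "((vs @ [v]) ! i, (vs @ [v]) ! Suc i) \<in> edges P" if "i < Suc j" for i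
      using that vs u by (cases "i = j") (simp_all add: paths_to_def nth_append)
    ultimately show "(case x of (u, vs) \<Rightarrow> vs @ [v]) \<in> paths_to P (Suc j) v"
      using len by (simp add: x paths_to_def nth_append)
  qed
  also have "\<dots> = (\<Sum>u\<in>?U. \<Sum>vs\<in>paths_to P j u. ?g j vs * label P (u, v))"
    using fin Suc.prems(1) by (subst sum.Sigma) (auto intro!: finite_paths_to)
  also have "\<dots> = (\<Sum>u\<in>?U. path_sum P j u * label P (u, v))"
  proof (rule sum.cong[OF refl])
    fix u assume "u \<in> ?U"
    thus "(\<Sum>vs\<in>paths_to P j u. ?g j vs * label P (u, v)) = path_sum P j u * label P (u, v)"
      using Suc.IH[of u] Suc.prems(1) by (simp flip: sum_distrib_right)
  qed
  also have "\<dots> = path_sum P (Suc j) v"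
    using fin by (simp add: sum.inter_filter)
  finally show ?case .
qed

text \<open>Ordering the vertices by layer makes the adjacency matrix \<open>A\<close> strictly
  upper triangular. The row vector \<open>\<rho>\<close> of path sums solves
  \<open>\<rho> = e_s + \<rho> A\<close>, so \<open>\<rho> (I - A)\<close> is the unit vector at the
  source.\<close>

lemma abp_matrix:
  fixes P :: "('v, 'c::comm_ring_1) abp"
  assumes abp: "is_abp_over K P" and card: "card (abp_vertices P) \<le> Suc t" and "t < n"
  obtains A :: "nat \<Rightarrow> nat \<Rightarrow> ('v, 'c) mpoly" and \<rho> :: "nat \<Rightarrow> ('v, 'c) mpoly" and s :: nat where
    "s \<le> t" "\<rho> t = abp_poly P" "\<And>l. l > t \<Longrightarrow> \<rho> l = 0"
    "\<And>l. \<rho> l = (if l = s then 1 else 0) + (\<Sum>k<n. \<rho> k * A k l)"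
    "\<And>k l. A k l = 0 \<or> k < l \<and> l \<le> t \<and> (\<exists>e\<in>edges P. A k l = label P e)"
proof -
  define d where "d = depth P"
  obtain s0 t0 where s0: "layer P 0 = {s0}" and t0: "layer P d = {t0}"
    using abp by (auto simp: is_abp_over_def d_def)
  have fin: "\<And>i. i \<le> d \<Longrightarrow> finite (layer P i)"
    and disj: "\<And>i j. i \<le> d \<Longrightarrow> j \<le> d \<Longrightarrow> i \<noteq> j \<Longrightarrow> layer P i \<inter> layer P j = {}"
    and edges: "edges P \<subseteq> (\<Union>i<d. layer P i \<times> layer P (Suc i))"
    using abp by (auto simp: is_abp_over_def d_def)
  define V where "V = abp_vertices P"
  have V: "V = (\<Union>i\<le>d. layer P i)" by (simp add: V_def abp_vertices_def d_def)
  have finV: "finite V" using fin by (auto simp: V)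
  define lay where "lay v = (LEAST i. v \<in> layer P i)" for v
  have lay: "lay v = i" if "v \<in> layer P i" "i \<le> d" for v i
  proof -
    have "lay v \<le> i" "v \<in> layer P (lay v)" unfolding lay_def using that by (auto intro: Least_le LeastI)
    thus ?thesis using disj[of "lay v" i] that by auto
  qed
  have edgeD: "\<exists>i<d. u \<in> layer P i \<and> v \<in> layer P (Suc i)" if "(u, v) \<in> edges P" for u v
    using that edges by auto
  have edge_V: "u \<in> V \<and> v \<in> V \<and> lay v = Suc (lay u)" if uv: "(u, v) \<in> edges P" for u v
  proof -
    obtain i where i: "i < d" "u \<in> layer P i" "v \<in> layer P (Suc i)" using edgeD[OF uv] by blast
    hence "lay u = i" "lay v = Suc i" using lay by simp_all
    thus ?thesis using i by (auto simp: V)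
  qed
  have s0V: "s0 \<in> V" and t0V: "t0 \<in> V" using s0 t0 by (auto simp: V)
  \<comment> \<open>Positions are counted down from \<open>t\<close>, so that the sink is exactly at
    \<open>t\<close> even when there are fewer than \<open>Suc t\<close> vertices. Ties within a
    layer are broken by vertex number; no subtraction is truncated for vertices.\<close>
  define later where "later v = {u \<in> V. lay v < lay u \<or> lay v = lay u \<and> v < u}" for v
  define pos where "pos v = t - card (later v)" for v
  have fin_later: "finite (later v)" for v using finV by (simp add: later_def)
  have card_later: "card (later v) \<le> t" if "v \<in> V" for v
  proof -
    have "later v \<subset> V" using that by (auto simp: later_def)
    hence "card (later v) < card V" using finV by (rule psubset_card_mono[rotated])
    thus ?thesis using card by (simp add: V_def)
  qed
  have pos_less: "pos u < pos v" if "v \<in> later u" "u \<in> V" for u v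
  proof -
    have "later v \<subset> later u" using that(1) by (auto simp: later_def)
    hence "card (later v) < card (later u)" using fin_later by (rule psubset_card_mono[rotated])
    thus ?thesis using card_later[OF that(2)] by (simp add: pos_def)
  qed
  have inj: "inj_on pos V"
  proof (rule inj_onI)
    fix u v assume uv: "u \<in> V" "v \<in> V" "pos u = pos v"
    have "u = v \<or> v \<in> later u \<or> u \<in> later v"
      using uv linorder_less_linear[of u v] linorder_less_linear[of "lay u" "lay v"]
      by (auto simp: later_def)
    thus "u = v" using pos_less[of v u] pos_less[of u v] uv by auto
  qed
  have lay_le: "lay v \<le> d" if "v \<in> V" for v
    using that lay by (auto simp: V)
  have "later t0 = {}"
  proof -
    have "lay t0 = d" using t0 lay by simp
    moreover have "u = t0" if "u \<in> V" "lay u = d" for u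
      using that lay t0 unfolding V by (metis UN_E atMost_iff singletonD)
    ultimately show ?thesis using lay_le by (force simp: later_def)
  qed
  hence pos_t0: "pos t0 = t" by (simp add: pos_def)
  have pos_le: "pos v \<le> t" for v by (simp add: pos_def)
  define vx where "vx = inv_into V pos"
  have vx: "vx (pos v) = v" if "v \<in> V" for v using inj that by (simp add: vx_def)
  define A where "A k l = (if k \<in> pos ` V \<and> l \<in> pos ` V \<and> (vx k, vx l) \<in> edges P
    then label P (vx k, vx l) else 0)" for k l
  define ps where "ps v = path_sum P (lay v) v" for v
  \<comment> \<open>Positions without a vertex receive zero, consistently with the zero rows and
    columns of \<open>A\<close> there.\<close>
  define \<rho> where "\<rho> l = (if l \<in> pos ` V then ps (vx l) else 0)" for l
  have ps: "ps v = (if v = s0 then 1 else 0) +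
      (\<Sum>u\<in>V. if (u, v) \<in> edges P then ps u * label P (u, v) else 0)" if v: "v \<in> V" for v
  proof (cases "lay v")
    case 0
    obtain i where "v \<in> layer P i" "i \<le> d" using v by (auto simp: V)
    hence "v = s0" using lay 0 s0 by auto
    moreover have "(u, v) \<notin> edges P" for u using edge_V[of u v] 0 by auto
    ultimately show ?thesis using 0 by (simp add: ps_def)
  next
    case (Suc j)
    have "v \<noteq> s0" using Suc lay[of s0 0] s0 by auto
    have j: "j \<le> d" using lay_le[OF v] Suc by simp
    have u: "lay u = j" if "u \<in> layer P j" for u using lay that j by blast
    have "(\<Sum>u\<in>V. if (u, v) \<in> edges P then ps u * label P (u, v) else 0) =
        (\<Sum>u\<in>layer P j. if (u, v) \<in> edges P then ps u * label P (u, v) else 0)"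
    proof (rule sum.mono_neutral_right[OF finV])
      show "layer P j \<subseteq> V" using j by (auto simp: V)
      show "\<forall>u\<in>V - layer P j. (if (u, v) \<in> edges P then ps u * label P (u, v) else 0) = 0"
      proof
        fix u assume u: "u \<in> V - layer P j"
        have "(u, v) \<notin> edges P"
        proof
          assume "(u, v) \<in> edges P"
          from edgeD[OF this] obtain i where i: "i < d" "u \<in> layer P i" "v \<in> layer P (Suc i)" by blast
          hence "Suc i = Suc j" using lay[of v "Suc i"] Suc by simp
          thus False using i u by simp
        qed
        thus "(if (u, v) \<in> edges P then ps u * label P (u, v) else 0) = 0" by simp
      qed
    qed
    also have "\<dots> = path_sum P (Suc j) v"
      unfolding path_sum.simps by (intro sum.cong refl) (simp add: ps_def u)
    finally show ?thesis using \<open>v \<noteq> s0\<close> by (simp add: ps_def Suc)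
  qed
  show thesis
  proof (rule that[of "pos s0" \<rho> A])
    show "pos s0 \<le> t" by (rule pos_le)
  next
    have "abp_paths P = paths_to P d t0"
      using t0 by (auto simp: abp_paths_def paths_to_def d_def)
    hence "abp_poly P = path_sum P d t0"
      unfolding abp_poly_def using sum_paths_to[of d P t0, OF fin] t0 by (simp add: d_def)
    also have "\<dots> = \<rho> t"
      using t0V pos_t0 vx[OF t0V] lay[of t0 d] t0 by (auto simp: \<rho>_def ps_def)
    finally show "\<rho> t = abp_poly P" ..
  next
    fix l assume "l > t"
    hence "l \<notin> pos ` V" using pos_le by (auto simp: not_le[symmetric])
    thus "\<rho> l = 0" by (simp add: \<rho>_def)
  next
    fix l
    show "\<rho> l = (if l = pos s0 then 1 else 0) + (\<Sum>k<n. \<rho> k * A k l)"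
    proof (cases "l \<in> pos ` V")
      case False
      thus ?thesis using s0V by (auto simp: \<rho>_def A_def)
    next
      case True
      then obtain v where v: "v \<in> V" "l = pos v" by blast
      have "(\<Sum>k<n. \<rho> k * A k l) = (\<Sum>k\<in>pos ` V. \<rho> k * A k l)"
        using pos_le \<open>t < n\<close> by (intro sum.mono_neutral_right) (auto simp: \<rho>_def intro: le_less_trans[OF pos_le])
      also have "\<dots> = (\<Sum>u\<in>V. if (u, v) \<in> edges P then ps u * label P (u, v) else 0)"
        unfolding sum.reindex[OF inj] using v
        by (intro sum.cong refl) (auto simp: \<rho>_def A_def vx)
      finally show ?thesis
        using ps[OF v(1)] v s0V inj by (auto simp: \<rho>_def vx inj_on_eq_iff)
    qed
  next
    fix k l
    show "A k l = 0 \<or> k < l \<and> l \<le> t \<and> (\<exists>e\<in>edges P. A k l = label P e)"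
    proof (cases "A k l = 0")
      case False
      then obtain u v where uv: "u \<in> V" "v \<in> V" "k = pos u" "l = pos v" "(u, v) \<in> edges P"
        and A: "A k l = label P (u, v)"
        by (auto simp: A_def vx split: if_splits)
      have "v \<in> later u" using edge_V[OF uv(5)] by (auto simp: later_def)
      hence "k < l" using pos_less uv by blast
      thus ?thesis using A uv pos_le by blast
    qed simp
  qed
qed

text \<open>Since \<open>\<rho> R\<close> is the unit vector at \<open>s\<close>, adding
  \<open>e\<close> at \<open>(t, s)\<close> amounts to multiplying \<open>R\<close> on the left by
  the identity with \<open>e * \<rho>\<close> added to row \<open>t\<close>. That factor is
  \<open>L\<close> times \<open>D\<close>, because \<open>\<rho>\<close> vanishes beyond
  \<open>t\<close>.\<close>

lemma triangular_factorization:
  fixes e :: "'r::comm_ring_1" and n s t k l :: nat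
  assumes A: "\<And>k l. \<not> (k < l \<and> l \<le> t) \<Longrightarrow> A k l = 0"
    and \<rho>: "\<And>l. l < n \<Longrightarrow> \<rho> l = (if l = s then 1 else 0) + (\<Sum>k<n. \<rho> k * A k l)"
    and \<rho>0: "\<And>l. l > t \<Longrightarrow> \<rho> l = 0"
    and kl: "k < n" "l < n" and t: "t < n"
  defines "L \<equiv> \<lambda>k m. if k = m then 1 else if k = t \<and> m < t then e * \<rho> m else 0"
    and "D \<equiv> \<lambda>m. if m = t then 1 + e * \<rho> t else 1"
    and "R \<equiv> \<lambda>m l. (if m = l then 1 else 0) - A m l"
  shows "(\<Sum>m<n. L k m * D m * R m l) = R k l + (if k = t \<and> l = s then e else 0)"
proof (cases "k = t")
  case False
  hence "(\<Sum>m<n. L k m * D m * R m l) = (\<Sum>m<n. if m = k then R k l else 0)"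
    by (intro sum.cong refl) (auto simp: L_def D_def)
  thus ?thesis using False kl by simp
next
  case True
  have "L k m * D m = (if m = t then 1 else 0) + e * \<rho> m" if "m < n" for m
    using True \<rho>0[of m] by (auto simp: L_def D_def)
  hence "(\<Sum>m<n. L k m * D m * R m l) = (\<Sum>m<n. (if m = t then R m l else 0) + e * (\<rho> m * R m l))"
    by (intro sum.cong refl) (auto simp: algebra_simps)
  also have "\<dots> = R t l + e * (\<Sum>m<n. \<rho> m * R m l)"
    using t by (simp add: sum.distrib sum_distrib_left)
  also have "(\<Sum>m<n. \<rho> m * R m l) = (\<Sum>m<n. (if m = l then \<rho> m else 0) - \<rho> m * A m l)"
    by (intro sum.cong refl) (auto simp: R_def algebra_simps)
  also have "\<dots> = \<rho> l - (\<Sum>m<n. \<rho> m * A m l)"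
    using kl by (simp add: sum_subtractf)
  also have "\<dots> = (if l = s then 1 else 0)" using \<rho>[OF kl(2)] by simp
  finally show ?thesis using True by simp
qed

lemma bilinear_factorization:
  fixes X Y :: "nat \<Rightarrow> 'r::comm_ring_1"
  assumes "\<And>k l. k < n \<Longrightarrow> l < n \<Longrightarrow> (\<Sum>m<n. L k m * D m * R m l) = B k l"
  shows "(\<Sum>k<n. \<Sum>l<n. X k * B k l * Y l) =
    (\<Sum>m<n. D m * (\<Sum>k<n. X k * L k m) * (\<Sum>l<n. R m l * Y l))"
proof -
  have "(\<Sum>k<n. \<Sum>l<n. X k * B k l * Y l) =
      (\<Sum>k<n. \<Sum>l<n. \<Sum>m<n. D m * (X k * L k m) * (R m l * Y l))"
  proof (intro sum.cong refl)
    fix k l assume "k \<in> {..<n}" "l \<in> {..<n}"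
    hence "X k * B k l * Y l = X k * (\<Sum>m<n. L k m * D m * R m l) * Y l" using assms by simp
    also have "\<dots> = (\<Sum>m<n. D m * (X k * L k m) * (R m l * Y l))"
      unfolding sum_distrib_left sum_distrib_right by (intro sum.cong refl) (simp add: mult_ac)
    finally show "X k * B k l * Y l = (\<Sum>m<n. D m * (X k * L k m) * (R m l * Y l))" .
  qed
  also have "\<dots> = (\<Sum>k<n. \<Sum>m<n. \<Sum>l<n. D m * (X k * L k m) * (R m l * Y l))"
    by (intro sum.cong refl sum.swap)
  also have "\<dots> = (\<Sum>m<n. \<Sum>k<n. \<Sum>l<n. D m * (X k * L k m) * (R m l * Y l))"
    by (rule sum.swap)
  also have "\<dots> = (\<Sum>m<n. D m * (\<Sum>k<n. X k * L k m) * (\<Sum>l<n. R m l * Y l))"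
    by (intro sum.cong refl) (simp add: sum_distrib_left sum_distrib_right mult_ac)
  finally show ?thesis .
qed

section \<open>Depth-three circuits\<close>

lemma eps_poly_simps:
  "eps_poly (p + q) = eps_poly p + eps_poly q" "eps_poly (p * q) = eps_poly p * eps_poly q"
  "eps_poly (- p) = - eps_poly p" "eps_poly 1 = 1" "eps_poly 0 = 0" "eps_poly p = 0 \<longleftrightarrow> p = 0"
  by (simp_all add: eps_poly_def fps_of_poly_add fps_of_poly_mult fps_of_poly_uminus
      fls_times_fps_to_fls)

lemma
  fixes c :: "'a::field" and x y :: "'a fls"
  shows eps_rational_0: "(0 :: 'a fls) \<in> eps_rational_functions"
    and eps_rational_1: "(1 :: 'a fls) \<in> eps_rational_functions"
    and eps_rational_const: "fls_const c \<in> eps_rational_functions"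
    and eps_rational_X: "(fls_X :: 'a fls) \<in> eps_rational_functions"
    and eps_rational_add: "x \<in> eps_rational_functions \<Longrightarrow> y \<in> eps_rational_functions \<Longrightarrow> x + y \<in> eps_rational_functions"
    and eps_rational_mult: "x \<in> eps_rational_functions \<Longrightarrow> y \<in> eps_rational_functions \<Longrightarrow> x * y \<in> eps_rational_functions"
    and eps_rational_uminus: "x \<in> eps_rational_functions \<Longrightarrow> - x \<in> eps_rational_functions"
    and eps_rational_inverse: "x \<in> eps_rational_functions \<Longrightarrow> inverse x \<in> eps_rational_functions"
proof -
  have intro: "eps_poly p / eps_poly q \<in> eps_rational_functions" if "q \<noteq> 0" for p q :: "'a poly"
    using that unfolding eps_rational_functions_def by blast
  have intro': "eps_poly p \<in> eps_rational_functions" for p :: "'a poly"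
    using intro[of 1 p] by (simp add: eps_poly_simps)
  show "(0 :: 'a fls) \<in> eps_rational_functions" "(1 :: 'a fls) \<in> eps_rational_functions"
    using intro'[of 0] intro'[of 1] by (simp_all add: eps_poly_simps)
  show "fls_const c \<in> eps_rational_functions" "(fls_X :: 'a fls) \<in> eps_rational_functions"
    using intro'[of "[:c:]"] intro'[of "[:0, 1:]"] by (simp_all add: eps_poly_def fps_of_poly_const fps_of_poly_fps_X)
  show "x + y \<in> eps_rational_functions" "x * y \<in> eps_rational_functions"
    if xy: "x \<in> eps_rational_functions" "y \<in> eps_rational_functions"
  proof -
    obtain p q p' q' where x: "x = eps_poly p / eps_poly q" "q \<noteq> 0" and y: "y = eps_poly p' / eps_poly q'" "q' \<noteq> 0"
      using xy unfolding eps_rational_functions_def by blast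
    have "x + y = eps_poly (p * q' + p' * q) / eps_poly (q * q')"
      using x y by (simp add: eps_poly_simps add_frac_eq)
    moreover have "x * y = eps_poly (p * p') / eps_poly (q * q')"
      using x y by (simp add: eps_poly_simps)
    ultimately show "x + y \<in> eps_rational_functions" "x * y \<in> eps_rational_functions"
      using intro[of "q * q'"] x y by simp_all
  qed
  show "- x \<in> eps_rational_functions" "inverse x \<in> eps_rational_functions"
    if xx: "x \<in> eps_rational_functions"
  proof -
    obtain p q where x: "x = eps_poly p / eps_poly q" "q \<noteq> 0"
      using xx unfolding eps_rational_functions_def by blast
    have "- x = eps_poly (- p) / eps_poly q" using x by (simp add: eps_poly_simps)
    thus "- x \<in> eps_rational_functions" using intro x(2) by simp
    show "inverse x \<in> eps_rational_functions"
    proof (cases "p = 0")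
      case True
      thus ?thesis using x intro'[of 0] by (simp add: eps_poly_simps)
    next
      case False
      have "inverse x = eps_poly q / eps_poly p" using x by simp
      thus ?thesis using intro False by simp
    qed
  qed
qed

lemma eps_rational_X_power: "fls_X ^ k \<in> eps_rational_functions"
  by (induction k) (auto intro: eps_rational_1 eps_rational_mult eps_rational_X)

text \<open>The explicit form computed by one bottom addition gate: a scalar for each variable and
  one for the constant gate. The set of variables is finite, so all variables can be listed.\<close>

definition rational_affine :: "('v::finite, 'a::field fls) mpoly \<Rightarrow> bool" where
  "rational_affine p \<longleftrightarrow> (\<exists>c0 c. p = mconst c0 + (\<Sum>v\<in>UNIV. mconst (c v) * mvar v) \<and>
     c0 \<in> eps_rational_functions \<and> (\<forall>v. c v \<in> eps_rational_functions))"

lemma rational_affine_add: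
  assumes "rational_affine p" "rational_affine q"
  shows "rational_affine (p + q)"
proof -
  obtain c0 c d0 d where "p = mconst c0 + (\<Sum>v\<in>UNIV. mconst (c v) * mvar v)"
    "q = mconst d0 + (\<Sum>v\<in>UNIV. mconst (d v) * mvar v)" and
    *: "c0 \<in> eps_rational_functions" "\<forall>v. c v \<in> eps_rational_functions"
       "d0 \<in> eps_rational_functions" "\<forall>v. d v \<in> eps_rational_functions"
    using assms unfolding rational_affine_def by blast
  hence "p + q = mconst (c0 + d0) + (\<Sum>v\<in>UNIV. mconst (c v + d v) * mvar v)"
    by (simp add: mc.hom_add distrib_right sum.distrib)
  thus ?thesis unfolding rational_affine_def
    by (intro exI[of _ "c0 + d0"] exI[of _ "\<lambda>v. c v + d v"]) (use * in \<open>simp add: eps_rational_add\<close>)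
qed

lemma rational_affine_scale:
  assumes "rational_affine p" "a \<in> eps_rational_functions"
  shows "rational_affine (mconst a * p)"
proof -
  obtain c0 c where "p = mconst c0 + (\<Sum>v\<in>UNIV. mconst (c v) * mvar v)" and
    *: "c0 \<in> eps_rational_functions" "\<forall>v. c v \<in> eps_rational_functions"
    using assms unfolding rational_affine_def by blast
  hence "mconst a * p = mconst (a * c0) + (\<Sum>v\<in>UNIV. mconst (a * c v) * mvar v)"
    by (simp add: mc.hom_mult distrib_left sum_distrib_left mult.assoc)
  thus ?thesis unfolding rational_affine_def
    by (intro exI[of _ "a * c0"] exI[of _ "\<lambda>v. a * c v"]) (use * assms(2) in \<open>simp add: eps_rational_mult\<close>)
qed

lemma rational_affine_const: "a \<in> eps_rational_functions \<Longrightarrow> rational_affine (mconst a)"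
  unfolding rational_affine_def by (intro exI[of _ a] exI[of _ "\<lambda>_. 0"]) (simp add: eps_rational_0)

lemma rational_affine_0: "rational_affine 0"
  using rational_affine_const[OF eps_rational_0] by simp

lemma rational_affine_uminus: "rational_affine p \<Longrightarrow> rational_affine (- p)"
  using rational_affine_scale[of p "- 1"] eps_rational_uminus[OF eps_rational_1]
  by (simp add: mc.hom_uminus)

lemma rational_affine_diff: "rational_affine p \<Longrightarrow> rational_affine q \<Longrightarrow> rational_affine (p - q)"
  using rational_affine_add[of p "- q"] rational_affine_uminus[of q] by simp

lemma rational_affine_sum: "(\<And>x. x \<in> A \<Longrightarrow> rational_affine (F x)) \<Longrightarrow> rational_affine (\<Sum>x\<in>A. F x)"
  by (induction A rule: infinite_finite_induct) (auto intro: rational_affine_add rational_affine_0)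

lemma rational_affine_mvar: "rational_affine (mvar v)"
proof -
  have "mvar v = mconst 0 + (\<Sum>u\<in>UNIV. mconst (if u = v then 1 else 0) * (mvar u :: ('a, 'b fls) mpoly))"
  proof -
    have "mconst (if u = v then 1 else 0) * mvar u = (if u = v then mvar v else 0 :: ('a, 'b fls) mpoly)" for u
      by simp
    thus ?thesis by simp
  qed
  thus ?thesis unfolding rational_affine_def
    by (intro exI[of _ 0] exI[of _ "\<lambda>u. if u = v then 1 else 0"])
      (simp add: eps_rational_0 eps_rational_1)
qed

text \<open>Total degree at most 1 leaves only the empty monomial and single variables.\<close>

lemma affine_linear_rational_affine:
  fixes p :: "('v::finite, 'a::field fls) mpoly"
  assumes "affine_linear p" "mcoeffs p \<subseteq> eps_rational_functions"
  shows "rational_affine p"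
proof -
  have "rational_affine (Poly_Mapping.single m (Poly_Mapping.lookup p m))" if "m \<in> Poly_Mapping.keys p" for m
  proof -
    have c: "Poly_Mapping.lookup p m \<in> eps_rational_functions" (is "?c \<in> _")
      using assms(2) by (auto simp: mcoeffs_def)
    have le: "(\<Sum>x\<in>Poly_Mapping.keys m. Poly_Mapping.lookup m x) \<le> 1"
      using assms(1) that by (simp add: affine_linear_def)
    show ?thesis
    proof (cases "m = 0")
      case True
      thus ?thesis using rational_affine_const[OF c] by (simp add: mconst_def)
    next
      case False
      then obtain x where x: "x \<in> Poly_Mapping.keys m" by (metis keys_eq_empty ex_in_conv)
      have "(\<Sum>y\<in>Poly_Mapping.keys m. Poly_Mapping.lookup m y) =
          Poly_Mapping.lookup m x + (\<Sum>y\<in>Poly_Mapping.keys m - {x}. Poly_Mapping.lookup m y)"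
        using x by (intro sum.remove) auto
      moreover have "Poly_Mapping.lookup m x > 0" using x by (simp add: in_keys_iff)
      ultimately have 1: "Poly_Mapping.lookup m x = 1"
        and "(\<Sum>y\<in>Poly_Mapping.keys m - {x}. Poly_Mapping.lookup m y) = 0" using le by linarith+
      hence "\<forall>y\<in>Poly_Mapping.keys m - {x}. Poly_Mapping.lookup m y = 0"
        by (subst (asm) sum_eq_0_iff) simp_all
      hence "m = Poly_Mapping.single x 1" using 1
        by (intro poly_mapping_eqI) (auto simp: lookup_single when_def in_keys_iff)
      hence "Poly_Mapping.single m ?c = mconst ?c * mvar x"
        by (simp add: mconst_def mvar_def mult_single)
      thus ?thesis using rational_affine_scale[OF rational_affine_mvar c] by simp
    qed
  qed
  hence "rational_affine (\<Sum>m\<in>Poly_Mapping.keys p. Poly_Mapping.single m (Poly_Mapping.lookup p m))"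
    by (rule rational_affine_sum)
  thus ?thesis by (simp add: sum_single_lookup)
qed

text \<open>Substituting a series is compatible with products when its constant term vanishes, which
  is what \<open>q \<ge> 1\<close> guarantees.\<close>

lemma rhom_oracle_coeff:
  assumes "q \<ge> 1"
  shows "rhom (\<lambda>c :: 'a::field fps. fps_to_fls (fps_compose c (fps_X ^ q)))"
proof (rule rhom_comp[OF rhom_fps_to_fls])
  have "fps_nth (fps_X ^ q) 0 = (0 :: 'a)" using assms by (cases q) auto
  thus "rhom (\<lambda>c :: 'a fps. fps_compose c (fps_X ^ q))"
    by unfold_locales (simp_all add: fps_compose_add_distrib fps_compose_mult_distrib)
qed

lemma oracle_value_eq_ev:
  assumes "q \<ge> 1"
  shows "oracle_value h q A =
    ev (\<lambda>c. mconst (fps_to_fls (fps_compose c (fps_X ^ q)))) (\<lambda>(i, j). A i j) h"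
  unfolding oracle_value_def subst_eq_ev
  by (rule ev_map_coeffs[OF rhom_oracle_coeff[OF assms] rhom_mconst])

lemma oracle_value_cong:
  assumes "q \<ge> 1" "h \<in> skew_ring n" "\<And>i j. i < 2 * n \<Longrightarrow> j < 2 * n \<Longrightarrow> A i j = B i j"
  shows "oracle_value h q A = oracle_value h q B"
  unfolding oracle_value_eq_ev[OF assms(1)]
  using assms(2,3) by (intro ev_cong) (auto simp: skew_ring_def skew_vars_def)

text \<open>The gates are laid out in this order: the constant 1 at position 0, the \<open>N\<close>
  variables, the \<open>4 * n\<^sup>2\<close> matrix entries in row-major order, the oracle, and the
  top gate. Additive constants are scalars on wires to gate 0.\<close>

lemma depth_three_circuit_exists:
  fixes h :: "(nat \<times> nat, 'a::field fps) mpoly" and S :: "nat \<Rightarrow> nat \<Rightarrow> ('v::finite, 'a fls) mpoly"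
  assumes "n > 0" "q \<ge> 1" and h: "h \<in> skew_ring n"
    and S: "\<And>i j. i < 2 * n \<Longrightarrow> j < 2 * n \<Longrightarrow> rational_affine (S i j)"
    and skew: "\<And>i j. S j i = - S i j" "\<And>i. S i i = 0"
    and \<gamma>: "\<gamma> \<in> eps_rational_functions" "\<delta> \<in> eps_rational_functions"
  shows "\<exists>\<Phi> :: ('v, 'a fls) circuit. oracle_circuit_over eps_rational_functions n \<Phi> \<and>
    depth_three_oracle_circuit n \<Phi> \<and>
    computes n h \<Phi> (mconst \<gamma> * oracle_value h q S + mconst \<delta>)"
proof -
  \<comment> \<open>Vacuous outside the matrix, so that coefficients can be chosen for all index
    pairs at once.\<close>
  define coeffs where "coeffs i j cc \<longleftrightarrow> (i < 2 * n \<longrightarrow> j < 2 * n \<longrightarrow>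
      S i j = mconst (fst cc) + (\<Sum>v\<in>UNIV. mconst (snd cc v) * mvar v) \<and>
      fst cc \<in> eps_rational_functions \<and> (\<forall>v. snd cc v \<in> eps_rational_functions))"
    for i j and cc :: "'a fls \<times> ('v \<Rightarrow> 'a fls)"
  have ex: "\<exists>cc. coeffs i j cc" for i j
  proof (cases "i < 2 * n \<and> j < 2 * n")
    case True
    then obtain c0 c where "S i j = mconst c0 + (\<Sum>v\<in>UNIV. mconst (c v) * mvar v)"
      "c0 \<in> eps_rational_functions" "\<forall>v. c v \<in> eps_rational_functions"
      using S[of i j] unfolding rational_affine_def by blast
    hence "coeffs i j (c0, c)" unfolding coeffs_def by simp
    thus ?thesis by blast
  qed (auto simp: coeffs_def)
  define cc where "cc i j = (SOME cc. coeffs i j cc)" for i j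
  have "coeffs i j (cc i j)" for i j unfolding cc_def by (rule someI_ex[OF ex])
  hence cc: "S i j = mconst (fst (cc i j)) + (\<Sum>v\<in>UNIV. mconst (snd (cc i j) v) * mvar v) \<and>
      fst (cc i j) \<in> eps_rational_functions \<and> (\<forall>v. snd (cc i j) v \<in> eps_rational_functions)"
    if "i < 2 * n" "j < 2 * n" for i j
    using that unfolding coeffs_def by blast
  obtain vs :: "'v list" where vs: "set vs = UNIV" "distinct vs"
    using finite_distinct_list[OF finite_UNIV] by blast
  define N where "N = length vs"
  define E where "E = 4 * n\<^sup>2"
  have E: "E = 2 * n * (2 * n)" by (simp add: E_def power2_eq_square)
  define row col where "row m = m div (2 * n)" and "col m = m mod (2 * n)" for m
  have rc: "row m < 2 * n" "col m < 2 * n" if "m < E" for m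
    using that \<open>n > 0\<close> by (auto simp: row_def col_def E less_mult_imp_div_less)
  have rc_eq: "row (i * (2 * n) + j) = i" "col (i * (2 * n) + j) = j" if "j < 2 * n" for i j
    using that by (simp_all add: row_def col_def)
  have eq_rc: "row m * (2 * n) + col m = m" for m
    unfolding row_def col_def by (rule div_mult_mod_eq)
  define add_gate :: "nat \<Rightarrow> ('v, 'a fls) gate" where "add_gate m =
    GAdd ((fst (cc (row m) (col m)), 0) # map (\<lambda>k. (snd (cc (row m) (col m)) (vs ! k), Suc k)) [0..<N])" for m
  define W where "W i j = Suc N + (i * (2 * n) + j)" for i j
  have W_less: "i * (2 * n) + j < E" if "i < 2 * n" "j < 2 * n" for i j
  proof -
    have "i * (2 * n) + j < Suc i * (2 * n)" using that by simp
    also have "\<dots> \<le> E" unfolding E using that by (intro mult_le_mono1) simp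
    finally show ?thesis .
  qed
  define top :: "('v, 'a fls) gate" where "top = GAdd [(\<gamma>, Suc N + E), (\<delta>, 0)]"
  define G :: "nat \<Rightarrow> ('v, 'a fls) gate" where "G i = (if i = 0 then GConst 1 else if i \<le> N then GVar (vs ! (i - 1))
    else if i < Suc N + E then add_gate (i - Suc N) else if i = Suc N + E then GOracle q W else top)" for i
  define \<Phi> where "\<Phi> = map G [0..<Suc (Suc (Suc N + E))]"
  have len: "length \<Phi> = Suc (Suc (Suc N + E))" by (simp add: \<Phi>_def)
  have nth: "\<Phi> ! i = G i" if "i < length \<Phi>" for i
    using that unfolding len by (simp add: \<Phi>_def del: upt_Suc)
  have G_cases: "i = 0 \<and> G i = GConst 1 \<or> (\<exists>k<N. i = Suc k \<and> G i = GVar (vs ! k)) \<or>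
      (\<exists>m<E. i = Suc N + m \<and> G i = add_gate m) \<or> i = Suc N + E \<and> G i = GOracle q W \<or>
      i = Suc (Suc N + E) \<and> G i = top" if i: "i < length \<Phi>" for i
  proof -
    consider "i = 0" | "0 < i" "i \<le> N" | "N < i" "i < Suc N + E" | "i = Suc N + E" | "i = Suc (Suc N + E)"
      using i unfolding len by linarith
    thus ?thesis
    proof cases
      case 2
      hence "i - 1 < N" "i = Suc (i - 1)" "G i = GVar (vs ! (i - 1))" by (auto simp: G_def)
      thus ?thesis by blast
    next
      case 3
      hence "i - Suc N < E" "i = Suc N + (i - Suc N)" "G i = add_gate (i - Suc N)" by (auto simp: G_def)
      thus ?thesis by blast
    qed (auto simp: G_def)
  qed
  have G_add: "G (Suc N + m) = add_gate m" if "m < E" for m using that by (simp add: G_def)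
  have G_simps: "G 0 = GConst 1" "G (Suc N + E) = GOracle q W" "G (Suc (Suc N + E)) = top"
    and G_var: "\<And>k. k < N \<Longrightarrow> G (Suc k) = GVar (vs ! k)" by (auto simp: G_def)
  have wires_add: "gate_wires n (add_gate m) \<subseteq> {..N}" for m
    by (auto simp: add_gate_def)
  have scalars_add: "gate_scalars (add_gate m) \<subseteq> eps_rational_functions" if "m < E" for m
    using cc[OF rc[OF that]] by (auto simp: add_gate_def)
  have 1: "oracle_circuit_over eps_rational_functions n \<Phi>"
    unfolding oracle_circuit_over_def
  proof (intro conjI allI impI)
    show "\<Phi> \<noteq> []" using len by auto
    fix i assume i: "i < length \<Phi>"
    show "gate_wires n (\<Phi> ! i) \<subseteq> {..<i}"
      unfolding nth[OF i] using G_cases[OF i]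
    proof (elim disjE exE conjE)
      fix m assume "i = Suc N + m" "G i = add_gate m"
      thus "gate_wires n (G i) \<subseteq> {..<i}" using wires_add[of m] by auto
    next
      assume "i = Suc N + E" "G i = GOracle q W"
      thus "gate_wires n (G i) \<subseteq> {..<i}" using W_less by (auto simp: W_def)
    qed (auto simp: top_def)
    show "gate_scalars (\<Phi> ! i) \<subseteq> eps_rational_functions"
      unfolding nth[OF i] using G_cases[OF i] scalars_add \<gamma> eps_rational_1
      by (elim disjE exE conjE) (auto simp: top_def)
    fix q' W' assume "\<Phi> ! i = GOracle q' W'"
    thus "q' \<ge> 1" unfolding nth[OF i] using G_cases[OF i] \<open>q \<ge> 1\<close>
      by (elim disjE exE conjE) (auto simp: top_def add_gate_def)
  qed
  have 2: "depth_three_oracle_circuit n \<Phi>"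
    unfolding depth_three_oracle_circuit_def
  proof (intro exI conjI)
    let ?B = "{Suc N..<Suc N + E}"
    show "Suc (Suc N + E) = length \<Phi> - 1" "Suc N + E < length \<Phi>" "?B \<subseteq> {..<length \<Phi>}"
      by (auto simp: len)
    show "card ?B = 4 * n\<^sup>2" by (simp add: E_def)
    show "\<forall>b\<in>?B. \<exists>us. \<Phi> ! b = GAdd us \<and>
        (\<forall>j\<in>snd ` set us. (\<exists>v. \<Phi> ! j = GVar v) \<or> (\<exists>c. \<Phi> ! j = GConst c))"
    proof
      fix b assume b: "b \<in> ?B"
      define m where "m = b - Suc N"
      have m: "m < E" "b = Suc N + m" using b by (auto simp: m_def)
      have "\<Phi> ! b = add_gate m" using b m G_add by (simp add: nth len)
      moreover have "(\<exists>v. \<Phi> ! j = GVar v) \<or> (\<exists>c. \<Phi> ! j = GConst c)" if "j \<le> N" for j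
        using that G_var[of "j - 1"] G_simps(1) by (cases j) (auto simp: nth len)
      ultimately show "\<exists>us. \<Phi> ! b = GAdd us \<and>
        (\<forall>j\<in>snd ` set us. (\<exists>v. \<Phi> ! j = GVar v) \<or> (\<exists>c. \<Phi> ! j = GConst c))"
        unfolding add_gate_def by (intro exI conjI) (assumption, auto)
    qed
    show "\<Phi> ! (Suc N + E) = GOracle q W" using G_simps by (simp add: nth len)
    show "bij_betw (\<lambda>(i, j). W i j) ({..<2 * n} \<times> {..<2 * n}) ?B"
    proof (rule bij_betw_byWitness[where f' = "\<lambda>b. (row (b - Suc N), col (b - Suc N))"])
      show "\<forall>a\<in>{..<2 * n} \<times> {..<2 * n}.
          (row ((case a of (i, j) \<Rightarrow> W i j) - Suc N), col ((case a of (i, j) \<Rightarrow> W i j) - Suc N)) = a"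
        by (auto simp: W_def rc_eq)
      show "\<forall>b\<in>?B. (case (row (b - Suc N), col (b - Suc N)) of (i, j) \<Rightarrow> W i j) = b"
        by (auto simp: W_def eq_rc)
      show "(\<lambda>(i, j). W i j) ` ({..<2 * n} \<times> {..<2 * n}) \<subseteq> ?B"
        using W_less by (auto simp: W_def)
      show "(\<lambda>b. (row (b - Suc N), col (b - Suc N))) ` ?B \<subseteq> {..<2 * n} \<times> {..<2 * n}"
        using rc by auto
    qed
    show "Suc (Suc N + E) \<notin> ?B" by simp
    show "\<Phi> ! Suc (Suc N + E) = GAdd [(\<gamma>, Suc N + E), (\<delta>, 0)]"
      using G_simps(3) by (simp add: nth len top_def)
    show "Suc N + E \<in> snd ` set [(\<gamma>, Suc N + E), (\<delta>, 0)]" by simp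
    show "\<forall>j\<in>snd ` set [(\<gamma>, Suc N + E), (\<delta>, 0)]. j = Suc N + E \<or> (\<exists>c. \<Phi> ! j = GConst c)"
      using G_simps(1) by (auto simp: nth len)
    show "\<forall>j<length \<Phi>. j \<notin> ?B \<union> {Suc N + E, Suc (Suc N + E)} \<longrightarrow>
        (\<exists>v. \<Phi> ! j = GVar v) \<or> (\<exists>c. \<Phi> ! j = GConst c)"
    proof (intro allI impI)
      fix j assume j: "j < length \<Phi>" "j \<notin> ?B \<union> {Suc N + E, Suc (Suc N + E)}"
      show "(\<exists>v. \<Phi> ! j = GVar v) \<or> (\<exists>c. \<Phi> ! j = GConst c)"
        unfolding nth[OF j(1)] using G_cases[OF j(1)] j(2) by auto
    qed
  qed
  \<comment> \<open>The intended values. At the oracle the matrix read is \<open>S\<close> only for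
    indices below \<open>2 * n\<close>, which suffices because \<open>h\<close> lies in
    \<open>skew_ring n\<close>.\<close>
  define val :: "nat \<Rightarrow> ('v, 'a fls) mpoly" where "val i = (if i = 0 then 1 else if i \<le> N then mvar (vs ! (i - 1))
    else if i < Suc N + E then S (row (i - Suc N)) (col (i - Suc N))
    else if i = Suc N + E then oracle_value h q S else mconst \<gamma> * oracle_value h q S + mconst \<delta>)" for i
  have val_W: "val (W i j) = S i j" if "i < 2 * n" "j < 2 * n" for i j
    using W_less[OF that] that by (simp add: val_def W_def rc_eq)
  have val_simps: "val 0 = 1" "val (Suc N + E) = oracle_value h q S"
    "val (Suc (Suc N + E)) = mconst \<gamma> * oracle_value h q S + mconst \<delta>"
    and val_var: "\<And>k. k < N \<Longrightarrow> val (Suc k) = mvar (vs ! k)"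
    and val_add: "\<And>m. m < E \<Longrightarrow> val (Suc N + m) = S (row m) (col m)"
    by (auto simp: val_def)
  have 3: "computes n h \<Phi> (mconst \<gamma> * oracle_value h q S + mconst \<delta>)"
    unfolding computes_def
  proof (intro exI conjI allI impI)
    show "mconst \<gamma> * oracle_value h q S + mconst \<delta> = val (length \<Phi> - 1)"
      using val_simps(3) by (simp add: len)
    fix i assume i: "i < length \<Phi>"
    show "val i = gate_value h val (\<Phi> ! i)"
      unfolding nth[OF i] using G_cases[OF i]
    proof (elim disjE exE conjE)
      fix m assume m: "m < E" "i = Suc N + m" "G i = add_gate m"
      let ?c = "cc (row m) (col m)"
      have "(\<Sum>v\<in>UNIV. mconst (snd ?c v) * mvar v) = (\<Sum>v\<leftarrow>vs. mconst (snd ?c v) * mvar v)"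
        using vs by (simp add: sum_list_distinct_conv_sum_set)
      also have "\<dots> = (\<Sum>k\<leftarrow>[0..<N]. mconst (snd ?c (vs ! k)) * mvar (vs ! k))"
        unfolding N_def by (subst (1) map_nth[symmetric]) (simp add: o_def)
      also have "\<dots> = (\<Sum>k\<leftarrow>[0..<N]. mconst (snd ?c (vs ! k)) * val (Suc k))"
        by (intro arg_cong[of _ _ sum_list] map_cong refl) (simp add: val_var)
      finally have "S (row m) (col m) = mconst (fst ?c) + (\<Sum>k\<leftarrow>[0..<N]. mconst (snd ?c (vs ! k)) * val (Suc k))"
        using cc[OF rc[OF m(1)]] by simp
      thus "val i = gate_value h val (G i)"
        unfolding m(3) using m(1) by (simp add: m(2) val_add add_gate_def val_simps o_def del: add_Suc)
    next
      assume "i = Suc N + E" "G i = GOracle q W"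
      thus "val i = gate_value h val (G i)"
        using oracle_value_cong[OF \<open>q \<ge> 1\<close> h, of "\<lambda>i j. val (W i j)" S] val_W val_simps(2) by simp
    next
      assume "i = Suc (Suc N + E)" "G i = top"
      thus "val i = gate_value h val (G i)" using val_simps by (simp add: top_def)
    qed (use val_simps val_var in auto)
    fix q' W' assume "\<Phi> ! i = GOracle q' W'"
    hence "W' = W" unfolding nth[OF i] using G_cases[OF i]
      by (elim disjE exE conjE) (auto simp: top_def add_gate_def)
    thus "skew_symmetric (2 * n) (\<lambda>i j. val (W' i j))"
      unfolding skew_symmetric_def
    proof (intro allI impI conjI)
      fix i assume i: "i < 2 * n"
      show "val (W' i i) = 0" using i skew(2) by (simp add: \<open>W' = W\<close> val_W)
      fix j assume j: "j < 2 * n"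
      show "val (W' j i) = - val (W' i j)"
        unfolding \<open>W' = W\<close> val_W[OF i j] val_W[OF j i] by (rule skew(1))
    qed
  qed
  from 1 2 3 show ?thesis by blast
qed

section \<open>Substituting the branching program into the Pfaffian ideal\<close>

lemma vge_power_mult_pole:
  assumes "vge 0 (eps ^ C * p)" "C + M \<le> N"
  shows "vge M (eps ^ N * p)"
proof -
  have "vge (N - C) (eps ^ (N - C) * (eps ^ C * p))"
    using vge_mult[OF vge_eps_power assms(1)] by simp
  hence "vge (N - C) (eps ^ N * p)"
    using assms(2) by (simp flip: mult.assoc power_add)
  thus ?thesis by (rule vge_mono) (use assms(2) in simp)
qed

text \<open>A common pole bound is the sum of the individual ones.\<close>

lemma finite_poles_bounded:
  assumes "finite A"
  shows "\<exists>C. \<forall>x\<in>A. vge 0 (eps ^ C * F x)"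
  using assms
proof (induction A rule: finite_induct)
  case (insert x A)
  then obtain C where C: "\<forall>x\<in>A. vge 0 (eps ^ C * F x)" by blast
  obtain D where D: "vge 0 (eps ^ D * F x)" using poles_bounded by blast
  have "vge 0 (eps ^ (C + D) * F y)" if "y \<in> insert x A" for y
    using that C D vge_power_mult_pole[of C "F y" 0 "C + D"] vge_power_mult_pole[of D "F y" 0 "C + D"]
    by auto
  thus ?case by blast
qed simp

text \<open>Rapidly growing powers of \<open>eps\<close> on both sides turn the triangular factors
  into perturbations: an off-diagonal entry of \<open>L\<close> or \<open>R\<close> always comes
  with the larger power, and dividing by the diagonal one leaves a positive power in
  \<open>p\<close> or \<open>q\<close> whenever the exponents grow strictly.\<close>

lemma bilinear_LDR:
  fixes A :: "nat \<Rightarrow> nat \<Rightarrow> ('v, 'a::field fls) mpoly" and \<rho> :: "nat \<Rightarrow> ('v, 'a fls) mpoly"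
    and u v w :: "nat \<Rightarrow> nat" and K :: nat
  assumes t: "t < n"
    and A: "\<And>k l. \<not> (k < l \<and> l \<le> t) \<Longrightarrow> A k l = 0"
    and \<rho>: "\<And>l. \<rho> l = (if l = s then 1 else 0) + (\<Sum>k<n. \<rho> k * A k l)"
    and \<rho>0: "\<And>l. l > t \<Longrightarrow> \<rho> l = 0"
    and uw: "\<And>j k. j < k \<Longrightarrow> k < n \<Longrightarrow> w j + u j \<le> w k" "\<And>j k. j < k \<Longrightarrow> k < n \<Longrightarrow> w j + v j \<le> w k"
  defines "B \<equiv> \<lambda>k l. (if k = l then 1 else 0) - A k l + (if k = t \<and> l = s then eps else 0)"
    and "D \<equiv> \<lambda>m. if m = t then 1 + eps * \<rho> t else 1"
    and "p \<equiv> \<lambda>m. 1 + (if m < t then eps ^ (K * (w t + u t - (w m + u m))) * (eps * \<rho> m) else 0)"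
    and "q \<equiv> \<lambda>m. 1 - (\<Sum>l<n. eps ^ (K * (w l + v l - (w m + v m))) * A m l)"
  shows "(\<Sum>k<n. \<Sum>l<n. eps ^ (K * (w k + u k)) * B k l * eps ^ (K * (w l + v l))) =
    (\<Sum>m<n. (eps ^ (2 * K * w m) * D m) * (eps ^ (K * u m) * p m) * (eps ^ (K * v m) * q m))"
proof -
  define L where "L k m = (if k = m then 1 else if k = t \<and> m < t then eps * \<rho> m else 0)" for k m
  define R where "R m l = (if m = l then 1 else 0) - A m l" for m l
  define X where "X k = (eps :: ('v, 'a fls) mpoly) ^ (K * (w k + u k))" for k
  define Y where "Y k = (eps :: ('v, 'a fls) mpoly) ^ (K * (w k + v k))" for k
  have LDR: "(\<Sum>m<n. L k m * D m * R m l) = B k l" if "k < n" "l < n" for k l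
    using triangular_factorization[OF A \<rho> \<rho>0 that t, of eps]
    unfolding L_def R_def D_def B_def by simp
  have XL: "(\<Sum>k<n. X k * L k m) = X m * p m" if m: "m < n" for m
  proof -
    have "X k * L k m = (if k = m then X m else 0) + (if k = t then (if m < t then X t * (eps * \<rho> m) else 0) else 0)" for k
      by (auto simp: L_def)
    hence "(\<Sum>k<n. X k * L k m) = X m + (if m < t then X t * (eps * \<rho> m) else 0)"
      using m t by (simp add: sum.distrib)
    also have "\<dots> = X m * p m"
    proof (cases "m < t")
      case True
      have "w m + u m \<le> w t + u t" using uw(1)[OF True t] by simp
      hence "X t = X m * eps ^ (K * (w t + u t - (w m + u m)))"
        unfolding X_def power_add[symmetric] distrib_left[symmetric] by simp
      thus ?thesis using True by (simp add: p_def distrib_left mult.assoc)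
    qed (simp add: p_def)
    finally show ?thesis .
  qed
  have RY: "(\<Sum>l<n. R m l * Y l) = Y m * q m" if m: "m < n" for m
  proof -
    \<comment> \<open>Only \<open>m < l\<close> matters, as \<open>A\<close> is strictly upper
      triangular; there the natural-number subtraction in the exponent is exact.\<close>
    have AY: "A m l * Y l = Y m * (eps ^ (K * (w l + v l - (w m + v m))) * A m l)" if "l < n" for l
    proof (cases "m < l")
      case True
      have "w m + v m \<le> w l + v l" using uw(2)[OF True that] by simp
      hence "Y l = Y m * eps ^ (K * (w l + v l - (w m + v m)))"
        unfolding Y_def power_add[symmetric] distrib_left[symmetric] by simp
      thus ?thesis by (simp add: mult_ac)
    qed (simp add: A)
    have "(\<Sum>l<n. R m l * Y l) = (\<Sum>l<n. (if m = l then Y m else 0) - A m l * Y l)"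
      by (intro sum.cong refl) (auto simp: R_def algebra_simps)
    also have "\<dots> = Y m - (\<Sum>l<n. A m l * Y l)" using m by (simp add: sum_subtractf)
    also have "(\<Sum>l<n. A m l * Y l) = Y m * (\<Sum>l<n. eps ^ (K * (w l + v l - (w m + v m))) * A m l)"
      unfolding sum_distrib_left by (intro sum.cong refl AY) simp
    finally show ?thesis by (simp add: q_def right_diff_distrib)
  qed
  have "(\<Sum>k<n. \<Sum>l<n. X k * B k l * Y l) = (\<Sum>m<n. D m * (\<Sum>k<n. X k * L k m) * (\<Sum>l<n. R m l * Y l))"
    by (rule bilinear_factorization) (rule LDR)
  also have "\<dots> = (\<Sum>m<n. (eps ^ (2 * K * w m) * D m) * (eps ^ (K * u m) * p m) * (eps ^ (K * v m) * q m))"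
  proof (rule sum.cong[OF refl])
    fix m assume "m \<in> {..<n}"
    \<comment> \<open>The exponents \<open>K * (w m + u m)\<close> and
      \<open>K * (w m + v m)\<close> add up to the doubled weight of the scaling variable plus those
      of the two vectors.\<close>
    have "X m * Y m = eps ^ (2 * K * w m) * eps ^ (K * u m) * eps ^ (K * v m)"
      unfolding X_def Y_def power_add[symmetric]
      by (intro arg_cong[of _ _ "(^) eps"]) (simp add: algebra_simps)
    moreover have "D m * (X m * p m) * (Y m * q m) = (X m * Y m) * (D m * p m * q m)"
      by (simp only: mult_ac)
    moreover have "a * b * c * (D m * p m * q m) = a * D m * (b * p m) * (c * q m)" for a b c
      by (simp only: mult_ac)
    ultimately show "D m * (\<Sum>k<n. X k * L k m) * (\<Sum>l<n. R m l * Y l) =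
        (eps ^ (2 * K * w m) * D m) * (eps ^ (K * u m) * p m) * (eps ^ (K * v m) * q m)"
      using XL RY \<open>m \<in> {..<n}\<close> by simp
  qed
  finally show ?thesis by (simp only: X_def Y_def)
qed

text \<open>The leading term of \<open>f\<close> meets the factored program matrix. The constants
  \<open>c\<close> and \<open>\<alpha>\<close> are fixed before the precision \<open>M\<close>,
  since the exponent to be extracted depends on \<open>\<alpha>\<close> and determines the precision
  that is needed.\<close>

lemma pfaffian_ideal_oracle_matrix:
  fixes f :: "(nat \<times> nat, 'a::field) mpoly" and P :: "('v::finite, 'a fls) abp"
  assumes f: "f \<noteq> 0" "mvars f \<subseteq> skew_vars n" "f \<in> pfaffian_ideal n r"
    and P: "is_abp_over eps_rational_functions P" "card (abp_vertices P) \<le> r"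
    and g: "vge 0 (abp_poly P)"
  obtains c :: 'a and \<alpha> :: nat where "c \<noteq> 0" "\<alpha> > 0" "n > 0"
    "\<And>M. \<exists>S D. (\<forall>i j. S j i = - S i j) \<and> (\<forall>i. S i i = 0) \<and>
       (\<forall>i j. rational_affine (S i j) \<and> vge 0 (S i j)) \<and>
       vge (D + M) (ev cst (\<lambda>(i, j). S i j) f - cst c * eps ^ D * (1 + eps * abp_poly P) ^ \<alpha>)"
proof -
  \<comment> \<open>The source is a vertex, so \<open>r\<close> is positive.\<close>
  obtain s0 where s0: "layer P 0 = {s0}" using P(1) unfolding is_abp_over_def by blast
  have "s0 \<in> abp_vertices P" unfolding abp_vertices_def using s0 by blast
  moreover have "\<forall>i\<le>depth P. finite (layer P i)" using P(1) unfolding is_abp_over_def by blast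
  hence "finite (abp_vertices P)" unfolding abp_vertices_def by simp
  ultimately have "card (abp_vertices P) > 0" using card_gt_0_iff by blast
  hence r: "r > 0" using P(2) by simp
  have labels: "rational_affine (label P e)" if "e \<in> edges P" for e
    using P(1) that affine_linear_rational_affine unfolding is_abp_over_def by blast
  show thesis
  proof (rule leading_term[OF f r, where 'v = 'v])
    fix c :: 'a and \<alpha> t :: nat and w :: "nat \<Rightarrow> nat" and u v :: "nat \<Rightarrow> nat \<Rightarrow> nat" and D :: nat
    assume c: "c \<noteq> 0" "\<alpha> > 0" and t: "t < n" "r \<le> Suc t"
      and gap: "\<And>i j k. i < 2 * n \<Longrightarrow> j < k \<Longrightarrow> k < n \<Longrightarrow> w j + u i j + 1 \<le> w k \<and> w j + v i j + 1 \<le> w k"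
      and lead: "\<And>K M (T :: nat \<Rightarrow> ('v, 'a fls) mpoly) p q g.
      M \<le> K \<Longrightarrow> vge 0 g \<Longrightarrow> (\<And>i k. i < 2 * n \<Longrightarrow> k < n \<Longrightarrow> vge M (p i k - 1) \<and> vge M (q i k - 1)) \<Longrightarrow>
      (\<And>k. k < n \<Longrightarrow> T k = eps ^ (2 * K * w k) * (if k = t then 1 + eps * g else 1)) \<Longrightarrow>
      vge (K * D + M) (ev cst (\<lambda>(i, j). skewform n (\<lambda>k i. T k * (eps ^ (K * u i k) * p i k))
        (\<lambda>k i. eps ^ (K * v i k) * q i k) i j) f - cst c * eps ^ (K * D) * (1 + eps * g) ^ \<alpha>)"
    have card: "card (abp_vertices P) \<le> Suc t" using P(2) t(2) by simp
    obtain A \<rho> s where s: "s \<le> t" and \<rho>t: "\<rho> t = abp_poly P" and \<rho>0: "\<And>l. l > t \<Longrightarrow> \<rho> l = 0"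
      and \<rho>: "\<And>l. \<rho> l = (if l = s then 1 else 0) + (\<Sum>k<n. \<rho> k * A k l)"
      and A: "\<And>k l. A k l = 0 \<or> k < l \<and> l \<le> t \<and> (\<exists>e\<in>edges P. A k l = label P e)"
      by (rule abp_matrix[OF P(1) card t(1)], rule that)
    have A0: "A k l = 0" if "\<not> (k < l \<and> l \<le> t)" for k l using A[of k l] that by blast
    have A_aff: "rational_affine (A k l)" for k l
      using A[of k l] labels rational_affine_0 by metis
    have "finite ({..<n} \<times> {..<n})" by simp
    from finite_poles_bounded[OF this, of "\<lambda>(k, l). A k l"]
    obtain C1 where "\<forall>x\<in>{..<n} \<times> {..<n}. vge 0 (eps ^ C1 * (case x of (k, l) \<Rightarrow> A k l))" by blast
    hence C1: "vge 0 (eps ^ C1 * A k l)" if "k < n" "l < n" for k l using that by fastforce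
    from finite_poles_bounded[OF finite_lessThan, of n \<rho>]
    obtain C2 where C2: "\<And>k. k < n \<Longrightarrow> vge 0 (eps ^ C2 * \<rho> k)" by blast
    have gap_u: "w j + u i j \<le> w k" and gap_v: "w j + v i j \<le> w k"
      if "i < 2 * n" "j < k" "k < n" for i j k
      using gap[OF that] by linarith+
    show thesis
    proof (rule that[OF c])
      show "n > 0" using t(1) by simp
    next
      fix M
      \<comment> \<open>Large enough to absorb the poles of \<open>A\<close> and of
        \<open>\<rho>\<close> and still leave \<open>M\<close> powers of \<open>eps\<close>.\<close>
      define K where "K = C1 + C2 + M"
      have K: "C1 + M \<le> K" "C2 + M \<le> K" by (simp_all add: K_def)
      define B where "B k l = (if k = l then 1 else 0) - A k l + (if k = t \<and> l = s then eps else 0)" for k l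
      \<comment> \<open>Written through \<open>B\<close>, an entry is an affine combination of edge
        labels; written in factored form below, it has the shape required by \<open>lead\<close>.
        Antisymmetrising gives \<open>S\<close>.\<close>
      define S0 where "S0 i j = (\<Sum>k<n. \<Sum>l<n. eps ^ (K * (w k + u i k)) * B k l * eps ^ (K * (w l + v j l)))"
        for i j
      define S where "S i j = (if i < 2 * n \<and> j < 2 * n then S0 i j - S0 j i else 0)" for i j
      define T where "T k = eps ^ (2 * K * w k) * (if k = t then 1 + eps * \<rho> t else 1)" for k
      define p where "p i m = 1 + (if m < t then eps ^ (K * (w t + u i t - (w m + u i m))) * (eps * \<rho> m) else 0)"
        for i m
      define q where "q i m = 1 - (\<Sum>l<n. eps ^ (K * (w l + v i l - (w m + v i m))) * A m l)" for i m
      have S0: "S0 i j = (\<Sum>m<n. T m * (eps ^ (K * u i m) * p i m) * (eps ^ (K * v j m) * q j m))"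
        if "i < 2 * n" "j < 2 * n" for i j
        unfolding S0_def B_def T_def p_def q_def
        by (rule bilinear_LDR[OF t(1) A0 \<rho> \<rho>0 gap_u[OF that(1)] gap_v[OF that(2)]])
      have pq: "vge M (p i k - 1) \<and> vge M (q i k - 1)" if ik: "i < 2 * n" "k < n" for i k
      proof
        show "vge M (p i k - 1)"
        proof (cases "k < t")
          case True
          \<comment> \<open>The \<open>+ 1\<close> in \<open>gap\<close> makes the exponent at least
            \<open>K\<close>.\<close>
          have "K * 1 \<le> K * (w t + u i t - (w k + u i k))"
            using gap[OF ik(1) True t(1)] by (intro mult_le_mono2) linarith
          hence "C2 + M \<le> K * (w t + u i t - (w k + u i k))" using K by linarith
          hence "vge M (eps ^ (K * (w t + u i t - (w k + u i k))) * \<rho> k)"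
            by (rule vge_power_mult_pole[OF C2[OF ik(2)]])
          hence "vge M (eps * (eps ^ (K * (w t + u i t - (w k + u i k))) * \<rho> k))"
            by (rule vge_mult_left[OF vge_eps])
          thus ?thesis using True by (simp add: p_def mult_ac)
        qed (simp add: p_def)
        have "vge M (\<Sum>l<n. eps ^ (K * (w l + v i l - (w k + v i k))) * A k l)"
        proof (rule vge_sum)
          fix l assume l: "l \<in> {..<n}"
          show "vge M (eps ^ (K * (w l + v i l - (w k + v i k))) * A k l)"
          proof (cases "k < l")
            case True
            have "K * 1 \<le> K * (w l + v i l - (w k + v i k))"
              using gap[OF ik(1) True] l by (intro mult_le_mono2) fastforce
            hence "C1 + M \<le> K * (w l + v i l - (w k + v i k))" using K by linarith
            thus ?thesis using l by (intro vge_power_mult_pole[OF C1[OF ik(2)]]) simp_all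
          qed (simp add: A0)
        qed
        thus "vge M (q i k - 1)" unfolding q_def by (simp add: vge_uminus)
      qed
      have pq0: "vge 0 (p i k)" "vge 0 (q i k)" if "i < 2 * n" "k < n" for i k
        using pq[OF that] vge_add[OF vge_mono[of M _ 0] vge_1, of "p i k - 1"]
          vge_add[OF vge_mono[of M _ 0] vge_1, of "q i k - 1"] by simp_all
      have T0: "vge 0 (T k)" for k
      proof -
        have "vge 0 (1 + eps * \<rho> t)"
          by (rule vge_add[OF vge_1 vge_mult_left[OF vge_eps]]) (simp add: \<rho>t g)
        hence "vge 0 (if k = t then 1 + eps * \<rho> t else 1)" by simp
        thus ?thesis unfolding T_def by (rule vge_mult_left[OF vge_power_0[OF vge_eps]])
      qed
      \<comment> \<open>Absence of poles is seen from the factored form only, since the labels in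
        \<open>B\<close> may have poles.\<close>
      have S0_int: "vge 0 (S0 i j)" if "i < 2 * n" "j < 2 * n" for i j
        unfolding S0[OF that]
      proof (rule vge_sum)
        fix m assume m: "m \<in> {..<n}"
        show "vge 0 (T m * (eps ^ (K * u i m) * p i m) * (eps ^ (K * v j m) * q j m))"
          using m that pq0
          by (intro vge_mult_left[OF vge_mult_left[OF T0 vge_mult_left[OF vge_power_0[OF vge_eps]]]
                vge_mult_left[OF vge_power_0[OF vge_eps]]]) auto
      qed
      have B_aff: "rational_affine (B k l)" for k l
      proof -
        have "rational_affine (if k = l then 1 else 0 :: ('v, 'a fls) mpoly)"
          by (simp add: rational_affine_0 rational_affine_const[OF eps_rational_1, unfolded mconst_1])
        moreover have "rational_affine (if k = t \<and> l = s then eps else 0 :: ('v, 'a fls) mpoly)"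
          by (simp add: rational_affine_0 rational_affine_const[OF eps_rational_X])
        ultimately show ?thesis
          unfolding B_def by (intro rational_affine_add rational_affine_diff A_aff)
      qed
      have S0_aff: "rational_affine (S0 i j)" for i j
        unfolding S0_def
      proof (intro rational_affine_sum)
        fix k l
        have "rational_affine (mconst (fls_X ^ (K * (w k + u i k)) * fls_X ^ (K * (w l + v j l))) * B k l)"
          by (intro rational_affine_scale B_aff eps_rational_mult eps_rational_X_power)
        thus "rational_affine (eps ^ (K * (w k + u i k)) * B k l * eps ^ (K * (w l + v j l)))"
          by (simp add: mc.hom_mult mc.hom_power mult_ac)
      qed
      have "vge (K * D + M) (ev cst (\<lambda>(i, j). skewform n (\<lambda>k i. T k * (eps ^ (K * u i k) * p i k))
        (\<lambda>k i. eps ^ (K * v i k) * q i k) i j) f - cst c * eps ^ (K * D) * (1 + eps * abp_poly P) ^ \<alpha>)"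
        by (rule lead[OF _ g pq]) (auto simp: K_def T_def \<rho>t)
      also have "ev cst (\<lambda>(i, j). skewform n (\<lambda>k i. T k * (eps ^ (K * u i k) * p i k))
        (\<lambda>k i. eps ^ (K * v i k) * q i k) i j) f = ev cst (\<lambda>(i, j). S i j) f"
      proof (rule ev_cong)
        fix x assume "x \<in> mvars f"
        then obtain i j where x: "x = (i, j)" "i < 2 * n" "j < 2 * n"
          using f(2) by (fastforce simp: skew_vars_def)
        show "(\<lambda>(i, j). skewform n (\<lambda>k i. T k * (eps ^ (K * u i k) * p i k))
            (\<lambda>k i. eps ^ (K * v i k) * q i k) i j) x = (\<lambda>(i, j). S i j) x"
          using x(2,3) unfolding x(1) prod.case skewform_def
          by (simp add: S_def S0 sum_subtractf)
      qed
      finally have "vge (K * D + M) (ev cst (\<lambda>(i, j). S i j) f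
          - cst c * eps ^ (K * D) * (1 + eps * abp_poly P) ^ \<alpha>)" .
      moreover have "S j i = - S i j" "S i i = 0" for i j by (auto simp: S_def)
      moreover have "rational_affine (S i j)" "vge 0 (S i j)" for i j
        by (auto simp: S_def intro!: rational_affine_diff rational_affine_0 S0_aff vge_diff S0_int)
      ultimately show "\<exists>S D. (\<forall>i j. S j i = - S i j) \<and> (\<forall>i. S i i = 0) \<and>
       (\<forall>i j. rational_affine (S i j) \<and> vge 0 (S i j)) \<and>
       vge (D + M) (ev cst (\<lambda>(i, j). S i j) f - cst c * eps ^ D * (1 + eps * abp_poly P) ^ \<alpha>)"
        by (intro exI[of _ S] exI[of _ "K * D"]) blast
    qed
  qed
qed

section \<open>Extracting the polynomial from the leading term\<close>

text \<open>Makes the Frobenius identity available in the polynomial ring where the circuit values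
  live.\<close>

lemma CHAR_mpoly_fls: "CHAR(('v, 'a::field fls) mpoly) = CHAR('a)"
proof (rule CHAR_eqI)
  have of_nat: "(of_nat k :: ('v, 'a fls) mpoly) = cst (of_nat k)" for k
    by (rule rhom.hom_of_nat[OF rhom_cst, symmetric])
  have inj: "mconst a = 0 \<longleftrightarrow> a = 0" for a :: "'a fls"
    by (metis mconst_def mconst_0 lookup_single_eq lookup_zero)
  show "of_nat CHAR('a) = (0 :: ('v, 'a fls) mpoly)" unfolding of_nat by simp
  fix k assume "of_nat k = (0 :: ('v, 'a fls) mpoly)"
  hence "of_nat k = (0 :: 'a)" unfolding of_nat inj by (metis fls_const_0 fls_const_nonzero)
  thus "CHAR('a) dvd k" by (simp add: of_nat_eq_0_iff_char_dvd)
qed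

text \<open>Here \<open>e\<close> is the largest power of the characteristic dividing
  \<open>\<alpha>\<close>, and 1 in characteristic zero: raising to the power \<open>e\<close> is
  additive, and the cofactor \<open>\<beta>\<close> is invertible in the field.\<close>

lemma frobenius_exponent:
  fixes \<alpha> :: nat
  assumes "\<alpha> > 0"
  obtains e \<beta> where "\<alpha> = e * \<beta>" "e > 0" "of_nat \<beta> \<noteq> (0 :: 'a::field)"
    "\<And>x :: ('v, 'a fls) mpoly. (1 + x) ^ e = 1 + x ^ e"
    "CHAR('a) = 0 \<Longrightarrow> e = 1" "CHAR('a) > 0 \<Longrightarrow> \<exists>k. e = CHAR('a) ^ k"
proof (cases "CHAR('a) = 0")
  case True
  show thesis
    by (rule that[of 1 \<alpha>]) (use True assms in \<open>auto simp: of_nat_eq_0_iff_char_dvd\<close>)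
next
  case False
  hence p: "prime CHAR('a)" by (simp add: prime_CHAR_semidom)
  obtain \<beta> where \<beta>: "\<alpha> = CHAR('a) ^ multiplicity CHAR('a) \<alpha> * \<beta>" "\<not> CHAR('a) dvd \<beta>"
    using multiplicity_decompose'[of \<alpha> "CHAR('a)"] assms p not_prime_unit by blast
  define e where "e = CHAR('a) ^ multiplicity CHAR('a) \<alpha>"
  show thesis
  proof (rule that[of e \<beta>])
    show "\<alpha> = e * \<beta>" using \<beta>(1) by (simp only: e_def)
    show "e > 0" using p by (simp add: e_def prime_gt_0_nat)
    show "of_nat \<beta> \<noteq> (0 :: 'a)" using \<beta>(2) by (simp add: of_nat_eq_0_iff_char_dvd)
    show "(1 + x) ^ e = 1 + x ^ e" for x :: "('v, 'a fls) mpoly"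
      using freshmans_dream'[where 'a = "('v, 'a fls) mpoly", of e "multiplicity CHAR('a) \<alpha>" 1 x] p
      by (simp add: CHAR_mpoly_fls e_def)
    show "CHAR('a) = 0 \<Longrightarrow> e = 1" "\<exists>k. e = CHAR('a) ^ k" using False by (auto simp: e_def)
  qed
qed

text \<open>The binomial expansion to first order, with a remainder coefficient \<open>z\<close>
  free of poles.\<close>

lemma one_plus_power:
  assumes "vge 0 (x :: ('v, 'a::field fls) mpoly)"
  shows "\<exists>z. vge 0 z \<and> (1 + x) ^ k = 1 + of_nat k * x + x\<^sup>2 * z"
proof (induction k)
  case 0
  show ?case by (intro exI[of _ 0]) simp
next
  case (Suc k)
  then obtain z where z: "vge 0 z" "(1 + x) ^ k = 1 + of_nat k * x + x\<^sup>2 * z" by blast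
  have k: "vge 0 (of_nat k :: ('v, 'a fls) mpoly)"
    unfolding rhom.hom_of_nat[OF rhom_cst, symmetric] by (rule vge_const)
  have "(1 + x) ^ Suc k = (1 + x) * (1 + of_nat k * x + x\<^sup>2 * z)" by (simp add: z(2))
  also have "\<dots> = 1 + of_nat (Suc k) * x + x\<^sup>2 * (of_nat k + z + x * z)"
    by (simp add: algebra_simps power2_eq_square)
  finally show ?case
    using vge_add[OF vge_add[OF k z(1)] vge_mult_left[OF assms z(1)]] by blast
qed

text \<open>Power series embed injectively into Laurent series, so the approximation descends to a
  decomposition of \<open>h\<close> itself, in which \<epsilon> can be rescaled.\<close>

lemma approximation_decomposition:
  fixes f :: "('x, 'a::field) mpoly"
  assumes "approximates (map_coeffs fps_to_fls h) f"
  obtains E where "h = map_coeffs fps_const f + mconst fps_X * E"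
proof -
  from assms obtain E where
    E: "map_coeffs fps_to_fls h = map_coeffs fls_const f + mconst fls_X * map_coeffs fps_to_fls E"
    unfolding approximates_def by blast
  have "emb h = emb (map_coeffs fps_const f + mconst fps_X * E)"
    using E by (simp add: emb_map_const emb.hom_add emb.hom_mult emb_mconst) (simp add: emb_def)
  hence "fps_to_fls (Poly_Mapping.lookup h m) =
      fps_to_fls (Poly_Mapping.lookup (map_coeffs fps_const f + mconst fps_X * E) m)" for m
    unfolding emb_def by (metis lookup_map_coeffs fps_zero_to_fls)
  hence "h = map_coeffs fps_const f + mconst fps_X * E"
    by (intro poly_mapping_eqI) (simp only: fps_to_fls_eq_iff)
  thus thesis by (rule that)
qed

text \<open>Replacing \<epsilon> by its \<open>q\<close>-th power fixes the constant coefficients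
  taken from \<open>f\<close> and pushes the error of \<open>h\<close> to order
  \<open>q\<close>.\<close>

lemma oracle_value_approximates:
  fixes f :: "(nat \<times> nat, 'a::field) mpoly"
  assumes h: "h = map_coeffs fps_const f + mconst fps_X * E" and "q \<ge> 1"
    and A: "\<And>i j. vge 0 (A i j)"
  shows "vge q (oracle_value h q A - ev cst (\<lambda>(i, j). A i j) f)"
proof -
  let ?\<psi> = "\<lambda>c :: 'a fps. fps_to_fls (fps_compose c (fps_X ^ q))"
  note \<psi> = rhom_oracle_coeff[OF \<open>q \<ge> 1\<close>, where 'a = 'a]
  note m\<psi> = rhom_comp[OF rhom_mconst \<psi>]
  let ?ev = "ev (\<lambda>c. mconst (?\<psi> c)) (\<lambda>(i, j). A i j)"
  interpret e: rhom ?ev by (rule rhom_ev[OF m\<psi>])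
  have X: "?\<psi> fps_X = fls_X ^ q"
    using \<open>q \<ge> 1\<close> by (simp add: fps_to_fls_power)
  have "oracle_value h q A = ?ev (map_coeffs fps_const f) + mconst (?\<psi> fps_X) * ?ev E"
    unfolding oracle_value_eq_ev[OF \<open>q \<ge> 1\<close>] h e.hom_add e.hom_mult ev_mconst[OF m\<psi>] ..
  also have "?ev (map_coeffs fps_const f) = ev cst (\<lambda>(i, j). A i j) f"
    unfolding ev_map_coeffs[OF rhom_fps_const m\<psi>] by simp
  finally have "oracle_value h q A - ev cst (\<lambda>(i, j). A i j) f = eps ^ q * ?ev E"
    unfolding X mc.hom_power by simp
  moreover have "vge 0 (?ev E)" unfolding ev_def
    using A by (intro vge_sum vge_mult_left vge_monom_ev) (auto simp flip: emb_mconst)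
  ultimately show ?thesis using vge_mult[OF vge_eps_power[of q], of 0 "?ev E"] by simp
qed

text \<open>With \<open>Y = eps ^ e * G ^ e\<close>, the power of \<open>1 + eps * G\<close> becomes
  \<open>(1 + Y) ^ \<beta>\<close>, whose first nonconstant term is
  \<open>of_nat \<beta> * Y\<close>. Subtracting the constant term and dividing by
  \<open>c * of_nat \<beta>\<close> and by \<open>eps ^ (D + e)\<close> isolates
  \<open>G ^ e\<close>; \<open>\<gamma>\<close> and the additive constant do precisely this.\<close>

lemma approximates_from_leading_term:
  fixes H G :: "('v, 'a::field fls) mpoly"
  assumes c: "c \<noteq> (0 :: 'a)" and \<beta>: "of_nat \<beta> \<noteq> (0 :: 'a)" and "e > 0"
    and frob: "\<And>x :: ('v, 'a fls) mpoly. (1 + x) ^ e = 1 + x ^ e"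
    and H: "vge (D + (e + 1)) (H - cst c * eps ^ D * (1 + eps * G) ^ (e * \<beta>))"
    and G: "approximates G g"
  defines "\<gamma> \<equiv> fls_const (inverse (c * of_nat \<beta>)) * inverse (fls_X ^ (D + e))"
  shows "approximates (mconst \<gamma> * H + mconst (- (\<gamma> * (fls_const c * fls_X ^ D)))) (g ^ e)"
proof -
  define Y where "Y = eps ^ e * G ^ e"
  have G0: "vge 0 G" by (rule approximates_vge_0) fact
  have Y: "vge e Y" unfolding Y_def using vge_mult[OF vge_eps_power[of e] vge_power_0[OF G0]] by simp
  obtain z where z: "vge 0 z" "(1 + Y) ^ \<beta> = 1 + of_nat \<beta> * Y + Y\<^sup>2 * z"
    using one_plus_power[OF vge_mono[OF Y le0]] by blast
  have pow: "(1 + eps * G) ^ (e * \<beta>) = 1 + of_nat \<beta> * Y + Y\<^sup>2 * z"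
    unfolding power_mult frob z(2)[symmetric] by (simp add: Y_def power_mult_distrib)
  have \<beta>': "(of_nat \<beta> :: ('v, 'a fls) mpoly) = cst (of_nat \<beta>)"
    by (rule rhom.hom_of_nat[OF rhom_cst, symmetric])
  define k :: "('v, 'a fls) mpoly" where "k = cst (inverse (c * of_nat \<beta>))"
  have k: "k * cst c * of_nat \<beta> = 1"
  proof -
    have "inverse (c * of_nat \<beta>) * c * of_nat \<beta> = 1" using c \<beta> by (simp add: field_simps)
    thus ?thesis unfolding k_def \<beta>' mc.hom_mult[symmetric] fls_const_mult_const by simp
  qed
  let ?P = "mconst \<gamma> * H + mconst (- (\<gamma> * (fls_const c * fls_X ^ D))) :: ('v, 'a fls) mpoly"
  have \<gamma>: "eps ^ (D + e) * mconst \<gamma> = k"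
  proof -
    have nz: "fls_X ^ (D + e) \<noteq> (0 :: 'a fls)" by simp
    have "fls_X ^ (D + e) * (a * inverse (fls_X ^ (D + e))) = a" for a :: "'a fls"
      unfolding mult.left_commute[of "fls_X ^ (D + e)" a] right_inverse[OF nz] by (rule mult_1_right)
    thus ?thesis unfolding \<gamma>_def k_def mc.hom_power[symmetric] mc.hom_mult[symmetric] by (simp only:)
  qed
  have "?P = mconst \<gamma> * (H - cst c * eps ^ D)"
    by (simp add: mc.hom_uminus mc.hom_mult mc.hom_power right_diff_distrib)
  hence "eps ^ (D + e) * ?P = k * (H - cst c * eps ^ D)"
    by (simp only: mult.assoc[symmetric] \<gamma>)
  moreover have "eps ^ (D + e) * G ^ e = k * (cst c * of_nat \<beta> * eps ^ D * Y)"
  proof -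
    have "k * (cst c * of_nat \<beta> * eps ^ D * Y) = (k * cst c * of_nat \<beta>) * (eps ^ D * Y)"
      by (simp only: mult.assoc)
    thus ?thesis unfolding k by (simp add: Y_def power_add mult.assoc)
  qed
  ultimately have "eps ^ (D + e) * (?P - G ^ e) =
      k * (H - cst c * eps ^ D) - k * (cst c * of_nat \<beta> * eps ^ D * Y)"
    by (simp only: right_diff_distrib)
  also have "\<dots> = k * ((H - cst c * eps ^ D * (1 + eps * G) ^ (e * \<beta>)) + cst c * (eps ^ D * (Y\<^sup>2 * z)))"
    unfolding pow by (simp add: algebra_simps)
  finally have eq: "eps ^ (D + e) * (?P - G ^ e) =
      k * ((H - cst c * eps ^ D * (1 + eps * G) ^ (e * \<beta>)) + cst c * (eps ^ D * (Y\<^sup>2 * z)))" .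
  \<comment> \<open>The quadratic remainder has order \<open>D + 2 * e\<close>, at least
    \<open>D + e + 1\<close> because \<open>e\<close> is positive.\<close>
  have "vge (D + (2 * e + 0)) (eps ^ D * (Y\<^sup>2 * z))"
    by (intro vge_mult vge_eps_power vge_power Y z(1))
  hence "vge (D + (e + 1)) (eps ^ D * (Y\<^sup>2 * z))"
    by (rule vge_mono) (use \<open>e > 0\<close> in simp)
  hence "vge (1 + (D + e)) (eps ^ (D + e) * (?P - G ^ e))"
    unfolding eq k_def using H by (simp add: vge_add vge_mult_left)
  hence "vge 1 (?P - G ^ e)" by (rule vge_eps_power_mult_cancel)
  moreover have "vge 1 (G ^ e - map_coeffs fls_const (g ^ e))"
    using approximates_power[OF G] by (simp add: approximates_iff)
  ultimately show ?thesis
    unfolding approximates_iff using vge_add by fastforce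
qed

theorem theorem4p4:
  fixes n r :: nat
    and f :: "(nat \<times> nat, 'a::field) mpoly"
    and h :: "(nat \<times> nat, 'a fps) mpoly"
    and g :: "('v::finite, 'a) mpoly"
  assumes "f \<noteq> 0"
    and "f \<in> pfaffian_ideal n r"
    and "h \<in> skew_ring n"
    and "approximates (map_coeffs fps_to_fls h) f"
    and "border_abp r g"
  shows "\<exists>\<Phi> :: ('v, 'a fls) circuit.
           oracle_circuit_over eps_rational_functions n \<Phi> \<and>
           depth_three_oracle_circuit n \<Phi> \<and>
           (CHAR('a) = 0 \<longrightarrow> (\<exists>P. computes n h \<Phi> P \<and> approximates P g)) \<and>
           (CHAR('a) > 0 \<longrightarrow>
              (\<exists>k. \<exists>P. computes n h \<Phi> P \<and> approximates P (g ^ (CHAR('a) ^ k))))"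
proof -
  obtain P :: "('v, 'a fls) abp" where P: "is_abp_over eps_rational_functions P"
      "card (abp_vertices P) \<le> r" and g: "approximates (abp_poly P) g"
    using assms(5) unfolding border_abp_def by blast
  obtain E where E: "h = map_coeffs fps_const f + mconst fps_X * E"
    by (rule approximation_decomposition[OF assms(4)])
  \<comment> \<open>The constant terms of the coefficients of \<open>h\<close> are the coefficients
    of \<open>f\<close>, so \<open>f\<close> only uses variables that \<open>h\<close> uses.\<close>
  have "m \<in> Poly_Mapping.keys h" if "m \<in> Poly_Mapping.keys f" for m
  proof -
    have "fps_nth (Poly_Mapping.lookup h m) 0 = Poly_Mapping.lookup f m"
      by (simp add: E lookup_add lookup_map_coeffs lookup_mconst_mult)
    thus ?thesis using that by (auto simp: in_keys_iff)
  qed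
  hence f: "mvars f \<subseteq> skew_vars n"
    using assms(3) unfolding skew_ring_def mvars_def by blast
  obtain c :: 'a and \<alpha> where c: "c \<noteq> 0" and \<alpha>: "\<alpha> > 0" and n: "n > 0" and matrix:
    "\<And>M. \<exists>S D. (\<forall>i j. S j i = - S i j) \<and> (\<forall>i. S i i = 0) \<and>
       (\<forall>i j. rational_affine (S i j) \<and> vge 0 (S i j)) \<and>
       vge (D + M) (ev cst (\<lambda>(i, j). S i j) f - cst c * eps ^ D * (1 + eps * abp_poly P) ^ \<alpha>)"
    by (rule pfaffian_ideal_oracle_matrix[OF assms(1) f assms(2) P approximates_vge_0[OF g]], rule that)
  obtain e \<beta> where \<alpha>_eq: "\<alpha> = e * \<beta>" and e: "e > 0" and \<beta>: "of_nat \<beta> \<noteq> (0 :: 'a)"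
    and frob: "\<And>x :: ('v, 'a fls) mpoly. (1 + x) ^ e = 1 + x ^ e"
    and char: "CHAR('a) = 0 \<Longrightarrow> e = 1" "CHAR('a) > 0 \<Longrightarrow> \<exists>k. e = CHAR('a) ^ k"
    by (rule frobenius_exponent[OF \<alpha>, where 'a = 'a and 'v = 'v], rule that)
  \<comment> \<open>Precision \<open>e + 1\<close> reaches just beyond the term of relative order
    \<open>e\<close> that carries \<open>g ^ e\<close>.\<close>
  obtain S D where skew: "\<And>i j. S j i = - S i j" "\<And>i. S i i = 0"
    and S: "\<And>i j. rational_affine (S i j)" "\<And>i j. vge 0 (S i j)"
    and lead: "vge (D + (e + 1)) (ev cst (\<lambda>(i, j). S i j) f -
      cst c * eps ^ D * (1 + eps * abp_poly P) ^ (e * \<beta>))"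
    using matrix[of "e + 1"] unfolding \<alpha>_eq by blast
  \<comment> \<open>The rescaling sends the error of the oracle to the same order as the error of
    the leading term, so it cannot mask the term to be extracted.\<close>
  define q where "q = D + (e + 1)"
  have q: "q \<ge> 1" by (simp add: q_def)
  have "vge q (oracle_value h q S - ev cst (\<lambda>(i, j). S i j) f)"
    by (rule oracle_value_approximates[OF E q S(2)])
  from vge_add[OF this lead[folded q_def]]
  have "vge (D + (e + 1)) (oracle_value h q S -
      cst c * eps ^ D * (1 + eps * abp_poly P) ^ (e * \<beta>))"
    by (simp add: q_def)
  from approximates_from_leading_term[OF c \<beta> e frob this g]
  have approx: "approximates (mconst \<gamma> * oracle_value h q S + mconst \<delta>) (g ^ e)"
    if "\<gamma> = fls_const (inverse (c * of_nat \<beta>)) * inverse (fls_X ^ (D + e))"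
      "\<delta> = - (\<gamma> * (fls_const c * fls_X ^ D))" for \<gamma> \<delta>
    unfolding that .
  define \<gamma> :: "'a fls" where "\<gamma> = fls_const (inverse (c * of_nat \<beta>)) * inverse (fls_X ^ (D + e))"
  define \<delta> where "\<delta> = - (\<gamma> * (fls_const c * fls_X ^ D))"
  have "\<gamma> \<in> eps_rational_functions" unfolding \<gamma>_def
    by (intro eps_rational_mult eps_rational_const eps_rational_inverse eps_rational_X_power)
  moreover from this have "\<delta> \<in> eps_rational_functions" unfolding \<delta>_def
    by (intro eps_rational_uminus eps_rational_mult eps_rational_const eps_rational_X_power)
  ultimately obtain \<Phi> :: "('v, 'a fls) circuit" where \<Phi>:
    "oracle_circuit_over eps_rational_functions n \<Phi>" "depth_three_oracle_circuit n \<Phi>"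
    "computes n h \<Phi> (mconst \<gamma> * oracle_value h q S + mconst \<delta>)"
    using depth_three_circuit_exists[of n q h S \<gamma> \<delta>, OF n q assms(3) S(1) skew] by blast
  show ?thesis
  proof (intro exI[of _ \<Phi>] conjI impI \<Phi>(1,2))
    assume "CHAR('a) = 0"
    hence "e = 1" by (rule char(1))
    have "approximates (mconst \<gamma> * oracle_value h q S + mconst \<delta>) g"
      using approx[OF \<gamma>_def \<delta>_def] unfolding \<open>e = 1\<close> power_one_right .
    with \<Phi>(3) show "\<exists>P. computes n h \<Phi> P \<and> approximates P g" by (intro exI conjI)
  next
    assume "CHAR('a) > 0"
    then obtain k where "e = CHAR('a) ^ k" using char(2) by blast
    have "approximates (mconst \<gamma> * oracle_value h q S + mconst \<delta>) (g ^ (CHAR('a) ^ k))"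
      using approx[OF \<gamma>_def \<delta>_def] unfolding \<open>e = CHAR('a) ^ k\<close> .
    with \<Phi>(3) show "\<exists>k. \<exists>P. computes n h \<Phi> P \<and> approximates P (g ^ (CHAR('a) ^ k))"
      by (intro exI conjI)
  qed
qed

end
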